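(* For any nonnegative integer $s$ and any $\delta \in \{0,1\}$, the set $$\left\{ \zeta_2\left(j,\tfrac{1}{4}\right) \;\middle|\; j \in \mathbb{Z}\cap[s+3,3s+5],\ j \equiv \delta \pmod{2} \right\}$$ contains at least one irrational number (i.e. an element of $\mathbb{Q}_2$ not lying in $\mathbb{Q}$).
   Context: Volkenborn integral: for $f:\mathbb{Z}_2\to\mathbb{Q}_2$, $\int_{\mathbb{Z}_2} f(t)\,\mathrm{d}t := \lim_{N\to\infty}\frac{1}{2^N}\sum_{k=0}^{2^N-1} f(k)$ whenever the limit exists $2$-adically. Teichmüller character for $p=2$: for $x\in\mathbb{Z}_2^\times$, $\omega(x)\in\{1,-1\}$ is the unique sign with $x\equiv\omega(x)\pmod{4\mathbb{Z}_2}$; for $x\in\mathbb{Q}_2^\times$, $\omega(x):=2^{v_2(x)}\omega(x/2^{v_2(x)})$ and $\langle x\rangle:=x/\omega(x)$. $2$-adic Hurwitz zeta function: for $x\in\mathbb{Q}_2$ with $|x|_2\geqslant 4$ and an integer $j\geqslant 2$, $\zeta_2(j,x):=\frac{1}{j-1}\int_{\mathbb{Z}_2}\langle t+x\rangle^{1-j}\,\mathrm{d}t\in\mathbb{Q}_2$. *)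

theory Defs
  imports "HOL-Analysis.Analysis" "HOL-Number_Theory.Cong"
begin

section \<open>The 2-adic absolute value on the rationals\<close>

text \<open>The value at 0 is irrelevant.\<close>

definition rat_val2 :: "rat \<Rightarrow> int" where
  "rat_val2 q = int (multiplicity 2 (fst (quotient_of q))) - int (multiplicity 2 (snd (quotient_of q)))"

definition rat_abs2 :: "rat \<Rightarrow> real" where
  "rat_abs2 q = (if q = 0 then 0 else 2 powi (- rat_val2 q))"

lemma multiplicity2_mult:
  fixes a b :: int
  assumes "a \<noteq> 0" "b \<noteq> 0"
  shows "multiplicity 2 (a * b) = multiplicity 2 a + multiplicity 2 b"
  using assms by (intro prime_elem_multiplicity_mult_distrib) auto

lemma rat_val2_divide:
  fixes a b :: int
  assumes "a \<noteq> 0" "b \<noteq> 0"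
  shows "rat_val2 (of_int a / of_int b) = int (multiplicity 2 a) - int (multiplicity 2 b)"
proof -
  define q :: rat where "q = of_int a / of_int b"
  obtain c d where cd: "quotient_of q = (c, d)" by fastforce
  have d: "d > 0" using quotient_of_denom_pos[OF cd] .
  have q: "q = of_int c / of_int d" using quotient_of_div[OF cd] .
  have "q \<noteq> 0" using assms by (simp add: q_def)
  then have c: "c \<noteq> 0" using q by auto
  have "(of_int (a * d) :: rat) = of_int (c * b)"
    using q assms d unfolding q_def by (simp add: field_simps)
  then have "a * d = c * b" by (simp only: of_int_eq_iff)
  then have "multiplicity 2 a + multiplicity 2 d = multiplicity 2 c + multiplicity 2 b"
    using multiplicity2_mult[of a d] multiplicity2_mult[of c b] assms c d by simp
  then show ?thesis unfolding rat_val2_def q_def[symmetric] cd by simp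
qed

lemma rat_abs2_0 [simp]: "rat_abs2 0 = 0"
  by (simp add: rat_abs2_def)

lemma rat_abs2_nonneg [simp]: "rat_abs2 x \<ge> 0"
  by (simp add: rat_abs2_def)

lemma rat_abs2_eq_0_iff [simp]: "rat_abs2 x = 0 \<longleftrightarrow> x = 0"
  by (simp add: rat_abs2_def)

lemma rat_as_fraction:
  obtains a b :: int where "b \<noteq> 0" "(x :: rat) = of_int a / of_int b"
proof -
  obtain a b where ab: "quotient_of x = (a, b)" by fastforce
  have "b \<noteq> 0" using quotient_of_denom_pos[OF ab] by simp
  then show ?thesis using quotient_of_div[OF ab] by (rule that)
qed

lemma rat_abs2_mult: "rat_abs2 (x * y) = rat_abs2 x * rat_abs2 y"
proof (cases "x = 0 \<or> y = 0")
  case False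
  obtain a b where x: "b \<noteq> 0" "x = of_int a / of_int b" by (rule rat_as_fraction)
  obtain c d where y: "d \<noteq> 0" "y = of_int c / of_int d" by (rule rat_as_fraction)
  have ac: "a \<noteq> 0" "c \<noteq> 0" using False x y by auto
  have xy: "x * y = of_int (a * c) / of_int (b * d)" using x y by simp
  have "rat_val2 (x * y) = rat_val2 x + rat_val2 y"
    using x y ac rat_val2_divide[of "a * c" "b * d"] unfolding xy
    by (simp add: rat_val2_divide multiplicity2_mult)
  then show ?thesis using False
    by (simp add: rat_abs2_def power_int_diff power_int_minus field_simps power_int_add)
qed auto

lemma rat_abs2_1 [simp]: "rat_abs2 1 = 1"
  using rat_abs2_mult[of 1 1] by simp

lemma rat_abs2_minus [simp]: "rat_abs2 (- x) = rat_abs2 x"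
proof -
  have "rat_abs2 (-1) * rat_abs2 (-1) = 1" using rat_abs2_mult[of "-1" "-1"] by simp
  then have "rat_abs2 (-1) = 1"
    using rat_abs2_nonneg[of "-1"] by (metis abs_of_nonneg abs_square_eq_1 power2_eq_square)
  then show ?thesis using rat_abs2_mult[of "-1" x] by simp
qed

lemma rat_abs2_inverse: "rat_abs2 (inverse x) = inverse (rat_abs2 x)"
proof (cases "x = 0")
  case False
  then have "rat_abs2 x * rat_abs2 (inverse x) = 1" using rat_abs2_mult[of x "inverse x"] by simp
  then show ?thesis by (metis inverse_unique)
qed simp

lemma rat_abs2_ultra: "rat_abs2 (x + y) \<le> max (rat_abs2 x) (rat_abs2 y)"
proof (cases "x = 0 \<or> y = 0 \<or> x + y = 0")
  case True
  then show ?thesis by (auto simp: le_max_iff_disj)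
next
  case False
  obtain a b where x: "b \<noteq> 0" "x = of_int a / of_int b" by (rule rat_as_fraction)
  obtain c d where y: "d \<noteq> 0" "y = of_int c / of_int d" by (rule rat_as_fraction)
  define m n where "m = a * d" and "n = c * b"
  have x': "x = of_int m / of_int (b * d)" and y': "y = of_int n / of_int (b * d)"
    and xy': "x + y = of_int (m + n) / of_int (b * d)"
    using x y by (simp_all add: m_def n_def field_simps)
  have bd: "b * d \<noteq> 0" using x y by simp
  have nz: "m \<noteq> 0" "n \<noteq> 0" "m + n \<noteq> 0" using False x' y' xy' by auto
  define k where "k = min (multiplicity 2 m) (multiplicity 2 n)"
  have "2 ^ k dvd m" "2 ^ k dvd n"
    unfolding k_def by (auto intro: multiplicity_dvd')
  then have "2 ^ k dvd m + n" by simp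
  then have "k \<le> multiplicity 2 (m + n)" using nz by (intro multiplicity_geI) auto
  then have "rat_val2 (x + y) \<ge> min (rat_val2 x) (rat_val2 y)"
    unfolding xy' rat_val2_divide[OF nz(3) bd]
    unfolding x' y' rat_val2_divide[OF nz(1) bd] rat_val2_divide[OF nz(2) bd]
    by (auto simp: k_def)
  then have "rat_val2 x \<le> rat_val2 (x + y) \<or> rat_val2 y \<le> rat_val2 (x + y)" by linarith
  moreover have "(2 :: real) powi (- j) \<le> 2 powi (- i)" if "i \<le> j" for i j :: int
    using that by (intro power_int_increasing) auto
  ultimately have "rat_abs2 (x + y) \<le> rat_abs2 x \<or> rat_abs2 (x + y) \<le> rat_abs2 y"
    using False unfolding rat_abs2_def by presburger
  then show ?thesis by (simp only: le_max_iff_disj)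
qed

lemma rat_abs2_triangle: "rat_abs2 (x + y) \<le> rat_abs2 x + rat_abs2 y"
proof -
  have "max (rat_abs2 x) (rat_abs2 y) \<le> rat_abs2 x + rat_abs2 y"
    by (rule max.boundedI) simp_all
  then show ?thesis by (rule order_trans[OF rat_abs2_ultra])
qed

lemma rat_abs2_triangle_diff: "\<bar>rat_abs2 x - rat_abs2 y\<bar> \<le> rat_abs2 (x - y)"
proof -
  have "rat_abs2 x \<le> rat_abs2 (x - y) + rat_abs2 y"
    using rat_abs2_triangle[of "x - y" y] by (simp only: diff_add_cancel)
  moreover have "rat_abs2 y \<le> rat_abs2 (x - y) + rat_abs2 x"
    using rat_abs2_triangle[of "y - x" x] rat_abs2_minus[of "x - y"]
    by (simp only: diff_add_cancel minus_diff_eq)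
  ultimately show ?thesis by linarith
qed


section \<open>The field of 2-adic numbers as the completion of the rationals\<close>

definition cauchy2 :: "(nat \<Rightarrow> rat) \<Rightarrow> bool" where
  "cauchy2 X \<longleftrightarrow> (\<forall>e>0. \<exists>M. \<forall>m\<ge>M. \<forall>n\<ge>M. rat_abs2 (X m - X n) < e)"

lemma cauchy2D: "cauchy2 X \<Longrightarrow> e > 0 \<Longrightarrow> \<exists>M. \<forall>m\<ge>M. \<forall>n\<ge>M. rat_abs2 (X m - X n) < e"
  by (simp add: cauchy2_def)

definition null2 :: "(nat \<Rightarrow> rat) \<Rightarrow> bool" where
  "null2 X \<longleftrightarrow> (\<lambda>n. rat_abs2 (X n)) \<longlonglongrightarrow> 0"

lemma null2_add: assumes "null2 X" "null2 Y" shows "null2 (\<lambda>n. X n + Y n)"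
proof -
  have "(\<lambda>n. rat_abs2 (X n) + rat_abs2 (Y n)) \<longlonglongrightarrow> 0"
    using tendsto_add[OF assms[unfolded null2_def]] by simp
  then show ?thesis unfolding null2_def
    by (rule tendsto_sandwich[OF _ _ tendsto_const, rotated -1]) (auto simp: rat_abs2_triangle)
qed

lemma null2_minus: "null2 (\<lambda>n. - X n) \<longleftrightarrow> null2 X"
  by (simp add: null2_def)

lemma null2_diff_commute: "null2 (\<lambda>n. X n - Y n) \<longleftrightarrow> null2 (\<lambda>n. Y n - X n)"
  using null2_minus[of "\<lambda>n. X n - Y n"] by simp

lemma null2_diff: "null2 X \<Longrightarrow> null2 Y \<Longrightarrow> null2 (\<lambda>n. X n - Y n)"
  using null2_add[of X "\<lambda>n. - Y n"] by (simp add: null2_minus)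

lemma null2_const [simp]: "null2 (\<lambda>n. c) \<longleftrightarrow> c = 0"
  by (simp add: null2_def LIMSEQ_const_iff)

lemma cauchy2_const [simp]: "cauchy2 (\<lambda>n. c)"
  by (simp add: cauchy2_def)

lemma cauchy2_minus: "cauchy2 (\<lambda>n. - X n) \<longleftrightarrow> cauchy2 X"
proof -
  have "rat_abs2 (- X m - - X n) = rat_abs2 (X m - X n)" for m n
    using rat_abs2_minus[of "X m - X n"] by (simp del: rat_abs2_minus)
  then show ?thesis by (simp add: cauchy2_def)
qed

lemma cauchy2_add: assumes "cauchy2 X" "cauchy2 Y" shows "cauchy2 (\<lambda>n. X n + Y n)"
  unfolding cauchy2_def
proof (intro allI impI)
  fix e :: real assume "e > 0"
  then obtain M N where M: "\<forall>m\<ge>M. \<forall>n\<ge>M. rat_abs2 (X m - X n) < e"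
    and N: "\<forall>m\<ge>N. \<forall>n\<ge>N. rat_abs2 (Y m - Y n) < e"
    using cauchy2D[OF assms(1) \<open>e > 0\<close>] cauchy2D[OF assms(2) \<open>e > 0\<close>] by blast
  have "rat_abs2 ((X m + Y m) - (X n + Y n)) < e" if "m \<ge> max M N" "n \<ge> max M N" for m n
  proof -
    have "rat_abs2 (X m - X n) < e" "rat_abs2 (Y m - Y n) < e" using M N that by auto
    then show ?thesis using rat_abs2_ultra[of "X m - X n" "Y m - Y n"] by (simp add: add_diff_add)
  qed
  then show "\<exists>M. \<forall>m\<ge>M. \<forall>n\<ge>M. rat_abs2 (X m + Y m - (X n + Y n)) < e" by blast
qed

lemma cauchy2_abs: assumes "cauchy2 X" shows "convergent (\<lambda>n. rat_abs2 (X n))"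
proof -
  have "Cauchy (\<lambda>n. rat_abs2 (X n))"
    unfolding Cauchy_def dist_real_def
  proof (intro allI impI)
    fix e :: real assume "e > 0"
    then obtain M where "\<forall>m\<ge>M. \<forall>n\<ge>M. rat_abs2 (X m - X n) < e"
      using cauchy2D[OF assms] by blast
    then show "\<exists>M. \<forall>m\<ge>M. \<forall>n\<ge>M. \<bar>rat_abs2 (X m) - rat_abs2 (X n)\<bar> < e"
      by (intro exI[of _ M] allI impI le_less_trans[OF rat_abs2_triangle_diff]) auto
  qed
  then show ?thesis by (simp add: Cauchy_convergent_iff)
qed

lemma cauchy2_bounded: assumes "cauchy2 X" obtains B where "B > 0" "\<And>n. rat_abs2 (X n) \<le> B"
proof -
  have "Bseq (\<lambda>n. rat_abs2 (X n))" using cauchy2_abs[OF assms] by (rule convergent_imp_Bseq)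
  then show ?thesis using that unfolding Bseq_def by auto
qed

lemma cauchy2_mult: assumes "cauchy2 X" "cauchy2 Y" shows "cauchy2 (\<lambda>n. X n * Y n)"
proof -
  obtain B where B: "B > 0" "\<And>n. rat_abs2 (X n) \<le> B" using cauchy2_bounded[OF assms(1)] by blast
  obtain C where C: "C > 0" "\<And>n. rat_abs2 (Y n) \<le> C" using cauchy2_bounded[OF assms(2)] by blast
  show ?thesis unfolding cauchy2_def
  proof (intro allI impI)
    fix e :: real assume e: "e > 0"
    have "e / (2 * C) > 0" using e C(1) by simp
    then obtain M where M: "\<forall>m\<ge>M. \<forall>n\<ge>M. rat_abs2 (X m - X n) < e / (2 * C)"
      using cauchy2D[OF assms(1)] by blast
    have "e / (2 * B) > 0" using e B(1) by simp
    then obtain N where N: "\<forall>m\<ge>N. \<forall>n\<ge>N. rat_abs2 (Y m - Y n) < e / (2 * B)"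
      using cauchy2D[OF assms(2)] by blast
    have "rat_abs2 (X m * Y m - X n * Y n) < e" if "m \<ge> max M N" "n \<ge> max M N" for m n
    proof -
      have "rat_abs2 (X m * Y m - X n * Y n) = rat_abs2 (X m * (Y m - Y n) + (X m - X n) * Y n)"
        by (simp add: algebra_simps)
      also have "\<dots> \<le> rat_abs2 (X m) * rat_abs2 (Y m - Y n) + rat_abs2 (X m - X n) * rat_abs2 (Y n)"
        by (metis rat_abs2_triangle rat_abs2_mult)
      also have "\<dots> \<le> B * rat_abs2 (Y m - Y n) + rat_abs2 (X m - X n) * C"
        by (intro add_mono mult_right_mono mult_left_mono B C) auto
      also have "\<dots> < B * (e / (2 * B)) + e / (2 * C) * C"
        using M N that B C by (intro add_strict_mono mult_strict_left_mono mult_strict_right_mono) auto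
      also have "\<dots> = e" using B C by simp
      finally show ?thesis .
    qed
    then show "\<exists>M. \<forall>m\<ge>M. \<forall>n\<ge>M. rat_abs2 (X m * Y m - X n * Y n) < e" by blast
  qed
qed

lemma null2_mult: assumes "null2 X" "cauchy2 Y" shows "null2 (\<lambda>n. X n * Y n)"
proof -
  obtain L where L: "(\<lambda>n. rat_abs2 (Y n)) \<longlonglongrightarrow> L"
    using cauchy2_abs[OF assms(2)] unfolding convergent_def by blast
  show ?thesis using tendsto_mult[OF assms(1)[unfolded null2_def] L]
    by (simp add: null2_def rat_abs2_mult)
qed

lemma cauchy2_not_null2:
  assumes "cauchy2 X" "\<not> null2 X"
  obtains b M where "b > 0" "\<And>n. n \<ge> M \<Longrightarrow> rat_abs2 (X n) > b"
proof -
  obtain L where L: "(\<lambda>n. rat_abs2 (X n)) \<longlonglongrightarrow> L"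
    using cauchy2_abs[OF assms(1)] unfolding convergent_def by blast
  have "L \<ge> 0" using L by (rule LIMSEQ_le_const) auto
  moreover have "L \<noteq> 0" using assms(2) L by (auto simp: null2_def)
  ultimately have "L > 0" by simp
  then have "\<forall>\<^sub>F n in sequentially. rat_abs2 (X n) > L / 2"
    using L by (intro order_tendstoD) auto
  then show ?thesis using that[of "L / 2"] \<open>L > 0\<close> by (auto simp: eventually_sequentially)
qed

lemma rat_abs2_inverse_diff:
  assumes "x \<noteq> 0" "y \<noteq> 0"
  shows "rat_abs2 (inverse x - inverse y) = rat_abs2 (x - y) / (rat_abs2 x * rat_abs2 y)"
proof -
  have "inverse x - inverse y = - ((x - y) * inverse x * inverse y)"
    using assms by (simp add: field_simps)
  then show ?thesis by (simp add: rat_abs2_mult rat_abs2_inverse divide_inverse)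
qed

lemma cauchy2_inverse:
  assumes "cauchy2 X" "\<not> null2 X"
  shows "cauchy2 (\<lambda>n. inverse (X n))"
proof -
  obtain b M where b: "b > 0" "\<And>n. n \<ge> M \<Longrightarrow> rat_abs2 (X n) > b"
    using cauchy2_not_null2[OF assms] by blast
  show ?thesis unfolding cauchy2_def
  proof (intro allI impI)
    fix e :: real assume e: "e > 0"
    have "e * (b * b) > 0" using e b(1) by simp
    then obtain N where N: "\<forall>m\<ge>N. \<forall>n\<ge>N. rat_abs2 (X m - X n) < e * (b * b)"
      using cauchy2D[OF assms(1)] by blast
    have "rat_abs2 (inverse (X m) - inverse (X n)) < e" if "m \<ge> max M N" "n \<ge> max M N" for m n
    proof -
      have bm: "rat_abs2 (X m) > b" "rat_abs2 (X n) > b" using b that by auto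
      then have nz: "X m \<noteq> 0" "X n \<noteq> 0" using b(1) by auto
      have "b * b < rat_abs2 (X m) * rat_abs2 (X n)"
        using bm b(1) by (intro mult_strict_mono) auto
      then have "e * (b * b) \<le> e * (rat_abs2 (X m) * rat_abs2 (X n))" using e by simp
      moreover have "rat_abs2 (X m - X n) < e * (b * b)" using N that by simp
      ultimately have "rat_abs2 (X m - X n) < e * (rat_abs2 (X m) * rat_abs2 (X n))" by linarith
      moreover have "rat_abs2 (X m) * rat_abs2 (X n) > 0"
        using bm b(1) by (intro mult_pos_pos) auto
      ultimately show ?thesis by (simp add: rat_abs2_inverse_diff[OF nz] pos_divide_less_eq)
    qed
    then show "\<exists>M. \<forall>m\<ge>M. \<forall>n\<ge>M. rat_abs2 (inverse (X m) - inverse (X n)) < e" by blast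
  qed
qed

lemma null2_inverse_diff:
  assumes X: "cauchy2 X" "\<not> null2 X" and Y: "cauchy2 Y" "\<not> null2 Y"
    and XY: "null2 (\<lambda>n. X n - Y n)"
  shows "null2 (\<lambda>n. inverse (X n) - inverse (Y n))"
proof -
  have lim: "null2 (\<lambda>n. (X n - Y n) * (inverse (X n) * inverse (Y n)))"
    by (intro null2_mult cauchy2_mult cauchy2_inverse assms)
  obtain b M where b: "b > 0" "\<And>n. n \<ge> M \<Longrightarrow> rat_abs2 (X n) > b"
    using cauchy2_not_null2[OF X] by blast
  obtain c N where c: "c > 0" "\<And>n. n \<ge> N \<Longrightarrow> rat_abs2 (Y n) > c"
    using cauchy2_not_null2[OF Y] by blast
  have "rat_abs2 (inverse (X n) - inverse (Y n))
      = rat_abs2 ((X n - Y n) * (inverse (X n) * inverse (Y n)))" if "n \<ge> max M N" for n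
  proof -
    have "rat_abs2 (X n) > 0" "rat_abs2 (Y n) > 0" using b(1) b(2)[of n] c(1) c(2)[of n] that by auto
    then have "X n \<noteq> 0" "Y n \<noteq> 0" by auto
    then show ?thesis
      by (simp add: rat_abs2_inverse_diff rat_abs2_mult rat_abs2_inverse divide_inverse)
  qed
  then have ev: "\<forall>\<^sub>F n in sequentially. rat_abs2 ((X n - Y n) * (inverse (X n) * inverse (Y n)))
      = rat_abs2 (inverse (X n) - inverse (Y n))"
    unfolding eventually_sequentially by metis
  show ?thesis unfolding null2_def
    by (rule Lim_transform_eventually[OF lim[unfolded null2_def] ev])
qed

definition q2rel :: "(nat \<Rightarrow> rat) \<Rightarrow> (nat \<Rightarrow> rat) \<Rightarrow> bool" where
  "q2rel X Y \<longleftrightarrow> cauchy2 X \<and> cauchy2 Y \<and> null2 (\<lambda>n. X n - Y n)"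

lemma q2rel_refl: "cauchy2 X \<Longrightarrow> q2rel X X"
  by (simp add: q2rel_def)

lemma part_equivp_q2rel: "part_equivp q2rel"
proof (rule part_equivpI)
  show "\<exists>X. q2rel X X" using q2rel_refl[OF cauchy2_const] by blast
  show "symp q2rel" unfolding symp_def q2rel_def
    using null2_diff_commute by blast
  show "transp q2rel" unfolding transp_def q2rel_def
  proof (intro allI impI)
    fix X Y Z
    assume "cauchy2 X \<and> cauchy2 Y \<and> null2 (\<lambda>n. X n - Y n)"
      and "cauchy2 Y \<and> cauchy2 Z \<and> null2 (\<lambda>n. Y n - Z n)"
    then show "cauchy2 X \<and> cauchy2 Z \<and> null2 (\<lambda>n. X n - Z n)"
      using null2_add[of "\<lambda>n. X n - Y n" "\<lambda>n. Y n - Z n"] by simp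
  qed
qed

text \<open>\<open>class_q2 X\<close> is the limit of the Cauchy sequence \<open>X\<close>.\<close>

quotient_type q2 = "nat \<Rightarrow> rat" / partial: q2rel
  morphisms rep_q2 class_q2
  by (rule part_equivp_q2rel)

instantiation q2 :: field
begin

lift_definition zero_q2 :: q2 is "\<lambda>n. 0" by (simp add: q2rel_refl)

lift_definition one_q2 :: q2 is "\<lambda>n. 1" by (simp add: q2rel_refl)

lift_definition plus_q2 :: "q2 \<Rightarrow> q2 \<Rightarrow> q2" is "\<lambda>X Y n. X n + Y n"
  unfolding q2rel_def add_diff_add by (simp add: cauchy2_add null2_add)

lift_definition uminus_q2 :: "q2 \<Rightarrow> q2" is "\<lambda>X n. - X n"
  unfolding q2rel_def minus_diff_minus by (auto simp: cauchy2_minus intro: null2_diff_commute[THEN iffD1])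

lift_definition times_q2 :: "q2 \<Rightarrow> q2 \<Rightarrow> q2" is "\<lambda>X Y n. X n * Y n"
proof -
  fix X X' Y Y'
  assume "q2rel X X'" "q2rel Y Y'"
  then have "null2 (\<lambda>n. (X n - X' n) * Y n + (Y n - Y' n) * X' n)"
    and "cauchy2 (\<lambda>n. X n * Y n)" "cauchy2 (\<lambda>n. X' n * Y' n)"
    by (auto simp: q2rel_def intro!: null2_add null2_mult cauchy2_mult)
  then show "q2rel (\<lambda>n. X n * Y n) (\<lambda>n. X' n * Y' n)"
    unfolding q2rel_def by (simp add: algebra_simps)
qed

lift_definition inverse_q2 :: "q2 \<Rightarrow> q2"
  is "\<lambda>X. if null2 X then (\<lambda>n. 0) else (\<lambda>n. inverse (X n))"
proof -
  fix X Y
  assume XY: "q2rel X Y"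
  have "null2 X \<longleftrightarrow> null2 Y"
    using null2_diff[of X "\<lambda>n. X n - Y n"] null2_add[of "\<lambda>n. X n - Y n" Y] XY
    unfolding q2rel_def by auto
  then show "q2rel (if null2 X then (\<lambda>n. 0) else (\<lambda>n. inverse (X n)))
     (if null2 Y then (\<lambda>n. 0) else (\<lambda>n. inverse (Y n)))"
    using XY by (auto simp: q2rel_def cauchy2_inverse null2_inverse_diff)
qed

definition "x - y = x + - y" for x y :: q2

definition "x div y = x * inverse y" for x y :: q2

instance
proof
  fix a b c :: q2
  show "a * b * c = a * (b * c)"
    by transfer (simp add: ac_simps q2rel_def cauchy2_mult)
  show "a * b = b * a"
    by transfer (simp add: ac_simps q2rel_def cauchy2_mult)
  show "1 * a = a"
    by transfer (simp add: q2rel_def)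
  show "a + b + c = a + (b + c)"
    by transfer (simp add: ac_simps q2rel_def cauchy2_add)
  show "a + b = b + a"
    by transfer (simp add: ac_simps q2rel_def cauchy2_add)
  show "0 + a = a"
    by transfer (simp add: q2rel_def)
  show "- a + a = 0"
    by transfer (simp add: q2rel_def cauchy2_add cauchy2_minus)
  show "a - b = a + - b"
    by (rule minus_q2_def)
  show "(a + b) * c = a * c + b * c"
    by transfer (simp add: distrib_right q2rel_def cauchy2_mult cauchy2_add)
  show "(0 :: q2) \<noteq> 1"
    by transfer (simp add: q2rel_def)
  show "a div b = a * inverse b"
    by (rule divide_q2_def)
  show "inverse (0 :: q2) = 0"
    by transfer (simp add: q2rel_def)
  show "inverse a * a = 1" if "a \<noteq> 0"
    using that
  proof transfer
    fix X assume XX: "q2rel X X" and "\<not> q2rel X (\<lambda>n. 0)"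
    then have X: "cauchy2 X" "\<not> null2 X" by (auto simp: q2rel_def)
    obtain b M where b: "b > 0" "\<And>n. n \<ge> M \<Longrightarrow> rat_abs2 (X n) > b"
      using cauchy2_not_null2[OF X] by blast
    have "rat_abs2 (inverse (X n) * X n - 1) = 0" if "n \<ge> M" for n
    proof -
      have "X n \<noteq> 0" using b(1) b(2)[OF that] by auto
      then show ?thesis by simp
    qed
    then have "\<forall>\<^sub>F n in sequentially. rat_abs2 (inverse (X n) * X n - 1) = 0"
      unfolding eventually_sequentially by blast
    then have "null2 (\<lambda>n. inverse (X n) * X n - 1)"
      unfolding null2_def by (rule tendsto_eventually)
    then show "q2rel (\<lambda>n. (if null2 X then (\<lambda>n. 0) else (\<lambda>n. inverse (X n))) n * X n) (\<lambda>n. 1)"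
      using X by (simp add: q2rel_def cauchy2_mult cauchy2_inverse)
  qed
qed

end

lemma of_nat_q2_transfer: "of_nat k = class_q2 (\<lambda>n. of_nat k)"
proof (induction k)
  case 0
  then show ?case by (simp add: zero_q2.abs_eq)
next
  case (Suc k)
  then show ?case
    by (simp add: one_q2.abs_eq plus_q2.abs_eq q2rel_refl)
qed

lemma class_q2_eq_iff: "cauchy2 X \<Longrightarrow> cauchy2 Y \<Longrightarrow> class_q2 X = class_q2 Y \<longleftrightarrow> null2 (\<lambda>n. X n - Y n)"
  using Quotient3_rel[OF Quotient3_q2, of X Y] by (auto simp: q2rel_def)

instance q2 :: field_char_0
proof
  show "inj (of_nat :: nat \<Rightarrow> q2)"
    by (rule injI) (simp add: of_nat_q2_transfer class_q2_eq_iff)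
qed

lemma uminus_q2_abs: "cauchy2 X \<Longrightarrow> - class_q2 X = class_q2 (\<lambda>n. - X n)"
  by (simp add: uminus_q2.abs_eq q2rel_refl)

lemma of_int_q2: "(of_int k :: q2) = class_q2 (\<lambda>n. of_int k)"
  by (cases k rule: int_cases2) (simp_all add: of_nat_q2_transfer uminus_q2_abs)

lemma diff_q2_abs: "cauchy2 X \<Longrightarrow> cauchy2 Y \<Longrightarrow> class_q2 X - class_q2 Y = class_q2 (\<lambda>n. X n - Y n)"
  by (simp add: minus_q2_def uminus_q2_abs plus_q2.abs_eq q2rel_refl cauchy2_minus)

lemma of_rat_q2: "(of_rat r :: q2) = class_q2 (\<lambda>n. r)"
proof -
  obtain a b where r: "b \<noteq> 0" "r = of_int a / of_int b" by (rule rat_as_fraction)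
  have "(of_rat r :: q2) * of_int b = of_int a"
    using r by (simp add: of_rat_divide)
  moreover have "class_q2 (\<lambda>n. r) * of_int b = of_int a"
    using r by (simp add: of_int_q2 times_q2.abs_eq q2rel_refl)
  ultimately show ?thesis using r(1) by (metis mult_cancel_right of_int_eq_0_iff)
qed

lift_definition norm2 :: "q2 \<Rightarrow> real" is "\<lambda>X. lim (\<lambda>n. rat_abs2 (X n))"
proof -
  fix X Y assume XY: "q2rel X Y"
  then obtain L where L: "(\<lambda>n. rat_abs2 (X n)) \<longlonglongrightarrow> L"
    using cauchy2_abs unfolding convergent_def q2rel_def by blast
  have "(\<lambda>n. rat_abs2 (X n - Y n)) \<longlonglongrightarrow> 0" using XY by (simp add: q2rel_def null2_def)
  then have "(\<lambda>n. rat_abs2 (X n) - rat_abs2 (Y n)) \<longlonglongrightarrow> 0"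
    by (rule tendsto_0_le[where K = 1]) (auto simp: rat_abs2_triangle_diff)
  then have "(\<lambda>n. rat_abs2 (Y n)) \<longlonglongrightarrow> L"
    using tendsto_diff[OF L] by fastforce
  then show "lim (\<lambda>n. rat_abs2 (X n)) = lim (\<lambda>n. rat_abs2 (Y n))"
    using L by (simp add: limI)
qed

lemma norm2_tendsto:
  assumes "cauchy2 X"
  shows "(\<lambda>n. rat_abs2 (X n)) \<longlonglongrightarrow> norm2 (class_q2 X)"
  using cauchy2_abs[OF assms] by (simp add: norm2.abs_eq q2rel_refl assms convergent_LIMSEQ_iff)

lemma q2_cases: obtains X where "cauchy2 X" "x = class_q2 X"
  using Quotient3_abs_rep[OF Quotient3_q2] Quotient3_rep_reflp[OF Quotient3_q2] q2rel_def by metis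

lemma norm2_nonneg [simp]: "norm2 (x :: q2) \<ge> 0"
  by (cases x rule: q2_cases) (auto intro: LIMSEQ_le_const[OF norm2_tendsto])

lemma norm2_eq_0_iff [simp]: "norm2 (x :: q2) = 0 \<longleftrightarrow> x = 0"
proof (cases x rule: q2_cases)
  case (1 X)
  have "norm2 x = 0 \<longleftrightarrow> null2 X" unfolding null2_def 1
    using norm2_tendsto[OF 1(1)] LIMSEQ_unique by fastforce
  then show ?thesis using class_q2_eq_iff[OF 1(1) cauchy2_const[of 0]] 1 by (simp add: zero_q2.abs_eq)
qed

lemma norm2_of_rat [simp]: "norm2 (of_rat r :: q2) = rat_abs2 r"
  using norm2_tendsto[of "\<lambda>n. r"] by (simp add: of_rat_q2 LIMSEQ_const_iff)

lemma norm2_mult: "norm2 (x * y :: q2) = norm2 x * norm2 y"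
proof (cases x rule: q2_cases; cases y rule: q2_cases)
  fix X Y assume *: "cauchy2 X" "x = class_q2 X" "cauchy2 Y" "y = class_q2 Y"
  have "(\<lambda>n. rat_abs2 (X n * Y n)) \<longlonglongrightarrow> norm2 x * norm2 y"
    using tendsto_mult[OF norm2_tendsto norm2_tendsto] * by (simp add: rat_abs2_mult)
  moreover have "(\<lambda>n. rat_abs2 (X n * Y n)) \<longlonglongrightarrow> norm2 (x * y)"
    using norm2_tendsto[OF cauchy2_mult] * by (simp add: times_q2.abs_eq q2rel_refl)
  ultimately show ?thesis using LIMSEQ_unique by blast
qed

lemma norm2_minus [simp]: "norm2 (- x :: q2) = norm2 x"
proof (cases x rule: q2_cases)
  case (1 X)
  then show ?thesis using norm2_tendsto[of "\<lambda>n. - X n"] norm2_tendsto[of X]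
    by (auto simp: uminus_q2_abs cauchy2_minus intro: LIMSEQ_unique)
qed

lemma norm2_ultra: "norm2 (x + y :: q2) \<le> max (norm2 x) (norm2 y)"
proof (cases x rule: q2_cases; cases y rule: q2_cases)
  fix X Y assume *: "cauchy2 X" "x = class_q2 X" "cauchy2 Y" "y = class_q2 Y"
  have "(\<lambda>n. max (rat_abs2 (X n)) (rat_abs2 (Y n))) \<longlonglongrightarrow> max (norm2 x) (norm2 y)"
    using tendsto_max[OF norm2_tendsto norm2_tendsto] * by simp
  moreover have "(\<lambda>n. rat_abs2 (X n + Y n)) \<longlonglongrightarrow> norm2 (x + y)"
    using norm2_tendsto[OF cauchy2_add] * by (simp add: plus_q2.abs_eq q2rel_refl)
  ultimately show ?thesis
    using LIMSEQ_le[of "\<lambda>n. rat_abs2 (X n + Y n)" _ "\<lambda>n. max (rat_abs2 (X n)) (rat_abs2 (Y n))"]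
      rat_abs2_ultra by blast
qed

instantiation q2 :: metric_space
begin

definition "dist x y = norm2 (x - y)" for x y :: q2

definition uniformity_q2 :: "(q2 \<times> q2) filter" where
  "uniformity_q2 = (INF e\<in>{0 <..}. principal {(x, y). dist x y < e})"

definition open_q2 :: "q2 set \<Rightarrow> bool" where
  "open_q2 U \<longleftrightarrow> (\<forall>x\<in>U. eventually (\<lambda>(x', y). x' = x \<longrightarrow> y \<in> U) uniformity)"

instance
proof
  fix x y z :: q2
  show "dist x y = 0 \<longleftrightarrow> x = y" by (simp add: dist_q2_def)
  have "norm2 (x - y) \<le> max (norm2 (x - z)) (norm2 (z - y))"
    using norm2_ultra[of "x - z" "z - y"] by simp
  moreover have "norm2 (z - y) = norm2 (y - z)" using norm2_minus[of "y - z"] by simp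
  ultimately show "dist x y \<le> dist x z + dist y z"
    using norm2_nonneg[of "x - z"] norm2_nonneg[of "y - z"] unfolding dist_q2_def by linarith
qed (simp_all add: uniformity_q2_def open_q2_def)

end

lemma of_rat_tendsto_class_q2:
  assumes X: "cauchy2 X"
  shows "(\<lambda>k. of_rat (X k)) \<longlonglongrightarrow> class_q2 X"
  unfolding lim_sequentially
proof (intro allI impI)
  fix e :: real assume e: "e > 0"
  then have "e / 2 > 0" by simp
  then obtain M where M: "\<forall>m\<ge>M. \<forall>n\<ge>M. rat_abs2 (X m - X n) < e / 2"
    using cauchy2D[OF X] by blast
  have "dist (of_rat (X k)) (class_q2 X) < e" if k: "k \<ge> M" for k
  proof -
    have c: "cauchy2 (\<lambda>n. X k - X n)"
      using cauchy2_add[OF cauchy2_const cauchy2_minus[THEN iffD2, OF X], of "X k"] by simp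
    have "norm2 (class_q2 (\<lambda>n. X k - X n)) \<le> e / 2"
      using M k by (intro LIMSEQ_le_const2[OF norm2_tendsto[OF c]]) (auto intro!: exI[of _ M] less_imp_le)
    then show ?thesis using e by (simp add: dist_q2_def of_rat_q2 diff_q2_abs X)
  qed
  then show "\<exists>M. \<forall>k\<ge>M. dist (of_rat (X k)) (class_q2 X) < e" by blast
qed

theorem closure_Rats_q2: "closure (\<rat> :: q2 set) = UNIV"
proof -
  have "x \<in> closure \<rat>" for x :: q2
  proof (cases x rule: q2_cases)
    case (1 X)
    then show ?thesis
      using of_rat_tendsto_class_q2[OF 1(1)] unfolding closure_sequential
      by (intro exI[of _ "\<lambda>k. of_rat (X k)"]) auto
  qed
  then show ?thesis by blast
qed

instance q2 :: complete_space
proof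
  fix Y :: "nat \<Rightarrow> q2"
  assume Y: "Cauchy Y"
  have "\<exists>r. dist (of_rat r) (Y n) < inverse (real (Suc n))" for n
  proof -
    have "Y n \<in> closure \<rat>" by (simp add: closure_Rats_q2)
    then show ?thesis unfolding closure_approachable Rats_def by auto
  qed
  then obtain r where r: "\<And>n. dist (of_rat (r n)) (Y n) < inverse (real (Suc n))" by metis
  have d0: "(\<lambda>n. dist (of_rat (r n)) (Y n)) \<longlonglongrightarrow> 0"
    by (rule tendsto_sandwich[OF _ _ tendsto_const LIMSEQ_inverse_real_of_nat])
      (use r in \<open>simp_all add: less_imp_le del: of_nat_Suc\<close>)
  then have rY: "\<forall>e>0. \<exists>M. \<forall>n\<ge>M. dist (of_rat (r n)) (Y n) < e"
    by (simp add: lim_sequentially)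
  have "cauchy2 r" unfolding cauchy2_def
  proof (intro allI impI)
    fix e :: real assume e: "e > 0"
    then have e3: "e / 3 > 0" by simp
    then obtain M where M: "\<forall>n\<ge>M. dist (of_rat (r n)) (Y n) < e / 3" using rY by blast
    obtain N where N: "\<forall>m\<ge>N. \<forall>n\<ge>N. dist (Y m) (Y n) < e / 3"
      using Y e3 unfolding Cauchy_def by blast
    have "rat_abs2 (r m - r n) < e" if "m \<ge> max M N" "n \<ge> max M N" for m n
    proof -
      have "dist (of_rat (r m) :: q2) (of_rat (r n)) < e"
      proof (rule dist_triangle_third)
        show "dist (of_rat (r m)) (Y m) < e / 3" "dist (Y m) (Y n) < e / 3" using M N that by auto
        show "dist (Y n) (of_rat (r n)) < e / 3" using M that by (simp add: dist_commute)
      qed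
      then show ?thesis by (simp add: dist_q2_def flip: of_rat_diff)
    qed
    then show "\<exists>M. \<forall>m\<ge>M. \<forall>n\<ge>M. rat_abs2 (r m - r n) < e" by blast
  qed
  then have lim: "(\<lambda>k. of_rat (r k)) \<longlonglongrightarrow> class_q2 r" by (rule of_rat_tendsto_class_q2)
  have "Y \<longlonglongrightarrow> class_q2 r"
  proof (rule tendsto_dist_iff[THEN iffD2])
    have "(\<lambda>n. dist (of_rat (r n)) (Y n) + dist (of_rat (r n)) (class_q2 r)) \<longlonglongrightarrow> 0"
      using tendsto_add[OF d0 lim[THEN tendsto_dist_iff[THEN iffD1]]] by simp
    then show "(\<lambda>n. dist (Y n) (class_q2 r)) \<longlonglongrightarrow> 0"
      by (rule tendsto_sandwich[OF _ _ tendsto_const, rotated -1]) (auto simp: dist_triangle3)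
  qed
  then show "convergent Y" by (auto simp: convergent_def)
qed

lemma norm2_eq_power:
  fixes x :: q2
  assumes "x \<noteq> 0"
  shows "\<exists>!n :: int. norm2 x = 2 powi (- n)"
proof -
  have "x \<in> closure \<rat>" by (simp add: closure_Rats_q2)
  moreover have "norm2 x > 0" using assms by (simp add: less_le)
  ultimately obtain r where r: "dist (of_rat r) x < norm2 x"
    unfolding closure_approachable Rats_def by auto
  have "norm2 (of_rat r - x) < norm2 x" using r by (simp add: dist_q2_def)
  moreover have "norm2 x \<le> max (norm2 (x - of_rat r)) (norm2 (of_rat r :: q2))"
    using norm2_ultra[of "x - of_rat r" "of_rat r"] by simp
  moreover have "norm2 (of_rat r :: q2) \<le> max (norm2 (of_rat r - x)) (norm2 x)"
    using norm2_ultra[of "of_rat r - x" x] by simp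
  moreover have "norm2 (x - of_rat r) = norm2 (of_rat r - x)"
    using norm2_minus[of "x - of_rat r"] by simp
  ultimately have eq: "norm2 x = rat_abs2 r" by simp
  then have "r \<noteq> 0" using assms by auto
  then have "norm2 x = 2 powi (- rat_val2 r)" using eq by (simp add: rat_abs2_def)
  moreover have "m = n" if "(2 :: real) powi m = 2 powi n" for m n :: int
    using that power_int_strict_increasing[of m n "2 :: real"] power_int_strict_increasing[of n m "2 :: real"]
    by (cases m n rule: linorder_cases) auto
  ultimately show ?thesis by (metis neg_equal_iff_equal)
qed


section \<open>The 2-adic Hurwitz zeta function\<close>

definition Z2 :: "q2 set" where
  "Z2 = {x. norm2 x \<le> 1}"

text \<open>The value at 0 is irrelevant.\<close>

definition v2 :: "q2 \<Rightarrow> int" where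
  "v2 x = (THE n. norm2 x = 2 powi (- n))"

text \<open>The integral depends only on the values of the integrand at the natural numbers; it is
  unspecified when the limit does not exist.\<close>

definition volkenborn_integral :: "(q2 \<Rightarrow> q2) \<Rightarrow> q2" where
  "volkenborn_integral f = lim (\<lambda>N. 1 / 2 ^ N * (\<Sum>k<2 ^ N. f (of_nat k)))"

text \<open>Teichmueller character on the units of \<^const>\<open>Z2\<close>, and its extension to nonzero 2-adic
  numbers.\<close>

definition teichmueller_unit :: "q2 \<Rightarrow> q2" where
  "teichmueller_unit x = (THE e. e \<in> {1, -1} \<and> (\<exists>y\<in>Z2. x - e = 4 * y))"

definition teichmueller :: "q2 \<Rightarrow> q2" where
  "teichmueller x = 2 powi v2 x * teichmueller_unit (x / 2 powi v2 x)"

definition angle2 :: "q2 \<Rightarrow> q2" where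
  "angle2 x = x / teichmueller x"

text \<open>Meaningful for \<open>norm2 x \<ge> 4\<close> and \<open>j \<ge> 2\<close> only.\<close>

definition hurwitz_zeta2 :: "int \<Rightarrow> q2 \<Rightarrow> q2" where
  "hurwitz_zeta2 j x = 1 / of_int (j - 1) * volkenborn_integral (\<lambda>t. angle2 (t + x) powi (1 - j))"

end

theory Submission
  imports Defs "HOL-Number_Theory.Prime_Powers" "HOL-Computational_Algebra.Polynomial_FPS"
    "HOL-Computational_Algebra.Polynomial_Factorial" "HOL-Computational_Algebra.Field_as_Ring"
begin

text \<open>Let $b=s+2$, $n=2^r-1$, let $\varepsilon\in\{0,1\}$ have the parity of $s+1+\delta$, and put
  \[Q(u)=(u+2n)^\varepsilon\Bigl(\prod_{m=1}^n(u+4m-1)(u+4m-3)\Bigr)^b\prod_{k=0}^n(u+4k)^{-2b}.\]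
  Take the Volkenborn integral over $t$ of the Hasse derivative of order $b-2$ of $Q$ at $u=4t+1$. By
  partial fractions and the translation behaviour of the Volkenborn integral it is a rational linear form
  in 1 and the $\zeta_2(j,1/4)$. The symmetry $u\mapsto-4n-u$ removes the $j$ of the wrong parity, and
  the vanishing of the sum of the residues removes $j=s+2$.

  Splitting the integral over the residue classes modulo $2^r$ shows that one class dominates and gives
  its exact 2-adic absolute value, which is positive and about $16^{-nb}$. The denominators of the form are
  cleared by a number of archimedean size about $(16^n d_{2n}d_n^2)^b$, where $d_m$ is the least common
  multiple of $1,\dots,m$, and of 2-adic absolute value at most about $64^{-nb}$. If all the zeta values
  were rational, this would produce nonzero integers for which the product of the archimedean and the
  2-adic absolute value is about $(d_{2n}d_n^2/64^n)^b$. That product is at least 1; but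
  $\ln(d_{2n}d_n^2)$ is about $4n<6n\ln2$, and it suffices to have this for infinitely many $r$.\<close>

section \<open>A Chebyshev bound on dyadic scales\<close>

text \<open>The usual obstacle, that the linear form might vanish, is removed by the exact 2-adic
  value; this dictates \<open>n = 2 ^ r - 1\<close>. Then t+1, ..., t+n meet every residue class
  modulo 2^r except that of t, and their product is 2-adically largest when 2^r divides t. With a
  derivative of order b-2, two of the b copies of each linear factor always survive: (1+2t)^2 is
  congruent to 1 modulo 4, which outweighs the 2 in the denominators of the Bernoulli numbers. The
  zeros of order b at u = 1-4m serve a second purpose: the derivative of order b-1 vanishes there,
  which keeps prime powers beyond n out of the denominators of the rational part. The partial
  fraction coefficients grow only polynomially in n, so the archimedean size is that of the
  multiplier. The margin between 4 and 6 ln 2 = 4.158... is too narrow for Chebyshev's classical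
  psi(x) <= 1.1056 x + o(x); since infinitely many dyadic n suffice, an average over dyadic scales
  replaces the prime number theorem. All estimates are made on rational partial sums; if the zeta
  values are rational, the limit is rational too.\<close>

definition lcm_upto :: "nat \<Rightarrow> nat" where
  "lcm_upto n = Lcm {1..n}"

lemma lcm_upto_0 [simp]: "lcm_upto 0 = 1"
  by (simp add: lcm_upto_def)

lemma lcm_upto_Suc: "lcm_upto (Suc n) = lcm (Suc n) (lcm_upto n)"
  by (simp add: lcm_upto_def atLeastAtMostSuc_conv)

lemma lcm_upto_pos [simp]: "lcm_upto n > 0"
  by (induction n) (simp_all add: lcm_upto_Suc lcm_pos_nat)

lemma lcm_upto_neq_0 [simp]: "lcm_upto n \<noteq> 0"
  using lcm_upto_pos[of n] by linarith

lemma dvd_lcm_upto: "0 < k \<Longrightarrow> k \<le> n \<Longrightarrow> k dvd lcm_upto n"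
  by (simp add: lcm_upto_def)

lemma lcm_upto_dvd_mono: "m \<le> n \<Longrightarrow> lcm_upto m dvd lcm_upto n"
  by (auto simp: lcm_upto_def intro!: Lcm_least)

lemma prime_power_dvd_lcm_upto:
  assumes "prime p" "p ^ e dvd lcm_upto n" "e > 0"
  shows "p ^ e \<le> n"
  using assms(2)
proof (induction n)
  case 0
  then show ?case using assms(1,3) by (simp add: prime_nat_iff)
next
  case (Suc n)
  have "p ^ e dvd Suc n \<or> p ^ e dvd lcm_upto n"
  proof (rule ccontr)
    assume *: "\<not> ?thesis"
    have "multiplicity p (lcm (Suc n) (lcm_upto n)) = max (multiplicity p (Suc n)) (multiplicity p (lcm_upto n))"
      by (rule multiplicity_lcm) (simp_all add: assms(1))
    moreover have "multiplicity p (Suc n) < e" "multiplicity p (lcm_upto n) < e"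
      using * assms(1) by (auto intro!: multiplicity_lessI simp: prime_nat_iff)
    moreover have "multiplicity p (lcm_upto (Suc n)) \<ge> e"
      using Suc.prems assms(1) by (intro multiplicity_geI) (auto simp: prime_nat_iff)
    ultimately show False by (simp add: lcm_upto_Suc)
  qed
  then show ?case using Suc.IH by (auto dest: dvd_imp_le)
qed

definition chebyshev_psi :: "nat \<Rightarrow> real" where
  "chebyshev_psi n = (\<Sum>q=1..n. mangoldt q)"

text \<open>Passing from \<open>n\<close> to \<open>Suc n\<close> multiplies the lcm by
  \<open>p\<close> if \<open>Suc n\<close> is a power of the prime \<open>p\<close>. Otherwise it is
  unchanged, since a number above 1 that is not a prime power splits into two smaller coprime
  factors.\<close>

lemma ln_lcm_upto: "ln (real (lcm_upto n)) = chebyshev_psi n"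
proof (induction n)
  case 0
  then show ?case by (simp add: chebyshev_psi_def)
next
  case (Suc n)
  have psi: "chebyshev_psi (Suc n) = chebyshev_psi n + mangoldt (Suc n)"
    by (simp add: chebyshev_psi_def)
  show ?case
  proof (cases "primepow (Suc n)")
    case True
    then obtain p k where pk: "prime p" "k > 0" "Suc n = p ^ k"
      by (auto simp: primepow_def)
    define d where "d = lcm_upto n"
    have "p ^ (k - 1) < p ^ k" using pk prime_gt_1_nat[OF pk(1)]
      by (intro power_strict_increasing) auto
    then have "p ^ (k - 1) dvd d" using pk prime_gt_0_nat[OF pk(1)]
      unfolding d_def by (intro dvd_lcm_upto) auto
    then have g1: "p ^ (k - 1) dvd gcd (p ^ k) d" by (auto intro: le_imp_power_dvd)
    obtain i where i: "i \<le> k" "gcd (p ^ k) d = p ^ i"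
      using divides_primepow_nat[OF pk(1)] by (meson gcd_dvd1)
    have "i \<noteq> k"
    proof
      assume "i = k"
      then have "p ^ k dvd d" using i(2) by (metis gcd_dvd2)
      then have "p ^ k \<le> n" using prime_power_dvd_lcm_upto[OF pk(1) _ pk(2)] d_def by simp
      then show False using pk(3) by simp
    qed
    moreover have "k - 1 \<le> i" using g1 i(2) pk(1) by (simp add: dvd_power_iff_le prime_ge_2_nat)
    ultimately have "i = k - 1" using i(1) by linarith
    then have g: "gcd (p ^ k) d = p ^ (k - 1)" using i(2) by simp
    have "p ^ (k - 1) * lcm (p ^ k) d = p ^ k * d" using g prod_gcd_lcm_nat[of "p ^ k" d] by simp
    then have "p ^ (k - 1) * lcm (p ^ k) d = p ^ (k - 1) * (p * d)"
      using pk(2) by (cases k) (simp_all add: ac_simps)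
    then have "lcm (p ^ k) d = p * d" using prime_gt_0_nat[OF pk(1)] by simp
    then have "lcm (Suc n) (lcm_upto n) = p * lcm_upto n" by (simp only: pk(3) d_def)
    then have "lcm_upto (Suc n) = p * lcm_upto n" by (simp only: lcm_upto_Suc)
    moreover have "mangoldt (Suc n) = ln (real p)" using pk by (simp del: of_nat_Suc)
    ultimately show ?thesis using Suc psi prime_gt_0_nat[OF pk(1)] by (simp add: ln_mult)
  next
    case False
    have "Suc n dvd lcm_upto n"
    proof (cases "n = 0")
      case False
      obtain p where p: "prime p" "p dvd Suc n" using prime_factor_nat[of "Suc n"] False by auto
      define a where "a = p ^ multiplicity p (Suc n)"
      obtain b where b: "Suc n = a * b" "\<not> p dvd b"
        using multiplicity_decompose'[of "Suc n" p] p
        unfolding a_def by (metis Zero_not_Suc not_prime_unit)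
      have "multiplicity p (Suc n) > 0" using p by (simp add: prime_multiplicity_gt_zero_iff)
      then have a1: "a > 1" using prime_gt_1_nat[OF p(1)] unfolding a_def by (rule one_less_power[rotated])
      have "b \<noteq> 1"
      proof
        assume "b = 1"
        then have "Suc n = a" using b by simp
        moreover have "multiplicity p (Suc n) > 0" using p by (simp add: prime_multiplicity_gt_zero_iff)
        ultimately have "primepow (Suc n)" using p(1) unfolding a_def by (metis primepow_prime_power)
        then show False using \<open>\<not> primepow (Suc n)\<close> by simp
      qed
      moreover have "b > 0" using b(1) by (cases b) auto
      ultimately have b1: "b > 1" by simp
      have "a < Suc n" "b < Suc n" using b(1) a1 b1 by auto
      then have "a dvd lcm_upto n" "b dvd lcm_upto n" using a1 b1 by (auto intro!: dvd_lcm_upto)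
      moreover have "coprime a b" using b(2) p(1) by (simp add: a_def prime_imp_coprime)
      ultimately show ?thesis by (simp add: b(1) divides_mult)
    qed simp
    then have "lcm_upto (Suc n) = lcm_upto n" by (simp add: lcm_upto_Suc lcm_proj2_if_dvd_nat)
    then show ?thesis using Suc psi False by (simp add: mangoldt_def)
  qed
qed

section \<open>Chebyshev's identity for factorials\<close>

text \<open>Sum \<open>mangoldt_sum\<close> over the integers up to \<open>n\<close>. The range may
  exceed \<open>n\<close>, where the quotients vanish, so that the identities for \<open>N\<close>
  and \<open>N div k\<close> can be subtracted termwise.\<close>

lemma sum_mangoldt_div:
  assumes "n \<le> N"
  shows "(\<Sum>q=1..N. mangoldt q * real (n div q)) = ln (fact n :: real)"
  using assms
proof (induction n)
  case 0
  then show ?case by simp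
next
  case (Suc n)
  have div: "real (Suc n div q) = real (n div q) + (if q dvd Suc n then 1 else 0)" for q
    using div_Suc[of n q] by (auto simp: mod_eq_0_iff_dvd)
  have "(\<Sum>q=1..N. mangoldt q * real (Suc n div q)) =
      (\<Sum>q=1..N. mangoldt q * real (n div q)) + (\<Sum>q=1..N. if q dvd Suc n then mangoldt q else 0)"
    unfolding div sum.distrib[symmetric] by (intro sum.cong) (auto simp: algebra_simps)
  also have "(\<Sum>q=1..N. if q dvd Suc n then mangoldt q else 0) = (\<Sum>q | q dvd Suc n. mangoldt q :: real)"
  proof -
    have "{q. q dvd Suc n} = {q\<in>{1..N}. q dvd Suc n}"
      using Suc.prems by (auto dest: dvd_imp_le intro!: Nat.gr0I simp: Suc_le_eq)
    then show ?thesis by (simp only: sum.inter_filter finite_atLeastAtMost)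
  qed
  also have "\<dots> = ln (real (Suc n))" using mangoldt_sum[of "Suc n", where ?'a = real] by simp
  also have "(\<Sum>q=1..N. mangoldt q * real (n div q)) = ln (fact n :: real)"
    using Suc by simp
  also have "ln (fact n) + ln (real (Suc n)) = ln (fact (Suc n) :: real)"
    by (simp add: ln_mult del: of_nat_Suc)
  finally show ?case .
qed

lemma fact_add_le: "a + r \<le> B \<Longrightarrow> fact (a + r) \<le> (fact a :: nat) * B ^ r"
proof (induction r)
  case (Suc r)
  have "fact (a + Suc r) = (a + Suc r) * (fact (a + r) :: nat)" by simp
  also have "\<dots> \<le> B * (fact a * B ^ r)"
    using Suc by (intro mult_le_mono) auto
  finally show ?case by (simp add: ac_simps)
qed simp

text \<open>An elementary substitute for Stirling's formula: a multinomial coefficient with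
  \<open>k\<close> equal parts is one term in the expansion of \<open>k ^ (k * m)\<close>. The
  induction adds \<open>k\<close> factors at a time.\<close>

lemma fact_mult_le: "fact (k * m) \<le> (k :: nat) ^ (k * m) * fact m ^ k"
proof (induction m)
  case 0
  then show ?case by simp
next
  case (Suc m)
  have "fact (k * m + k) \<le> (fact (k * m) :: nat) * (k * Suc m) ^ k"
    by (rule fact_add_le) simp
  also have "\<dots> \<le> (k ^ (k * m) * fact m ^ k) * (k * Suc m) ^ k"
    by (rule mult_le_mono1[OF Suc.IH])
  also have "\<dots> = (k ^ (k * m) * k ^ k) * (fact m * Suc m) ^ k"
    by (simp only: power_mult_distrib mult.assoc mult.commute mult.left_commute)
  also have "\<dots> = k ^ (k * Suc m) * fact (Suc m) ^ k"
    by (simp add: power_add mult.commute)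
  finally show ?case by (simp add: add.commute)
qed

lemma fact_le_fact_div:
  assumes "k \<ge> 1" "N \<ge> 1"
  shows "fact N \<le> (k :: nat) ^ N * N ^ k * fact (N div k) ^ k"
proof -
  define m r where "m = N div k" and "r = N mod k"
  have N: "N = k * m + r" "r < k" using assms by (simp_all add: m_def r_def)
  have "fact N \<le> (fact (k * m) :: nat) * N ^ r" using fact_add_le[of "k * m" r N] N by simp
  also have "\<dots> \<le> (k ^ (k * m) * fact m ^ k) * N ^ k"
    using N assms by (intro mult_le_mono fact_mult_le power_increasing) auto
  also have "\<dots> \<le> (k ^ N * fact m ^ k) * N ^ k"
    using N assms by (intro mult_le_mono power_increasing) auto
  finally show ?thesis by (simp add: m_def ac_simps)
qed

text \<open>Since floor(N/q) mod k = floor(N/q) - k floor(N/(kq)), the left-hand side is the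
  logarithm of N! / (floor(N/k)!)^k. These weights are nonnegative and can be combined with any
  nonnegative coefficients.\<close>

lemma sum_mangoldt_div_mod:
  assumes "k \<ge> 1" "N \<ge> 1"
  shows "(\<Sum>q=1..N. mangoldt q * real ((N div q) mod k)) \<le> real N * ln (real k) + real k * ln (real N)"
proof -
  have "real ((N div q) mod k) = real (N div q) - real k * real (N div k div q)" for q
  proof -
    have "N div q = k * (N div k div q) + (N div q) mod k"
      using mult_div_mod_eq[of k "N div q"] by (simp only: div_mult2_eq[symmetric] mult.commute)
    then have "real (N div q) = real k * real (N div k div q) + real ((N div q) mod k)"
      by (metis of_nat_add of_nat_mult)
    then show ?thesis by simp
  qed
  then have "(\<Sum>q=1..N. mangoldt q * real ((N div q) mod k)) =
      (\<Sum>q=1..N. mangoldt q * real (N div q)) - real k * (\<Sum>q=1..N. mangoldt q * real (N div k div q))"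
    by (simp only: right_diff_distrib sum_subtractf sum_distrib_left mult.left_commute)
  also have "\<dots> = ln (fact N :: real) - real k * ln (fact (N div k) :: real)"
    using sum_mangoldt_div[of N N] sum_mangoldt_div[of "N div k" N] by simp
  also have "ln (fact N :: real) \<le> ln (real k ^ N * real N ^ k * fact (N div k) ^ k)"
  proof -
    have "real (fact N) \<le> real (k ^ N * N ^ k * fact (N div k) ^ k)"
      using fact_le_fact_div[OF assms] by (simp only: of_nat_le_iff)
    then have "fact N \<le> real k ^ N * real N ^ k * fact (N div k) ^ k"
      by (simp only: of_nat_mult of_nat_power of_nat_fact)
    then show ?thesis by (rule ln_mono) simp
  qed
  also have "ln (real k ^ N * real N ^ k * fact (N div k) ^ k) =
      real N * ln (real k) + real k * ln (real N) + real k * ln (fact (N div k) :: real)"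
    using assms by (simp add: ln_mult ln_realpow)
  finally show ?thesis by simp
qed

section \<open>A weighted sieve averaged over dyadic scales\<close>

text \<open>The weights come from a numerical search. On average over dyadic $x$ they bound $\psi(x)/x$ by
  $\ln(\prod k^c)/68$, which is just below $\frac{3}{2}\ln 2$, as the final estimate requires.\<close>

definition sieve_weights :: "(nat \<times> nat) list" where
  "sieve_weights = [(3, 13), (5, 7), (7, 4), (11, 4), (13, 3), (17, 5), (19, 2)]"

definition sieve_fun :: "nat \<Rightarrow> nat" where
  "sieve_fun m = (\<Sum>(k, c)\<leftarrow>sieve_weights. c * (m mod k))"

definition sieve_prod :: nat where
  "sieve_prod = (\<Prod>(k, c)\<leftarrow>sieve_weights. k ^ c)"

lemma sieve_prod_less: "sieve_prod < 2 ^ 102"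
  by (simp add: sieve_prod_def sieve_weights_def)

text \<open>A finite certificate. With a = floor(2^(j+7)/q) the floors at the levels below are
  quotients of \<open>a\<close> by powers of 2, so 128 values of \<open>a\<close> cover every q at
  every scale. Here 136 is 68 times the 2 from the geometric series over r >= j, and 128 is the
  common denominator of the eight level weights.\<close>

lemma sieve_fun_octave:
  assumes "a \<in> {128..<256}"
  shows "136 * 128 \<le> (\<Sum>i\<le>7. 2 ^ (7 - i) * sieve_fun (a div 2 ^ (7 - i)))"
proof -
  have int_fun: "int (sieve_fun m) = (\<Sum>(k, c)\<leftarrow>[(3, 13), (5, 7), (7, 4), (11, 4), (13, 3), (17, 5), (19, 2)]. c * (int m mod k))" for m
    by (simp add: sieve_fun_def sieve_weights_def zmod_int)
  \<comment> \<open>The evaluation is done over the integers, whose numerals are binary.\<close>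
  have "list_all (\<lambda>a. 136 * 128 \<le> (\<Sum>w\<leftarrow>[1, 2, 4, 8, 16, 32, 64, 128].
      w * (\<Sum>(k, c)\<leftarrow>[(3, 13), (5, 7), (7, 4), (11, 4), (13, 3), (17, 5), (19, 2)]. c * (a div w mod k)))) [128..255::int]"
    by code_simp
  moreover have "int a \<in> set [128..255]"
    unfolding set_upto atLeastAtMost_iff using assms by auto
  ultimately have "136 * 128 \<le> (\<Sum>w\<leftarrow>[1, 2, 4, 8, 16, 32, 64, 128].
      w * (\<Sum>(k, c)\<leftarrow>[(3, 13), (5, 7), (7, 4), (11, 4), (13, 3), (17, 5), (19, 2)]. c * (int a div w mod k)))"
    unfolding list_all_iff by (rule bspec)
  also have "\<dots> = (\<Sum>w\<leftarrow>[1, 2, 4, 8, 16, 32, 64, 128]. int w * int (sieve_fun (a div w)))"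
    by (simp add: int_fun zdiv_int)
  also have "\<dots> = int (\<Sum>i\<le>7. 2 ^ (7 - i) * sieve_fun (a div 2 ^ (7 - i)))"
    by (simp add: atMost_nat_numeral)
  finally show ?thesis by linarith
qed

definition sieve_sum :: "nat \<Rightarrow> real" where
  "sieve_sum r = (\<Sum>q=1..2 ^ r. mangoldt q * real (sieve_fun (2 ^ r div q)))"

lemma sieve_sum_le:
  "sieve_sum r \<le> 2 ^ r * ln (real sieve_prod) + 400 * real r * ln 2"
proof -
  have "sieve_sum r = (\<Sum>(k, c)\<leftarrow>sieve_weights. real c * (\<Sum>q=1..2 ^ r. mangoldt q * real ((2 ^ r div q) mod k)))"
    by (simp add: sieve_sum_def sieve_fun_def sieve_weights_def algebra_simps sum.distrib sum_distrib_left)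
  also have "\<dots> \<le> (\<Sum>(k, c)\<leftarrow>sieve_weights. real c * (2 ^ r * ln (real k) + real k * (real r * ln 2)))"
  proof (rule sum_list_mono)
    fix x assume "x \<in> set sieve_weights"
    moreover obtain k c where x: "x = (k, c)" by fastforce
    ultimately have "k \<ge> 1" by (auto simp: sieve_weights_def)
    then have "(\<Sum>q=1..2 ^ r. mangoldt q * real ((2 ^ r div q) mod k)) \<le> 2 ^ r * ln (real k) + real k * (real r * ln 2)"
      using sum_mangoldt_div_mod[of k "2 ^ r"] by (simp add: ln_realpow)
    then show "(case x of (k, c) \<Rightarrow> real c * (\<Sum>q=1..2 ^ r. mangoldt q * real ((2 ^ r div q) mod k))) \<le>
        (case x of (k, c) \<Rightarrow> real c * (2 ^ r * ln (real k) + real k * (real r * ln 2)))"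
      unfolding x by (simp add: mult_left_mono)
  qed
  \<comment> \<open>308 is the sum of the products k c over the weights; it is rounded up to 400
    below.\<close>
  also have "\<dots> = 2 ^ r * (\<Sum>(k, c)\<leftarrow>sieve_weights. real c * ln (real k)) + 308 * (real r * ln 2)"
    by (simp add: sieve_weights_def algebra_simps)
  also have "(\<Sum>(k, c)\<leftarrow>sieve_weights. real c * ln (real k)) = ln (real sieve_prod)"
  proof -
    have "ln (real sieve_prod) = ln (3 ^ 13 * 5 ^ 7 * 7 ^ 4 * 11 ^ 4 * 13 ^ 3 * 17 ^ 5 * 19 ^ 2)"
      by (simp add: sieve_prod_def sieve_weights_def)
    also have "\<dots> = 13 * ln 3 + 7 * ln 5 + 4 * ln 7 + 4 * ln 11 + 3 * ln 13 + 5 * ln 17 + 2 * ln (19 :: real)"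
      by (simp only: ln_mult_pos ln_realpow zero_less_power zero_less_numeral mult_pos_pos of_nat_numeral)
    finally show ?thesis by (simp add: sieve_weights_def)
  qed
  also have "308 * (real r * ln 2) \<le> 400 * (real r * ln (2 :: real))"
    by (intro mult_right_mono) auto
  finally show ?thesis by simp
qed

lemma sum_half_powers_from:
  assumes "j \<le> N"
  shows "(\<Sum>r=j..N. (1 / 2) ^ r) \<le> (2 :: real) * (1 / 2) ^ j"
proof -
  have "(\<Sum>r=j..N. (1 / 2) ^ r) = (2 :: real) * (1 / 2) ^ j - 2 * (1 / 2) ^ Suc N"
    using assms by (subst sum_gp) (auto simp: field_simps)
  then show ?thesis by simp
qed

text \<open>Every $q$ lies in a unique dyadic octave $(2^{j-1},2^j]$, and the contribution of $q$ to the
  left-hand side comes from the eight levels $j,\dots,j+7$ alone; it depends only on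
  $\lfloor 2^{j+7}/q\rfloor\in[128,256)$.\<close>

lemma sieve_fun_levels:
  assumes q: "q \<ge> 1" and N: "q \<le> 2 ^ N"
  shows "68 * (\<Sum>r\<le>N. (1 / 2) ^ r * (if q \<le> 2 ^ r then 1 else 0)) \<le>
    (\<Sum>r\<le>N + 7. (1 / 2) ^ r * real (sieve_fun (2 ^ r div q)))"
proof -
  define j where "j = (LEAST j. q \<le> 2 ^ j)"
  have j: "q \<le> 2 ^ j" unfolding j_def by (rule LeastI[of _ N]) (rule N)
  have jN: "j \<le> N" unfolding j_def by (rule Least_le) (rule N)
  have less: "2 ^ r < q" if "r < j" for r
    using not_less_Least[of r "\<lambda>j. q \<le> 2 ^ j"] that by (simp add: j_def)
  have j_iff: "q \<le> 2 ^ r \<longleftrightarrow> j \<le> r" for r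
    using less[of r] j power_increasing[of j r "2 :: nat"] by (metis leD le_trans linorder_not_le one_le_numeral)
  define a where "a = 2 ^ (j + 7) div q"
  have "a \<in> {128..<256}"
  proof -
    have "128 * q \<le> 2 ^ (j + 7)" using j by (simp add: power_add)
    then have "128 \<le> a" using q by (simp add: a_def less_eq_div_iff_mult_less_eq)
    moreover have "2 ^ (j + 7) < 256 * q"
    proof (cases j)
      case 0
      then show ?thesis using q by simp
    next
      case (Suc i)
      then show ?thesis using less[of i] by (simp add: power_add)
    qed
    then have "a < 256" using q by (simp add: a_def div_less_iff_less_mult)
    ultimately show ?thesis by simp
  qed
  then have oct: "136 * 128 \<le> (\<Sum>i\<le>7. 2 ^ (7 - i) * sieve_fun (a div 2 ^ (7 - i)))"
    by (rule sieve_fun_octave)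
  have div: "a div 2 ^ (7 - i) = 2 ^ (j + i) div q" if "i \<le> 7" for i
  proof -
    have "(2 :: nat) ^ (j + 7) = 2 ^ (j + i) * 2 ^ (7 - i)" using that by (simp flip: power_add)
    then have "a div 2 ^ (7 - i) = 2 ^ (j + i) * 2 ^ (7 - i) div (q * 2 ^ (7 - i))"
      by (simp only: a_def div_mult2_eq)
    then show ?thesis by simp
  qed
  have "68 * (\<Sum>r\<le>N. (1 / 2) ^ r * (if q \<le> 2 ^ r then 1 else 0)) = 68 * (\<Sum>r=j..N. (1 / 2 :: real) ^ r)"
    unfolding j_iff by (intro arg_cong[where f = "(*) 68"] sum.mono_neutral_cong_right) auto
  also have "\<dots> \<le> 68 * (2 * (1 / 2) ^ j)" using sum_half_powers_from[OF jN] by simp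
  also have "\<dots> = (1 / 2) ^ (j + 7) * real (136 * 128)" by (simp add: power_add power_one_over)
  also have "\<dots> \<le> (1 / 2) ^ (j + 7) * real (\<Sum>i\<le>7. 2 ^ (7 - i) * sieve_fun (a div 2 ^ (7 - i)))"
    using oct by (intro mult_left_mono) (simp_all only: of_nat_le_iff, simp_all)
  also have "\<dots> = (\<Sum>i\<le>7. (1 / 2) ^ (j + i) * real (sieve_fun (2 ^ (j + i) div q)))"
    unfolding of_nat_sum sum_distrib_left
  proof (intro sum.cong refl)
    fix i :: nat assume "i \<in> {..7}"
    then have i: "i \<le> 7" by simp
    have "(1 / 2 :: real) ^ (j + 7) * 2 ^ (7 - i) = (1 / 2) ^ (j + i) * ((1 / 2) ^ (7 - i) * 2 ^ (7 - i))"
      using i by (simp flip: power_add)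
    then have "(1 / 2 :: real) ^ (j + 7) * 2 ^ (7 - i) = (1 / 2) ^ (j + i)"
      by (simp flip: power_mult_distrib)
    then show "(1 / 2) ^ (j + 7) * real (2 ^ (7 - i) * sieve_fun (a div 2 ^ (7 - i))) =
        (1 / 2) ^ (j + i) * real (sieve_fun (2 ^ (j + i) div q))"
      unfolding div[OF i] by (simp only: of_nat_mult of_nat_power of_nat_numeral mult.assoc[symmetric])
  qed
  also have "\<dots> = (\<Sum>r=j..j + 7. (1 / 2) ^ r * real (sieve_fun (2 ^ r div q)))"
    by (rule sum.reindex_bij_witness[of _ "\<lambda>r. r - j" "\<lambda>i. i + j"]) (auto simp: add.commute)
  also have "\<dots> \<le> (\<Sum>r\<le>N + 7. (1 / 2) ^ r * real (sieve_fun (2 ^ r div q)))"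
    using jN by (intro sum_mono2) auto
  finally show ?thesis .
qed

text \<open>Exchanging the sums over the levels and over q reduces the average to the pointwise
  inequality \<open>sieve_fun_levels\<close>. The levels must run to \<open>N + 7\<close>, because
  the eight levels of a q may reach beyond \<open>N\<close>; this costs a bounded number of
  terms.\<close>

lemma psi_dyadic_average:
  "68 * (\<Sum>r\<le>N. chebyshev_psi (2 ^ r) / 2 ^ r) \<le> real (N + 8) * (ln (real sieve_prod)) + 1600"
proof -
  have psi: "chebyshev_psi (2 ^ r) = (\<Sum>q=1..2 ^ N. mangoldt q * (if q \<le> 2 ^ r then 1 else 0))" if "r \<le> N" for r
  proof -
    have "(2 :: nat) ^ r \<le> 2 ^ N" using that by (intro power_increasing) auto
    then show ?thesis unfolding chebyshev_psi_def by (intro sum.mono_neutral_cong_left) auto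
  qed
  have "68 * (\<Sum>r\<le>N. chebyshev_psi (2 ^ r) / 2 ^ r) =
      68 * (\<Sum>r\<le>N. \<Sum>q=1..2 ^ N. (1 / 2) ^ r * (mangoldt q * (if q \<le> 2 ^ r then 1 else 0)))"
    by (intro arg_cong[where f = "(*) 68"] sum.cong refl) (simp add: psi sum_distrib_left power_one_over sum_divide_distrib)
  also have "\<dots> = 68 * (\<Sum>q=1..2 ^ N. \<Sum>r\<le>N. (1 / 2) ^ r * (mangoldt q * (if q \<le> 2 ^ r then 1 else 0)))"
    by (subst sum.swap) simp
  also have "\<dots> = (\<Sum>q=1..2 ^ N. mangoldt q * (68 * (\<Sum>r\<le>N. (1 / 2) ^ r * (if q \<le> 2 ^ r then 1 else 0))))"
    by (simp only: sum_distrib_left mult.left_commute mult.assoc)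
  also have "\<dots> \<le> (\<Sum>q=1..2 ^ N. mangoldt q * (\<Sum>r\<le>N + 7. (1 / 2) ^ r * real (sieve_fun (2 ^ r div q))))"
    by (intro sum_mono mult_left_mono sieve_fun_levels mangoldt_nonneg) auto
  also have "\<dots> \<le> (\<Sum>q=1..2 ^ (N + 7). mangoldt q * (\<Sum>r\<le>N + 7. (1 / 2) ^ r * real (sieve_fun (2 ^ r div q))))"
  proof (rule sum_mono2)
    have "(2 :: nat) ^ N \<le> 2 ^ (N + 7)" by (intro power_increasing) auto
    then show "{1..2 ^ N} \<subseteq> {1..2 ^ (N + 7) :: nat}" by auto
  qed (auto intro!: mult_nonneg_nonneg sum_nonneg mangoldt_nonneg)
  also have "\<dots> = (\<Sum>r\<le>N + 7. (1 / 2) ^ r * (\<Sum>q=1..2 ^ (N + 7). mangoldt q * real (sieve_fun (2 ^ r div q))))"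
    unfolding sum_distrib_left by (subst sum.swap) (simp only: mult.left_commute)
  also have "\<dots> = (\<Sum>r\<le>N + 7. (1 / 2) ^ r * sieve_sum r)"
  proof (intro sum.cong refl arg_cong[where f = "(*) _"])
    fix r assume "r \<in> {..N + 7}"
    then have "(2 :: nat) ^ r \<le> 2 ^ (N + 7)" by (intro power_increasing) auto
    then show "(\<Sum>q=1..2 ^ (N + 7). mangoldt q * real (sieve_fun (2 ^ r div q))) = sieve_sum r"
      unfolding sieve_sum_def
      by (intro sum.mono_neutral_right) (auto simp: sieve_fun_def sieve_weights_def)
  qed
  also have "\<dots> \<le> (\<Sum>r\<le>N + 7. ln (real sieve_prod) + 400 * (real r * (1 / 2) ^ r))"
  proof (rule sum_mono)
    fix r :: nat
    have "ln (2 :: real) \<le> 1" using ln_2_less_1 by simp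
    then have "400 * real r * ln 2 \<le> 400 * real r" by (simp add: mult_left_le)
    then have "sieve_sum r \<le> 2 ^ r * ln (real sieve_prod) + 400 * real r"
      using sieve_sum_le[of r] by linarith
    then have "(1 / 2) ^ r * sieve_sum r \<le> (1 / 2) ^ r * (2 ^ r * ln (real sieve_prod) + 400 * real r)"
      by (intro mult_left_mono) auto
    also have "\<dots> = ((1 / 2) ^ r * 2 ^ r) * ln (real sieve_prod) + 400 * (real r * (1 / 2) ^ r)"
      by (simp only: distrib_left mult.assoc mult.commute mult.left_commute)
    also have "(1 / 2 :: real) ^ r * 2 ^ r = 1" by (simp flip: power_mult_distrib)
    also have "1 * ln (real sieve_prod) = ln (real sieve_prod)" by simp
    finally show "(1 / 2) ^ r * sieve_sum r \<le> ln (real sieve_prod) + 400 * (real r * (1 / 2) ^ r)" .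
  qed
  also have "\<dots> = real (N + 8) * ln (real sieve_prod) + 400 * (\<Sum>r\<le>N + 7. real r * (1 / 2) ^ r)"
    by (simp add: sum.distrib sum_distrib_left)
  \<comment> \<open>The subtracted term is what lets the induction go through; only boundedness is
    needed.\<close>
  also have "(\<Sum>r\<le>M. real r * (1 / 2) ^ r) \<le> 2 - (real M + 2) * (1 / 2) ^ M" for M
  proof (induction M)
    case (Suc M)
    define x :: real where "x = (1 / 2) ^ M"
    have "(\<Sum>r\<le>M. real r * (1 / 2) ^ r) \<le> 2 - (real M + 2) * x" using Suc by (simp only: x_def)
    moreover have "(1 / 2 :: real) ^ Suc M = x / 2" by (simp add: x_def)
    ultimately show ?case by (simp add: algebra_simps del: power_Suc)
  qed simp
  then have "(\<Sum>r\<le>N + 7. real r * (1 / 2) ^ r) \<le> 4"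
    by (rule order_trans) (simp add: algebra_simps)
  finally show ?thesis by simp
qed

text \<open>If the bound failed for all large r, then with a(r) = psi(2^r)/2^r every sum a(r) +
  a(r+1) would be so large that the mean of the a(r) contradicts
  \<open>psi_dyadic_average\<close>.\<close>

theorem lcm_upto_dyadic_bound:
  obtains \<eta> :: real where "\<eta> > 0"
    "\<And>r0. \<exists>r\<ge>r0. 2 * ln (real (lcm_upto (2 ^ r))) + ln (real (lcm_upto (2 ^ Suc r))) \<le> (6 * ln 2 - \<eta>) * 2 ^ r"
proof -
  define L where "L = ln (real sieve_prod)"
  \<comment> \<open>Half of the gap between 6 ln 2 and L/17, the latter being the bound that
    \<open>psi_dyadic_average\<close> puts on the mean of 2 (a(r) + a(r+1)).\<close>
  define \<eta> where "\<eta> = (102 * ln 2 - L) / 34"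
  have "L < ln (2 ^ 102)" unfolding L_def
  proof (subst ln_less_cancel_iff)
    show "real sieve_prod > 0" by (simp add: sieve_prod_def sieve_weights_def)
    show "real sieve_prod < 2 ^ 102" using sieve_prod_less by (metis of_nat_less_iff of_nat_numeral of_nat_power)
  qed simp
  also have "ln ((2 :: real) ^ 102) = 102 * ln 2"
    using ln_realpow[of 2 102] by (simp only: of_nat_numeral zero_less_numeral)
  finally have L: "L < 102 * ln 2" .
  then have "\<eta> > 0" by (simp add: \<eta>_def)
  moreover have "\<exists>r\<ge>r0. 2 * ln (real (lcm_upto (2 ^ r))) + ln (real (lcm_upto (2 ^ Suc r))) \<le> (6 * ln 2 - \<eta>) * 2 ^ r" for r0
  proof (rule ccontr)
    assume "\<not> ?thesis"
    then have neg: "(6 * ln 2 - \<eta>) * 2 ^ r < 2 * chebyshev_psi (2 ^ r) + chebyshev_psi (2 ^ Suc r)" if "r \<ge> r0" for r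
      using that unfolding ln_lcm_upto by (meson not_le)
    define a where "a r = chebyshev_psi (2 ^ r) / 2 ^ r" for r
    have a0: "a r \<ge> 0" for r
      unfolding a_def chebyshev_psi_def by (intro divide_nonneg_pos sum_nonneg mangoldt_nonneg) auto
    have step: "3 * ln 2 - \<eta> / 2 \<le> a r + a (Suc r)" if "r \<ge> r0" for r
    proof -
      have "6 * ln 2 - \<eta> < (2 * chebyshev_psi (2 ^ r) + chebyshev_psi (2 ^ Suc r)) / 2 ^ r"
        using neg[OF that] by (simp only: pos_less_divide_eq zero_less_power zero_less_numeral)
      also have "\<dots> = 2 * (a r + a (Suc r))" by (simp add: a_def add_divide_distrib)
      finally show ?thesis by simp
    qed
    have lower: "real n * (3 * ln 2 - \<eta> / 2) \<le> 2 * (\<Sum>r\<le>r0 + n. a r)" for n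
    proof -
      have "real n * (3 * ln 2 - \<eta> / 2) = (\<Sum>r=r0..<r0 + n. 3 * ln 2 - \<eta> / 2)" by simp
      also have "\<dots> \<le> (\<Sum>r=r0..<r0 + n. a r + a (Suc r))" by (intro sum_mono step) auto
      also have "\<dots> = (\<Sum>r=r0..<r0 + n. a r) + (\<Sum>r=Suc r0..<Suc (r0 + n). a r)"
        by (simp only: sum.distrib sum.shift_bounds_Suc_ivl)
      also have "\<dots> \<le> (\<Sum>r\<le>r0 + n. a r) + (\<Sum>r\<le>r0 + n. a r)"
        by (intro add_mono sum_mono2 a0) auto
      finally show ?thesis by simp
    qed
    have upper: "34 * (real n * (3 * ln 2 - \<eta> / 2)) \<le> real (r0 + n + 8) * L + 1600" for n
      using lower[of n] psi_dyadic_average[of "r0 + n"] by (simp add: a_def L_def)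
    have "real n * ((102 * ln 2 - L) / 2) \<le> real (r0 + 8) * L + 1600" for n
      using upper[of n] by (simp add: \<eta>_def field_simps)
    moreover obtain n where "real n * ((102 * ln 2 - L) / 2) > real (r0 + 8) * L + 1600"
      using reals_Archimedean3[of "(102 * ln 2 - L) / 2"] L by (metis diff_gt_0_iff_gt half_gt_zero)
    ultimately show False by (metis not_le)
  qed
  ultimately show ?thesis by (rule that)
qed

section \<open>Volkenborn sums of limits of polynomials\<close>

lemma rat_abs2_sum_le:
  assumes "B \<ge> 0" "\<And>i. i \<in> A \<Longrightarrow> rat_abs2 (f i) \<le> B"
  shows "rat_abs2 (\<Sum>i\<in>A. f i) \<le> B"
  using assms(2)
proof (induction A rule: infinite_finite_induct)
  case (insert x A)
  have "rat_abs2 (f x + sum f A) \<le> max (rat_abs2 (f x)) (rat_abs2 (sum f A))" by (rule rat_abs2_ultra)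
  also have "\<dots> \<le> B" using insert by simp
  finally show ?case using insert by simp
qed (use assms(1) in simp_all)

lemma rat_abs2_add_le: "rat_abs2 x \<le> B \<Longrightarrow> rat_abs2 y \<le> B \<Longrightarrow> rat_abs2 (x + y) \<le> B"
  using rat_abs2_ultra[of x y] by linarith

lemma rat_abs2_diff_le: "rat_abs2 x \<le> B \<Longrightarrow> rat_abs2 y \<le> B \<Longrightarrow> rat_abs2 (x - y) \<le> B"
  using rat_abs2_add_le[of x B "- y"] by simp

lemma rat_abs2_diff_commute: "rat_abs2 (x - y) = rat_abs2 (y - x)"
  using rat_abs2_minus[of "x - y"] by (simp del: rat_abs2_minus)

lemma rat_abs2_add_eq: "rat_abs2 y < rat_abs2 x \<Longrightarrow> rat_abs2 (x + y) = rat_abs2 x"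
  using rat_abs2_ultra[of x y] rat_abs2_ultra[of "x + y" "- y"] by simp

lemma rat_abs2_prod: "rat_abs2 (\<Prod>i\<in>A. f i) = (\<Prod>i\<in>A. rat_abs2 (f i))"
  by (induction A rule: infinite_finite_induct) (simp_all add: rat_abs2_mult)

lemma rat_abs2_power: "rat_abs2 (x ^ n) = rat_abs2 x ^ n"
  by (induction n) (simp_all add: rat_abs2_mult)

lemma rat_abs2_divide: "rat_abs2 (x / y) = rat_abs2 x / rat_abs2 y"
  by (simp add: divide_inverse rat_abs2_mult rat_abs2_inverse)

lemma rat_abs2_of_int: "k \<noteq> 0 \<Longrightarrow> rat_abs2 (of_int k) = (1 / 2) ^ multiplicity 2 k"
  using rat_val2_divide[of k 1] by (simp add: rat_abs2_def power_int_minus power_one_over field_simps)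

lemma rat_abs2_of_int_le_1 [simp]: "rat_abs2 (of_int k) \<le> 1"
  by (cases "k = 0") (simp_all add: rat_abs2_of_int power_le_one)

lemma rat_abs2_of_nat_le_1 [simp]: "rat_abs2 (of_nat k) \<le> 1"
  using rat_abs2_of_int_le_1[of "int k"] by (simp del: rat_abs2_of_int_le_1)

lemma rat_abs2_numeral_le_1 [simp]: "rat_abs2 (numeral k) \<le> 1"
  using rat_abs2_of_nat_le_1[of "numeral k"] by (simp del: rat_abs2_of_nat_le_1)

lemma rat_abs2_pos: "x \<noteq> 0 \<Longrightarrow> 0 < rat_abs2 x"
  using rat_abs2_nonneg[of x] rat_abs2_eq_0_iff[of x] by linarith

lemma rat_abs2_odd: "odd k \<Longrightarrow> rat_abs2 (of_int k) = 1"
  by (subst rat_abs2_of_int) (auto simp: not_dvd_imp_multiplicity_0)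

lemma rat_abs2_odd_nat: "odd k \<Longrightarrow> rat_abs2 (of_nat k) = 1"
  using rat_abs2_odd[of "int k"] by simp

lemma rat_abs2_2 [simp]: "rat_abs2 2 = 1 / 2"
  using rat_abs2_of_int[of 2] by simp

lemma rat_abs2_4 [simp]: "rat_abs2 4 = 1 / 4"
  using rat_abs2_mult[of 2 2] by simp

lemma rat_abs2_unit_add: "rat_abs2 x = 1 \<Longrightarrow> rat_abs2 y < 1 \<Longrightarrow> rat_abs2 (x + y) = 1"
  using rat_abs2_add_eq[of y x] by simp

section \<open>Uniform limits of polynomials on the naturals\<close>

text \<open>The functions on the naturals that are uniform limits of polynomials over the 2-adic integers
  all of whose nonconstant coefficients are divisible by \<open>2 ^ \<mu>\<close>.\<close>

definition poly_lim :: "nat \<Rightarrow> (nat \<Rightarrow> rat) set" where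
  "poly_lim \<mu> = {F. \<forall>M::nat. \<exists>p. rat_abs2 (coeff p 0) \<le> 1 \<and> (\<forall>i\<ge>1. rat_abs2 (coeff p i) \<le> (1 / 2) ^ \<mu>) \<and>
     (\<forall>t. rat_abs2 (F t - poly p (of_nat t)) \<le> (1 / 2) ^ M)}"

lemma poly_limI:
  assumes "\<And>M::nat. \<exists>p. rat_abs2 (coeff p 0) \<le> 1 \<and> (\<forall>i\<ge>1. rat_abs2 (coeff p i) \<le> (1 / 2) ^ \<mu>) \<and>
     (\<forall>t. rat_abs2 (F t - poly p (of_nat t)) \<le> (1 / 2) ^ M)"
  shows "F \<in> poly_lim \<mu>"
  using assms by (simp add: poly_lim_def)

lemma poly_limE:
  assumes "F \<in> poly_lim \<mu>"
  obtains p where "rat_abs2 (coeff p 0) \<le> 1" "\<And>i. i \<ge> 1 \<Longrightarrow> rat_abs2 (coeff p i) \<le> (1 / 2) ^ \<mu>"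
    "\<And>t. rat_abs2 (F t - poly p (of_nat t)) \<le> (1 / 2) ^ M"
proof -
  have "\<exists>p. rat_abs2 (coeff p 0) \<le> 1 \<and> (\<forall>i\<ge>1. rat_abs2 (coeff p i) \<le> (1 / 2) ^ \<mu>) \<and>
     (\<forall>t. rat_abs2 (F t - poly p (of_nat t)) \<le> (1 / 2) ^ M)"
    using assms by (simp add: poly_lim_def)
  then show ?thesis using that by blast
qed

lemma rat_abs2_poly_le_1:
  assumes "\<And>i. rat_abs2 (coeff p i) \<le> 1"
  shows "rat_abs2 (poly p (of_nat t)) \<le> 1"
proof -
  have "rat_abs2 (coeff p i * of_nat t ^ i) \<le> 1" for i
    unfolding rat_abs2_mult rat_abs2_power using assms by (intro mult_le_one power_le_one) auto
  then show ?thesis unfolding poly_altdef by (intro rat_abs2_sum_le) auto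
qed

lemma poly_lim_coeff_le_1:
  fixes p :: "rat poly"
  assumes "rat_abs2 (coeff p 0) \<le> 1" "\<And>i. i \<ge> 1 \<Longrightarrow> rat_abs2 (coeff p i) \<le> (1 / 2) ^ \<mu>"
  shows "rat_abs2 (coeff p i) \<le> 1"
proof (cases "i = 0")
  case False
  then have "rat_abs2 (coeff p i) \<le> (1 / 2) ^ \<mu>" using assms(2) by simp
  also have "\<dots> \<le> 1" by (intro power_le_one) auto
  finally show ?thesis .
qed (use assms in simp)

lemma poly_lim_le_1:
  assumes "F \<in> poly_lim \<mu>"
  shows "rat_abs2 (F t) \<le> 1"
proof -
  obtain p where p: "rat_abs2 (coeff p 0) \<le> 1" "\<And>i. i \<ge> 1 \<Longrightarrow> rat_abs2 (coeff p i) \<le> (1 / 2) ^ \<mu>"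
    "\<And>t. rat_abs2 (F t - poly p (of_nat t)) \<le> (1 / 2) ^ 0"
    using poly_limE[OF assms] by blast
  have "rat_abs2 (poly p (of_nat t)) \<le> 1"
    by (rule rat_abs2_poly_le_1) (rule poly_lim_coeff_le_1[OF p(1,2)])
  then show ?thesis using rat_abs2_add_le[of "F t - poly p (of_nat t)" 1 "poly p (of_nat t)"] p(3)[of t] by simp
qed

lemma poly_lim_const: "rat_abs2 c \<le> 1 \<Longrightarrow> (\<lambda>t. c) \<in> poly_lim \<mu>"
  by (intro poly_limI exI[of _ "[:c:]"]) (auto simp: coeff_pCons split: nat.split)

lemma poly_lim_linear:
  "rat_abs2 c \<le> 1 \<Longrightarrow> rat_abs2 z \<le> (1 / 2) ^ \<mu> \<Longrightarrow> (\<lambda>t. c + z * of_nat t) \<in> poly_lim \<mu>"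
  by (intro poly_limI exI[of _ "[:c, z:]"]) (auto simp: coeff_pCons mult.commute split: nat.split)

lemma poly_lim_add:
  assumes F: "F \<in> poly_lim \<mu>" and G: "G \<in> poly_lim \<mu>"
  shows "(\<lambda>t. F t + G t) \<in> poly_lim \<mu>"
proof (rule poly_limI)
  fix M :: nat
  obtain p where p: "rat_abs2 (coeff p 0) \<le> 1" "\<And>i. i \<ge> 1 \<Longrightarrow> rat_abs2 (coeff p i) \<le> (1 / 2) ^ \<mu>"
    "\<And>t. rat_abs2 (F t - poly p (of_nat t)) \<le> (1 / 2) ^ M"
    using poly_limE[OF F] by blast
  obtain q where q: "rat_abs2 (coeff q 0) \<le> 1" "\<And>i. i \<ge> 1 \<Longrightarrow> rat_abs2 (coeff q i) \<le> (1 / 2) ^ \<mu>"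
    "\<And>t. rat_abs2 (G t - poly q (of_nat t)) \<le> (1 / 2) ^ M"
    using poly_limE[OF G] by blast
  show "\<exists>p. rat_abs2 (coeff p 0) \<le> 1 \<and> (\<forall>i\<ge>1. rat_abs2 (coeff p i) \<le> (1 / 2) ^ \<mu>) \<and>
     (\<forall>t. rat_abs2 (F t + G t - poly p (of_nat t)) \<le> (1 / 2) ^ M)"
  proof (intro exI[of _ "p + q"] conjI allI impI)
    show "rat_abs2 (F t + G t - poly (p + q) (of_nat t)) \<le> (1 / 2) ^ M" for t
      using rat_abs2_add_le[OF p(3)[of t] q(3)[of t]] by (simp add: algebra_simps)
  qed (auto intro!: rat_abs2_add_le p q)
qed

lemma poly_lim_mult:
  assumes F: "F \<in> poly_lim \<mu>" and G: "G \<in> poly_lim \<mu>"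
  shows "(\<lambda>t. F t * G t) \<in> poly_lim \<mu>"
proof (rule poly_limI)
  fix M :: nat
  obtain p where p: "rat_abs2 (coeff p 0) \<le> 1" "\<And>i. i \<ge> 1 \<Longrightarrow> rat_abs2 (coeff p i) \<le> (1 / 2) ^ \<mu>"
    "\<And>t. rat_abs2 (F t - poly p (of_nat t)) \<le> (1 / 2) ^ M"
    using poly_limE[OF F] by blast
  obtain q where q: "rat_abs2 (coeff q 0) \<le> 1" "\<And>i. i \<ge> 1 \<Longrightarrow> rat_abs2 (coeff q i) \<le> (1 / 2) ^ \<mu>"
    "\<And>t. rat_abs2 (G t - poly q (of_nat t)) \<le> (1 / 2) ^ M"
    using poly_limE[OF G] by blast
  note p1 = poly_lim_coeff_le_1[OF p(1,2)] and q1 = poly_lim_coeff_le_1[OF q(1,2)]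
  show "\<exists>p. rat_abs2 (coeff p 0) \<le> 1 \<and> (\<forall>i\<ge>1. rat_abs2 (coeff p i) \<le> (1 / 2) ^ \<mu>) \<and>
     (\<forall>t. rat_abs2 (F t * G t - poly p (of_nat t)) \<le> (1 / 2) ^ M)"
  proof (intro exI[of _ "p * q"] conjI allI impI)
    show "rat_abs2 (coeff (p * q) 0) \<le> 1"
      using p(1) q(1) by (simp add: coeff_mult rat_abs2_mult mult_le_one)
    show "rat_abs2 (coeff (p * q) i) \<le> (1 / 2) ^ \<mu>" if "i \<ge> 1" for i
      unfolding coeff_mult
    proof (rule rat_abs2_sum_le)
      fix j assume "j \<in> {..i}"
      show "rat_abs2 (coeff p j * coeff q (i - j)) \<le> (1 / 2) ^ \<mu>"
      proof (cases "j \<ge> 1")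
        case True
        have "rat_abs2 (coeff p j) * rat_abs2 (coeff q (i - j)) \<le> (1 / 2) ^ \<mu> * 1"
          using p(2)[OF True] q1 by (intro mult_mono) auto
        then show ?thesis by (simp add: rat_abs2_mult)
      next
        case False
        then have "rat_abs2 (coeff p j) * rat_abs2 (coeff q (i - j)) \<le> 1 * (1 / 2) ^ \<mu>"
          using p1 q(2)[of "i - j"] that by (intro mult_mono) auto
        then show ?thesis by (simp add: rat_abs2_mult)
      qed
    qed simp
    show "rat_abs2 (F t * G t - poly (p * q) (of_nat t)) \<le> (1 / 2) ^ M" for t
    proof -
      have "F t * G t - poly (p * q) (of_nat t) =
          F t * (G t - poly q (of_nat t)) + (F t - poly p (of_nat t)) * poly q (of_nat t)"
        by (simp add: algebra_simps)
      moreover have "rat_abs2 (F t * (G t - poly q (of_nat t))) \<le> (1 / 2) ^ M"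
        using mult_mono[OF poly_lim_le_1[OF F, of t] q(3)[of t]] by (simp add: rat_abs2_mult)
      moreover have "rat_abs2 ((F t - poly p (of_nat t)) * poly q (of_nat t)) \<le> (1 / 2) ^ M"
        using mult_mono[OF p(3)[of t] rat_abs2_poly_le_1[of q t, OF q1]] by (simp add: rat_abs2_mult)
      ultimately show ?thesis by (simp only: rat_abs2_add_le)
    qed
  qed
qed

lemma poly_lim_sum: "(\<And>i. i \<in> A \<Longrightarrow> F i \<in> poly_lim \<mu>) \<Longrightarrow> (\<lambda>t. \<Sum>i\<in>A. F i t) \<in> poly_lim \<mu>"
  by (induction A rule: infinite_finite_induct) (auto intro: poly_lim_add poly_lim_const)

lemma poly_lim_power: "F \<in> poly_lim \<mu> \<Longrightarrow> (\<lambda>t. F t ^ n) \<in> poly_lim \<mu>"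
  by (induction n) (auto intro: poly_lim_mult poly_lim_const)

lemma poly_lim_mono: "\<mu> \<le> \<nu> \<Longrightarrow> F \<in> poly_lim \<nu> \<Longrightarrow> F \<in> poly_lim \<mu>"
proof (rule poly_limI)
  fix M :: nat
  assume \<mu>: "\<mu> \<le> \<nu>" and F: "F \<in> poly_lim \<nu>"
  obtain p where p: "rat_abs2 (coeff p 0) \<le> 1" "\<And>i. i \<ge> 1 \<Longrightarrow> rat_abs2 (coeff p i) \<le> (1 / 2) ^ \<nu>"
    "\<And>t. rat_abs2 (F t - poly p (of_nat t)) \<le> (1 / 2) ^ M"
    using poly_limE[OF F] by blast
  have "(1 / 2 :: real) ^ \<nu> \<le> (1 / 2) ^ \<mu>" using \<mu> by (intro power_decreasing) auto
  then show "\<exists>p. rat_abs2 (coeff p 0) \<le> 1 \<and> (\<forall>i\<ge>1. rat_abs2 (coeff p i) \<le> (1 / 2) ^ \<mu>) \<and>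
     (\<forall>t. rat_abs2 (F t - poly p (of_nat t)) \<le> (1 / 2) ^ M)"
    using p(1,3) order_trans[OF p(2)] by (intro exI[of _ p]) blast
qed

lemma rat_abs2_one_plus:
  assumes "rat_abs2 z < 1"
  shows "rat_abs2 (1 + z * of_nat t) = 1"
proof (rule rat_abs2_unit_add)
  have "rat_abs2 (z * of_nat t) \<le> rat_abs2 z * 1"
    unfolding rat_abs2_mult by (intro mult_left_mono) auto
  then show "rat_abs2 (z * of_nat t) < 1" using assms by simp
qed simp

text \<open>Truncate the geometric series in \<open>y = - z * t\<close> at \<open>M\<close>: the
  remainder is y^M / (1-y), where y has absolute value at most 1/2 and 1-y is a unit.\<close>

lemma poly_lim_inverse:
  assumes z: "rat_abs2 z \<le> (1 / 2) ^ \<mu>" and \<mu>: "\<mu> \<ge> 1"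
  shows "(\<lambda>t. inverse (1 + z * of_nat t)) \<in> poly_lim \<mu>"
proof (rule poly_limI)
  fix M :: nat
  have "(1 / 2 :: real) ^ \<mu> \<le> (1 / 2) ^ 1" using \<mu> by (intro power_decreasing) auto
  with z have z2: "rat_abs2 z \<le> 1 / 2" by simp
  define p where "p = (\<Sum>k<M. monom ((- z) ^ k) k)"
  have cp: "coeff p i = (if i < M then (- z) ^ i else 0)" for i
    by (simp add: p_def coeff_sum)
  show "\<exists>p. rat_abs2 (coeff p 0) \<le> 1 \<and> (\<forall>i\<ge>1. rat_abs2 (coeff p i) \<le> (1 / 2) ^ \<mu>) \<and>
     (\<forall>t. rat_abs2 (inverse (1 + z * of_nat t) - poly p (of_nat t)) \<le> (1 / 2) ^ M)"
  proof (intro exI[of _ p] conjI allI impI)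
    show "rat_abs2 (coeff p 0) \<le> 1" by (simp add: cp)
    show "rat_abs2 (coeff p i) \<le> (1 / 2) ^ \<mu>" if "i \<ge> 1" for i
    proof -
      have "rat_abs2 z ^ i \<le> rat_abs2 z ^ 1" using z2 that by (intro power_decreasing) auto
      then show ?thesis using z by (auto simp: cp rat_abs2_power)
    qed
    fix t
    have unit: "rat_abs2 (1 + z * of_nat t) = 1" using z2 by (intro rat_abs2_one_plus) simp
    then have nz: "1 + z * of_nat t \<noteq> 0" by (metis rat_abs2_0 zero_neq_one)
    define y where "y = - z * of_nat t"
    have y: "rat_abs2 y \<le> 1 / 2"
    proof -
      have "rat_abs2 z * rat_abs2 (of_nat t) \<le> (1 / 2) * 1" using z2 by (intro mult_mono) auto
      then show ?thesis by (simp add: y_def rat_abs2_mult)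
    qed
    have "poly p (of_nat t) = (\<Sum>k<M. y ^ k)"
      by (simp only: p_def poly_sum poly_monom y_def power_mult_distrib)
    then have "(1 - y) * poly p (of_nat t) = 1 - y ^ M" by (simp add: one_diff_power_eq)
    then have "inverse (1 + z * of_nat t) - poly p (of_nat t) = y ^ M * inverse (1 + z * of_nat t)"
      using nz by (simp add: y_def field_simps)
    then have "rat_abs2 (inverse (1 + z * of_nat t) - poly p (of_nat t)) = rat_abs2 y ^ M"
      by (simp add: rat_abs2_mult rat_abs2_inverse unit rat_abs2_power)
    also have "\<dots> \<le> (1 / 2) ^ M" using y by (intro power_mono) auto
    finally show "rat_abs2 (inverse (1 + z * of_nat t) - poly p (of_nat t)) \<le> (1 / 2) ^ M" .
  qed
qed

section \<open>Volkenborn sums: size and convergence\<close>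

text \<open>Kept in \<open>rat\<close>: the estimates hold at finite \<open>N\<close>, so the
  completion enters only when limits are identified with zeta values.\<close>

definition volk_sum :: "nat \<Rightarrow> (nat \<Rightarrow> rat) \<Rightarrow> rat" where
  "volk_sum N F = (\<Sum>t<2 ^ N. F t) / 2 ^ N"

lemma volk_sum_cmult: "volk_sum N (\<lambda>t. c * F t) = c * volk_sum N F"
  by (simp add: volk_sum_def sum_distrib_left)

lemma volk_sum_sum: "volk_sum N (\<lambda>t. \<Sum>i\<in>A. F i t) = (\<Sum>i\<in>A. volk_sum N (F i))"
  by (simp add: volk_sum_def sum_divide_distrib sum.swap[of _ A])

lemma volk_sum_const: "volk_sum N (\<lambda>t. c) = c"
  by (simp add: volk_sum_def)

lemma sum_lessThan_double: "(\<Sum>t<2 * n. f t) = (\<Sum>t<n. f t + f (t + n))" for f :: "nat \<Rightarrow> 'a::comm_monoid_add"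
proof -
  have "(\<Sum>t<n + n. f t) = (\<Sum>t<n. f t) + (\<Sum>t<n. f (t + n))"
    by (simp add: sum.nat_group[symmetric] lessThan_atLeast0 sum.atLeastLessThan_concat[of 0 n "n + n", symmetric] sum.shift_bounds_nat_ivl[of f 0 n n, simplified])
  then show ?thesis by (simp add: mult_2 sum.distrib)
qed

text \<open>Taylor's formula to second order over the integers. The remainder has to be quadratic in
  h = 2^N because \<open>volk_sum_Suc_diff\<close> divides by 2^(N+1).\<close>

lemma add_power_expand:
  obtains c :: int where "(int t + h) ^ k = int t ^ k + int k * int t ^ (k - 1) * h + h ^ 2 * c"
proof -
  have expand: "(T + K * e * h + h ^ 2 * c) * (x + h) = x * T + (K + 1) * T * h + h ^ 2 * (K * e + c * (x + h))"
    if "K * e * x = K * T" for T K e c x :: int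
    using that by algebra
  have "\<exists>c. (int t + h) ^ k = int t ^ k + int k * int t ^ (k - 1) * h + h ^ 2 * c"
  proof (induction k)
    case (Suc k)
    then obtain c where c: "(int t + h) ^ k = int t ^ k + int k * int t ^ (k - 1) * h + h ^ 2 * c" by blast
    have e: "int k * int t ^ (k - 1) * int t = int k * int t ^ k" by (cases k) auto
    have "(int t + h) ^ Suc k = (int t ^ k + int k * int t ^ (k - 1) * h + h ^ 2 * c) * (int t + h)"
      using c by (simp only: power_Suc2)
    also have "\<dots> = int t * int t ^ k + (int k + 1) * int t ^ k * h +
        h ^ 2 * (int k * int t ^ (k - 1) + c * (int t + h))"
      by (rule expand[OF e])
    finally have "(int t + h) ^ Suc k = int t ^ Suc k + int (Suc k) * int t ^ (Suc k - 1) * h +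
        h ^ 2 * (int k * int t ^ (k - 1) + c * (int t + h))" by (simp add: add.commute)
    then show ?case by blast
  qed auto
  then show ?thesis using that by blast
qed

text \<open>Cutting the range at 2^N shows that the sum at level N+1 is twice the sum at level N
  plus a multiple of 2^N. This replaces the von Staudt-Clausen theorem at the prime 2.\<close>

lemma power_sum_dyadic: "rat_abs2 (\<Sum>t<2 ^ N. of_nat t ^ k) \<le> 2 * (1 / 2) ^ N"
proof (induction N)
  case 0
  have "rat_abs2 (0 ^ k) \<le> 1" by (cases k) auto
  then show ?case by simp
next
  case (Suc N)
  have "(\<Sum>t<2 ^ Suc N. of_nat t ^ k :: rat) = (\<Sum>t<2 ^ N. of_nat t ^ k + of_nat (t + 2 ^ N) ^ k)"
    unfolding power_Suc by (rule sum_lessThan_double)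
  also have "\<dots> = 2 * (\<Sum>t<2 ^ N. of_nat t ^ k) + (\<Sum>t<2 ^ N. of_nat (t + 2 ^ N) ^ k - of_nat t ^ k)"
    by (simp add: sum.distrib sum_subtractf)
  finally have eq: "(\<Sum>t<2 ^ Suc N. of_nat t ^ k :: rat) =
    2 * (\<Sum>t<2 ^ N. of_nat t ^ k) + (\<Sum>t<2 ^ N. of_nat (t + 2 ^ N) ^ k - of_nat t ^ k)" .
  have "rat_abs2 (of_nat (t + 2 ^ N) ^ k - of_nat t ^ k) \<le> (1 / 2) ^ N" for t
  proof -
    obtain c where c: "(int t + 2 ^ N) ^ k = int t ^ k + int k * int t ^ (k - 1) * 2 ^ N + (2 ^ N) ^ 2 * c"
      by (rule add_power_expand)
    have "int (t + 2 ^ N) ^ k - int t ^ k = 2 ^ N * (int k * int t ^ (k - 1) + 2 ^ N * c)"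
      using c by (simp add: algebra_simps power2_eq_square)
    then have "(of_nat (t + 2 ^ N) ^ k - of_nat t ^ k :: rat) = of_int (2 ^ N * (int k * int t ^ (k - 1) + 2 ^ N * c))"
      by (metis of_int_diff of_int_of_nat_eq of_int_power)
    also have "\<dots> = 2 ^ N * of_int (int k * int t ^ (k - 1) + 2 ^ N * c)" by simp
    finally show ?thesis
      using mult_left_mono[OF rat_abs2_of_int_le_1[of "int k * int t ^ (k - 1) + 2 ^ N * c"], of "(1 / 2) ^ N"]
      by (simp only: rat_abs2_mult rat_abs2_power rat_abs2_2) simp
  qed
  then have "rat_abs2 (\<Sum>t<2 ^ N. of_nat (t + 2 ^ N) ^ k - of_nat t ^ k) \<le> (1 / 2) ^ N"
    by (intro rat_abs2_sum_le) auto
  moreover have "rat_abs2 (2 * (\<Sum>t<2 ^ N. of_nat t ^ k)) \<le> (1 / 2) ^ N"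
    using Suc by (simp add: rat_abs2_mult)
  ultimately show ?case unfolding eq by (simp add: rat_abs2_add_le)
qed

lemma volk_sum_power: "rat_abs2 (volk_sum N (\<lambda>t. of_nat t ^ k)) \<le> 2"
  using power_sum_dyadic[where N = N and k = k] by (simp add: volk_sum_def rat_abs2_divide rat_abs2_power field_simps)

lemma rat_abs2_volk_sum_le:
  assumes "\<And>t. rat_abs2 (F t) \<le> B"
  shows "rat_abs2 (volk_sum N F) \<le> B * 2 ^ N"
proof -
  have "B \<ge> 0" using assms[of 0] rat_abs2_nonneg order_trans by blast
  then have "rat_abs2 (\<Sum>t<2 ^ N. F t) \<le> B" using assms by (intro rat_abs2_sum_le) auto
  then show ?thesis
    by (simp add: volk_sum_def rat_abs2_divide rat_abs2_power power_one_over mult_right_mono)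
qed

text \<open>The factor 2 is the denominator of the Bernoulli numbers, the Volkenborn integrals of powers.\<close>

lemma volk_sum_poly_lim:
  assumes F: "F \<in> poly_lim \<mu>"
  shows "rat_abs2 (volk_sum N F - F 0) \<le> 2 * (1 / 2) ^ \<mu>"
proof -
  obtain p where p: "rat_abs2 (coeff p 0) \<le> 1" "\<And>i. i \<ge> 1 \<Longrightarrow> rat_abs2 (coeff p i) \<le> (1 / 2) ^ \<mu>"
    "\<And>t. rat_abs2 (F t - poly p (of_nat t)) \<le> (1 / 2) ^ (N + \<mu>)"
    using poly_limE[OF F] by blast
  have "volk_sum N (\<lambda>t. poly p (of_nat t)) - poly p 0 =
      (\<Sum>i=1..degree p. coeff p i * volk_sum N (\<lambda>t. of_nat t ^ i))"
  proof -
    have "volk_sum N (\<lambda>t. poly p (of_nat t)) = (\<Sum>i\<le>degree p. coeff p i * volk_sum N (\<lambda>t. of_nat t ^ i))"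
      unfolding poly_altdef by (simp add: volk_sum_sum volk_sum_cmult)
    also have "\<dots> = coeff p 0 + (\<Sum>i=1..degree p. coeff p i * volk_sum N (\<lambda>t. of_nat t ^ i))"
      by (simp add: atMost_atLeast0 sum.atLeast_Suc_atMost volk_sum_const)
    finally show ?thesis by (simp add: poly_0_coeff_0)
  qed
  also have "rat_abs2 \<dots> \<le> 2 * (1 / 2) ^ \<mu>"
  proof (rule rat_abs2_sum_le)
    fix i assume "i \<in> {1..degree p}"
    then have "rat_abs2 (coeff p i) * rat_abs2 (volk_sum N (\<lambda>t. of_nat t ^ i)) \<le> (1 / 2) ^ \<mu> * 2"
      using p(2) volk_sum_power by (intro mult_mono) auto
    then show "rat_abs2 (coeff p i * volk_sum N (\<lambda>t. of_nat t ^ i)) \<le> 2 * (1 / 2) ^ \<mu>"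
      by (simp add: rat_abs2_mult)
  qed simp
  finally have *: "rat_abs2 (volk_sum N (\<lambda>t. poly p (of_nat t)) - poly p 0) \<le> 2 * (1 / 2) ^ \<mu>" .
  have "rat_abs2 (volk_sum N (\<lambda>t. F t - poly p (of_nat t))) \<le> (1 / 2) ^ (N + \<mu>) * 2 ^ N"
    using p(3) by (rule rat_abs2_volk_sum_le)
  also have "\<dots> \<le> 2 * (1 / 2) ^ \<mu>" by (simp add: power_add power_one_over divide_right_mono)
  finally have "rat_abs2 (volk_sum N (\<lambda>t. F t - poly p (of_nat t))) \<le> 2 * (1 / 2) ^ \<mu>" .
  moreover have "volk_sum N (\<lambda>t. F t - poly p (of_nat t)) = volk_sum N F - volk_sum N (\<lambda>t. poly p (of_nat t))"
    by (simp add: volk_sum_def sum_subtractf diff_divide_distrib)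
  moreover have "rat_abs2 (poly p 0 - F 0) \<le> 2 * (1 / 2) ^ \<mu>"
  proof -
    have "rat_abs2 (poly p 0 - F 0) \<le> (1 / 2) ^ (N + \<mu>)"
      using p(3)[of 0] by (simp add: rat_abs2_diff_commute)
    also have "\<dots> \<le> (1 / 2) ^ \<mu>" by (intro power_decreasing) auto
    finally show ?thesis using zero_le_power[of "1 / 2 :: real" \<mu>] by linarith
  qed
  ultimately have "rat_abs2 ((volk_sum N F - volk_sum N (\<lambda>t. poly p (of_nat t))) +
      ((volk_sum N (\<lambda>t. poly p (of_nat t)) - poly p 0) + (poly p 0 - F 0))) \<le> 2 * (1 / 2) ^ \<mu>"
    using * by (intro rat_abs2_add_le) simp_all
  then show ?thesis by simp
qed

text \<open>The approximation must be finer than the denominators \<open>2 ^ Suc N\<close>, hence depends on \<open>N\<close>.\<close>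

lemma volk_sum_Suc_diff:
  assumes F: "F \<in> poly_lim \<mu>"
  shows "rat_abs2 (volk_sum (Suc N) F - volk_sum N F) \<le> 4 * (1 / 2) ^ N"
proof -
  obtain p where p: "rat_abs2 (coeff p 0) \<le> 1" "\<And>i. i \<ge> 1 \<Longrightarrow> rat_abs2 (coeff p i) \<le> (1 / 2) ^ \<mu>"
    "\<And>t. rat_abs2 (F t - poly p (of_nat t)) \<le> (1 / 2) ^ (2 * N)"
    using poly_limE[OF F] by blast
  have step: "volk_sum (Suc N) G - volk_sum N G = (\<Sum>t<2 ^ N. G (t + 2 ^ N) - G t) / 2 ^ Suc N" for G
    unfolding volk_sum_def power_Suc sum_lessThan_double
    by (simp add: sum.distrib sum_subtractf field_simps)
  have pow: "rat_abs2 ((\<Sum>t<2 ^ N. of_nat (t + 2 ^ N) ^ k - of_nat t ^ k) / 2 ^ Suc N) \<le> 4 * (1 / 2) ^ N" for k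
  proof -
    have "\<exists>c. int (t + 2 ^ N) ^ k = int t ^ k + int k * int t ^ (k - 1) * 2 ^ N + (2 ^ N) ^ 2 * c" for t
      using add_power_expand[of t "2 ^ N" k] by (metis of_nat_add of_nat_numeral of_nat_power)
    then obtain c where c: "\<And>t. int (t + 2 ^ N) ^ k = int t ^ k + int k * int t ^ (k - 1) * 2 ^ N + (2 ^ N) ^ 2 * c t"
      by metis
    have c': "(of_nat (t + 2 ^ N) ^ k - of_nat t ^ k :: rat) = 2 ^ N * (of_nat k * of_nat t ^ (k - 1)) + (2 ^ N) ^ 2 * of_int (c t)" for t
    proof -
      have "(of_int (int (t + 2 ^ N) ^ k) :: rat) = of_int (int t ^ k + int k * int t ^ (k - 1) * 2 ^ N + (2 ^ N) ^ 2 * c t)"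
        using c by simp
      then show ?thesis by (simp add: algebra_simps)
    qed
    \<comment> \<open>The first-order terms form a power sum with exponent k-1, small by
      \<open>power_sum_dyadic\<close>; the second-order terms keep a factor 2^N.\<close>
    have eq: "(\<Sum>t<2 ^ N. of_nat (t + 2 ^ N) ^ k - of_nat t ^ k) / 2 ^ Suc N =
        (of_nat k * (\<Sum>t<2 ^ N. of_nat t ^ (k - 1)) + 2 ^ N * (\<Sum>t<2 ^ N. of_int (c t))) / (2 :: rat)"
      unfolding c' sum.distrib sum_distrib_left[symmetric]
      by (simp add: power2_eq_square add_divide_distrib)
    have A: "rat_abs2 (of_nat k * (\<Sum>t<2 ^ N. of_nat t ^ (k - 1))) \<le> 2 * (1 / 2) ^ N"
      unfolding rat_abs2_mult
      using mult_mono[OF rat_abs2_of_nat_le_1[of k] power_sum_dyadic[where N = N and k = "k - 1"]] by simp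
    have B: "rat_abs2 (2 ^ N * (\<Sum>t<2 ^ N. of_int (c t))) \<le> 2 * (1 / 2) ^ N"
    proof -
      have "rat_abs2 (\<Sum>t<2 ^ N. of_int (c t)) \<le> 1" by (rule rat_abs2_sum_le) auto
      then have "(1 / 2) ^ N * rat_abs2 (\<Sum>t<2 ^ N. of_int (c t)) \<le> (1 / 2) ^ N * 2"
        by (intro mult_left_mono) auto
      then show ?thesis by (simp add: rat_abs2_mult rat_abs2_power)
    qed
    show ?thesis
      using rat_abs2_add_le[OF A B] unfolding eq rat_abs2_divide rat_abs2_2 by simp
  qed
  have step_power: "(\<Sum>t<2 ^ N. of_nat (t + 2 ^ N) ^ i - of_nat t ^ i) / 2 ^ Suc N =
      volk_sum (Suc N) (\<lambda>t. of_nat t ^ i) - volk_sum N (\<lambda>t. of_nat t ^ i)" for i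
    by (rule step[symmetric])
  have "volk_sum (Suc N) (\<lambda>t. poly p (of_nat t)) - volk_sum N (\<lambda>t. poly p (of_nat t)) =
      (\<Sum>i\<le>degree p. coeff p i * ((\<Sum>t<2 ^ N. of_nat (t + 2 ^ N) ^ i - of_nat t ^ i) / 2 ^ Suc N))"
    unfolding step_power poly_altdef volk_sum_sum volk_sum_cmult
    by (simp only: right_diff_distrib sum_subtractf)
  also have "rat_abs2 \<dots> \<le> 4 * (1 / 2) ^ N"
  proof (rule rat_abs2_sum_le)
    fix i
    show "rat_abs2 (coeff p i * ((\<Sum>t<2 ^ N. of_nat (t + 2 ^ N) ^ i - of_nat t ^ i) / 2 ^ Suc N)) \<le> 4 * (1 / 2) ^ N"
      unfolding rat_abs2_mult using mult_mono[OF poly_lim_coeff_le_1[OF p(1,2), of i] pow[of i]] by simp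
  qed simp
  finally have P: "rat_abs2 (volk_sum (Suc N) (\<lambda>t. poly p (of_nat t)) - volk_sum N (\<lambda>t. poly p (of_nat t))) \<le> 4 * (1 / 2) ^ N" .
  define G where "G t = F t - poly p (of_nat t)" for t
  have "rat_abs2 (volk_sum M G) \<le> (1 / 2) ^ (2 * N) * 2 ^ M" for M
    unfolding G_def using p(3) by (rule rat_abs2_volk_sum_le)
  then have "rat_abs2 (volk_sum (Suc N) G) \<le> (1 / 2) ^ (2 * N) * 2 ^ Suc N"
    "rat_abs2 (volk_sum N G) \<le> (1 / 2) ^ (2 * N) * 2 ^ N" by blast+
  then have "rat_abs2 (volk_sum (Suc N) G) \<le> 4 * (1 / 2) ^ N" "rat_abs2 (volk_sum N G) \<le> 4 * (1 / 2) ^ N"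
    by (simp_all add: power_mult power2_eq_square power_one_over field_simps power_mult_distrib)
  then have "rat_abs2 (volk_sum (Suc N) G - volk_sum N G) \<le> 4 * (1 / 2) ^ N" by (rule rat_abs2_diff_le)
  moreover have "volk_sum M G = volk_sum M F - volk_sum M (\<lambda>t. poly p (of_nat t))" for M
    by (simp add: G_def volk_sum_def sum_subtractf diff_divide_distrib)
  ultimately show ?thesis
    using rat_abs2_add_le[OF _ P, of "volk_sum (Suc N) G - volk_sum N G"] by simp
qed

lemma cauchy2_volk_sum:
  assumes F: "F \<in> poly_lim \<mu>"
  shows "cauchy2 (\<lambda>N. volk_sum N F)"
  unfolding cauchy2_def
proof (intro allI impI)
  have tail: "rat_abs2 (volk_sum (N + k) F - volk_sum N F) \<le> 4 * (1 / 2) ^ N" for N k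
  proof (induction k)
    case (Suc k)
    have "rat_abs2 (volk_sum (Suc (N + k)) F - volk_sum (N + k) F) \<le> 4 * (1 / 2) ^ (N + k)"
      by (rule volk_sum_Suc_diff[OF F])
    also have "\<dots> \<le> 4 * (1 / 2) ^ N" by (intro mult_left_mono power_decreasing) auto
    finally show ?case using rat_abs2_add_le[OF _ Suc.IH, of "volk_sum (Suc (N + k)) F - volk_sum (N + k) F"]
      by simp
  qed simp
  fix e :: real assume "e > 0"
  then obtain M where "(1 / 2) ^ M < e / 4" using real_arch_pow_inv[of "e / 4" "1 / 2"] by auto
  then have M: "4 * (1 / 2) ^ M < e" by simp
  have *: "rat_abs2 (volk_sum n F - volk_sum M F) \<le> 4 * (1 / 2) ^ M" if "n \<ge> M" for n
    using tail[of M "n - M"] that by simp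
  have "rat_abs2 (volk_sum m F - volk_sum n F) < e" if "m \<ge> M" "n \<ge> M" for m n
    using rat_abs2_diff_le[OF *[OF that(1)] *[OF that(2)]] M by simp
  then show "\<exists>M. \<forall>m\<ge>M. \<forall>n\<ge>M. rat_abs2 (volk_sum m F - volk_sum n F) < e" by blast
qed

section \<open>Families of Taylor expansions\<close>

text \<open>\<open>h t\<close> is to be thought of as the Taylor expansion of one function at
  \<open>t\<close>: its Hasse derivative of order k is divisible by 2^(\<mu> k), with a quotient in
  \<open>poly_lim\<close>. The class is closed under products and contains 1 + z t and, for \<mu>
  \<ge> 1, its inverse, provided that 2^\<mu> divides z.\<close>

definition fps_lim :: "nat \<Rightarrow> (nat \<Rightarrow> rat fps) set" where
  "fps_lim \<mu> = {h. \<forall>k. (\<lambda>t. fps_nth (h t) k / 2 ^ (\<mu> * k)) \<in> poly_lim \<mu>}"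

lemma fps_limD: "h \<in> fps_lim \<mu> \<Longrightarrow> (\<lambda>t. fps_nth (h t) k / 2 ^ (\<mu> * k)) \<in> poly_lim \<mu>"
  by (simp add: fps_lim_def)

lemma fps_lim_mult:
  assumes g: "g \<in> fps_lim \<mu>" and h: "h \<in> fps_lim \<mu>"
  shows "(\<lambda>t. g t * h t) \<in> fps_lim \<mu>"
  unfolding fps_lim_def
proof (intro CollectI allI)
  fix k
  have eq: "fps_nth (g t * h t) k / 2 ^ (\<mu> * k) =
      (\<Sum>i=0..k. (fps_nth (g t) i / 2 ^ (\<mu> * i)) * (fps_nth (h t) (k - i) / 2 ^ (\<mu> * (k - i))))" for t
    unfolding fps_mult_nth sum_divide_distrib
  proof (intro sum.cong refl)
    fix i assume "i \<in> {0..k}"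
    then have "(2 :: rat) ^ (\<mu> * k) = 2 ^ (\<mu> * i) * 2 ^ (\<mu> * (k - i))"
      by (simp flip: power_add distrib_left)
    then show "fps_nth (g t) i * fps_nth (h t) (k - i) / 2 ^ (\<mu> * k) =
        (fps_nth (g t) i / 2 ^ (\<mu> * i)) * (fps_nth (h t) (k - i) / 2 ^ (\<mu> * (k - i)))" by simp
  qed
  show "(\<lambda>t. fps_nth (g t * h t) k / 2 ^ (\<mu> * k)) \<in> poly_lim \<mu>"
    unfolding eq by (intro poly_lim_sum poly_lim_mult fps_limD g h)
qed

lemma fps_lim_1: "(\<lambda>t. 1) \<in> fps_lim \<mu>"
proof -
  have "(\<lambda>t. fps_nth 1 k / 2 ^ (\<mu> * k) :: rat) \<in> poly_lim \<mu>" for k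
    by (cases k) (auto intro: poly_lim_const)
  then show ?thesis by (simp add: fps_lim_def)
qed

lemma fps_lim_power: "h \<in> fps_lim \<mu> \<Longrightarrow> (\<lambda>t. h t ^ n) \<in> fps_lim \<mu>"
  by (induction n) (auto intro: fps_lim_mult fps_lim_1)

lemma fps_lim_prod: "(\<And>i. i \<in> A \<Longrightarrow> h i \<in> fps_lim \<mu>) \<Longrightarrow> (\<lambda>t. \<Prod>i\<in>A. h i t) \<in> fps_lim \<mu>"
  by (induction A rule: infinite_finite_induct) (auto intro: fps_lim_mult fps_lim_1)

text \<open>The Taylor expansion at \<open>t\<close> of the linear function \<open>1 + z * t\<close>.\<close>

definition lin_fps :: "rat \<Rightarrow> nat \<Rightarrow> rat fps" where
  "lin_fps z t = fps_const (1 + z * of_nat t) + fps_const z * fps_X"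

lemma lin_fps_nth:
  "fps_nth (lin_fps z t) k = (if k = 0 then 1 + z * of_nat t else if k = 1 then z else 0)"
  by (simp add: lin_fps_def)

lemma fps_lim_lin_fps:
  assumes "rat_abs2 z \<le> (1 / 2) ^ \<mu>"
  shows "lin_fps z \<in> fps_lim \<mu>"
proof -
  have "rat_abs2 (z / 2 ^ \<mu>) \<le> 1"
    using assms by (simp add: rat_abs2_divide rat_abs2_power power_one_over field_simps)
  moreover have "(\<lambda>t. 1 + z * of_nat t) \<in> poly_lim \<mu>" using assms by (intro poly_lim_linear) auto
  ultimately have "(\<lambda>t. fps_nth (lin_fps z t) k / 2 ^ (\<mu> * k)) \<in> poly_lim \<mu>" for k
    by (cases "k = 0"; cases "k = 1") (auto simp: lin_fps_nth intro: poly_lim_const)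
  then show ?thesis by (simp add: fps_lim_def)
qed

lemma inverse_linear_fps:
  fixes a :: "'a :: field"
  assumes "a \<noteq> 0"
  shows "inverse (fps_const a + fps_const z * fps_X) = Abs_fps (\<lambda>k. (- z) ^ k / a ^ Suc k)"
proof (rule fps_inverse_unique)
  show "(fps_const a + fps_const z * fps_X) * Abs_fps (\<lambda>k. (- z) ^ k / a ^ Suc k) = 1"
  proof (rule fps_ext)
    fix k
    show "fps_nth ((fps_const a + fps_const z * fps_X) * Abs_fps (\<lambda>k. (- z) ^ k / a ^ Suc k)) k = fps_nth 1 k"
      using assms by (cases k) (simp_all add: distrib_right mult.assoc fps_X_mult_nth)
  qed
qed

lemma fps_lim_inverse_lin_fps:
  assumes z: "rat_abs2 z \<le> (1 / 2) ^ \<mu>" and \<mu>: "\<mu> \<ge> 1"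
  shows "(\<lambda>t. inverse (lin_fps z t)) \<in> fps_lim \<mu>"
proof -
  have "(1 / 2 :: real) ^ \<mu> \<le> (1 / 2) ^ 1" using \<mu> by (intro power_decreasing) auto
  with z have "rat_abs2 z < 1" by simp
  then have "rat_abs2 (1 + z * of_nat t) = 1" for t by (rule rat_abs2_one_plus)
  then have nz: "1 + z * of_nat t \<noteq> 0" for t by (metis rat_abs2_0 zero_neq_one)
  have z1: "rat_abs2 (- z / 2 ^ \<mu>) \<le> 1"
    using z by (simp add: rat_abs2_divide rat_abs2_power power_one_over field_simps)
  have eq: "fps_nth (inverse (lin_fps z t)) k / 2 ^ (\<mu> * k) = (- z / 2 ^ \<mu>) ^ k * inverse (1 + z * of_nat t) ^ Suc k" for t k
    unfolding lin_fps_def inverse_linear_fps[OF nz]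
    by (simp only: fps_nth_Abs_fps power_mult_distrib power_mult divide_inverse power_inverse
        mult.assoc mult.commute mult.left_commute)
  have "(\<lambda>t. fps_nth (inverse (lin_fps z t)) k / 2 ^ (\<mu> * k)) \<in> poly_lim \<mu>" for k
    unfolding eq using z1 z \<mu>
    by (intro poly_lim_mult poly_lim_power poly_lim_inverse poly_lim_const)
      (simp_all add: rat_abs2_power power_le_one)
  then show ?thesis by (simp add: fps_lim_def)
qed

lemma fps_lim_mono:
  assumes "\<mu> \<le> \<nu>" "h \<in> fps_lim \<nu>"
  shows "h \<in> fps_lim \<mu>"
  unfolding fps_lim_def
proof (intro CollectI allI)
  fix k
  have eq: "fps_nth (h t) k / 2 ^ (\<mu> * k) = 2 ^ ((\<nu> - \<mu>) * k) * (fps_nth (h t) k / 2 ^ (\<nu> * k))" for t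
  proof -
    have "(2 :: rat) ^ (\<nu> * k) = 2 ^ ((\<nu> - \<mu>) * k) * 2 ^ (\<mu> * k)"
      using assms(1) by (simp flip: power_add distrib_right)
    then show ?thesis by simp
  qed
  show "(\<lambda>t. fps_nth (h t) k / 2 ^ (\<mu> * k)) \<in> poly_lim \<mu>"
    unfolding eq by (intro poly_lim_mult poly_lim_const poly_lim_mono[OF assms(1)] fps_limD assms(2))
      (simp add: rat_abs2_power power_le_one)
qed

lemma lin_fps_power_nth:
  "fps_nth (lin_fps z t ^ b) i = of_nat (b choose i) * z ^ i * (1 + z * of_nat t) ^ (b - i)"
proof -
  have "lin_fps z t ^ b = (\<Sum>k\<le>b. of_nat (b choose k) * (fps_const z * fps_X) ^ k * fps_const (1 + z * of_nat t) ^ (b - k))"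
    unfolding lin_fps_def by (subst add.commute) (rule binomial_ring)
  also have "\<dots> = (\<Sum>k\<le>b. fps_const (of_nat (b choose k) * z ^ k * (1 + z * of_nat t) ^ (b - k)) * fps_X ^ k)"
    by (intro sum.cong refl) (simp add: power_mult_distrib fps_const_power fps_of_nat[symmetric] ac_simps flip: fps_const_mult)
  finally show ?thesis
    by (simp add: fps_sum_nth fps_X_power_nth if_distrib[where f = "(*) _"] cong: if_cong)
qed

section \<open>The dominant term in a derivative of a b-th power\<close>

lemma choose_complement: "2 \<le> b \<Longrightarrow> j \<le> b - 2 \<Longrightarrow> b choose (b - 2 - j) = b choose (j + 2)" for b j :: nat
  using binomial_symmetric[of "j + 2" b] by simp

text \<open>Among the terms $\binom{b}{j+2}2^j$ the one with $j=0$ is 2-adically dominant, since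
  $(j+1)(j+2)\binom{b}{j+2} = 2\binom{b}{2}\binom{b-2}{j}$ and $2^{j+1}/((j+1)(j+2))$ is 2-adically even
  for $j\ge1$.\<close>

lemma choose_two_dominates:
  assumes "j \<ge> 1"
  shows "rat_abs2 (of_nat (b choose (j + 2)) * 2 ^ j) \<le> rat_abs2 (of_nat (b choose 2)) / 2"
proof (cases "j + 2 \<le> b")
  case False
  then show ?thesis by (simp add: binomial_eq_0)
next
  case True
  have "(j + 2) * (b choose (j + 2)) = b * ((b - 1) choose (j + 1))"
    using binomial_absorption[of "j + 1" b] by simp
  moreover have "(j + 1) * ((b - 1) choose (j + 1)) = (b - 1) * ((b - 2) choose j)"
    using binomial_absorption[of j "b - 1"] by (simp add: numeral_2_eq_2)
  moreover have "2 * (b choose 2) = b * (b - 1)"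
    using binomial_absorption[of 1 b] by (simp add: numeral_2_eq_2)
  ultimately have "(j + 1) * (j + 2) * (b choose (j + 2)) = 2 * (b choose 2) * ((b - 2) choose j)"
    by (metis mult.assoc mult.left_commute)
  then have eq: "of_nat ((j + 1) * (j + 2)) * of_nat (b choose (j + 2)) = (2 :: rat) * of_nat (b choose 2) * of_nat ((b - 2) choose j)"
    by (metis of_nat_mult of_nat_numeral)
  have pow: "(1 / 2) ^ j \<le> rat_abs2 (of_nat ((j + 1) * (j + 2)))"
  proof -
    have *: "rat_abs2 (of_nat m) \<ge> 1 / real m" if "m > 0" for m
    proof -
      have "2 ^ multiplicity 2 (int m) \<le> int m"
        using that by (intro zdvd_imp_le multiplicity_dvd) auto
      then have "(2 :: real) ^ multiplicity 2 (int m) \<le> real m"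
        by (metis of_int_le_iff of_int_numeral of_int_of_nat_eq of_int_power)
      then have "1 / real m \<le> 1 / 2 ^ multiplicity 2 (int m)"
        using that by (intro divide_left_mono) auto
      then show ?thesis using that rat_abs2_of_int[of "int m"] by (simp add: power_one_over)
    qed
    consider "even j" | "odd j" by blast
    then show ?thesis
    proof cases
      case 1
      then have "rat_abs2 (of_nat (j + 1)) = 1" by (intro rat_abs2_odd_nat) simp
      moreover have "j + 2 \<le> 2 ^ j" using 1 assms
      proof -
        have "m + 4 \<le> 2 ^ (m + 2)" for m :: nat by (induction m) auto
        moreover have "j \<ge> 2" using 1 assms by (cases "j = 1") auto
        then obtain m where "j = m + 2" by (metis add.commute le_Suc_ex)
        ultimately show ?thesis by (metis add.assoc numeral_Bit0)
      qed
      moreover have "1 / 2 ^ j \<le> 1 / real (j + 2)"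
        using calculation(2) by (intro divide_left_mono) (auto simp: real_of_nat_ge_one_iff simp flip: of_nat_le_iff[where ?'a = real])
      ultimately show ?thesis using *[of "j + 2"]
        unfolding of_nat_mult rat_abs2_mult power_one_over by simp
    next
      case 2
      then have "rat_abs2 (of_nat (j + 2)) = 1" by (intro rat_abs2_odd_nat) simp
      moreover have "j + 1 \<le> 2 ^ j" by (induction j) auto
      moreover have "1 / 2 ^ j \<le> 1 / real (j + 1)"
        using calculation(2) by (intro divide_left_mono) (auto simp flip: of_nat_le_iff[where ?'a = real])
      ultimately show ?thesis using *[of "j + 1"]
        unfolding of_nat_mult rat_abs2_mult power_one_over by simp
    qed
  qed
  have "rat_abs2 (of_nat (b choose (j + 2)) * 2 ^ j) =
      rat_abs2 (of_nat (b choose (j + 2))) * (1 / 2) ^ j"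
    by (simp add: rat_abs2_mult rat_abs2_power)
  also have "\<dots> \<le> rat_abs2 (of_nat (b choose (j + 2))) * rat_abs2 (of_nat ((j + 1) * (j + 2)))"
    by (intro mult_left_mono pow) auto
  also have "\<dots> = rat_abs2 (of_nat ((j + 1) * (j + 2)) * of_nat (b choose (j + 2)))"
    by (simp only: rat_abs2_mult mult.commute)
  also have "\<dots> = rat_abs2 (of_nat (b choose 2)) / 2 * rat_abs2 (of_nat ((b - 2) choose j))"
    unfolding eq by (simp add: rat_abs2_mult)
  also have "\<dots> \<le> rat_abs2 (of_nat (b choose 2)) / 2 * 1"
    by (intro mult_left_mono) auto
  finally show ?thesis by simp
qed

text \<open>Leibniz rule; \<open>j\<close> counts the derivatives that fall on \<open>h\<close>.
  With b-2 derivatives in all, at least two of the b linear factors stay undifferentiated, whence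
  the shift \<open>j + 2\<close>.\<close>

lemma lin_fps_power_mult_nth:
  assumes b: "b \<ge> 2"
  shows "fps_nth (lin_fps z t ^ b * h) (b - 2) =
    (\<Sum>j\<le>b - 2. of_nat (b choose (j + 2)) * z ^ (b - 2 - j) * ((1 + z * of_nat t) ^ (j + 2) * fps_nth h j))"
proof -
  have "fps_nth (lin_fps z t ^ b * h) (b - 2) =
      (\<Sum>j=0..b - 2. fps_nth h j * fps_nth (lin_fps z t ^ b) (b - 2 - j))"
    by (subst mult.commute) (rule fps_mult_nth)
  also have "\<dots> = (\<Sum>j\<le>b - 2. of_nat (b choose (j + 2)) * z ^ (b - 2 - j) * ((1 + z * of_nat t) ^ (j + 2) * fps_nth h j))"
    unfolding atMost_atLeast0
  proof (intro sum.cong refl)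
    fix j assume "j \<in> {0..b - 2}"
    then have j: "j \<le> b - 2" by simp
    then have "b - (b - 2 - j) = j + 2" using b by linarith
    then show "fps_nth h j * fps_nth (lin_fps z t ^ b) (b - 2 - j) =
        of_nat (b choose (j + 2)) * z ^ (b - 2 - j) * ((1 + z * of_nat t) ^ (j + 2) * fps_nth h j)"
      by (simp only: lin_fps_power_nth choose_complement[OF b j] mult.assoc mult.commute mult.left_commute)
  qed
  finally show ?thesis .
qed

text \<open>The powers 2^(b-2-j) from the linear factor and 4^j from \<open>h\<close> combine to
  2^(b-2) 2^j, and \<open>choose_two_dominates\<close> singles out j = 0. That integrand lies in
  \<open>poly_lim 2\<close>, where a Volkenborn sum differs from the value at 0 by at most 1/2, so a
  unit value at 0 makes the sum a unit.\<close>

lemma volk_sum_main_term: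
  assumes b: "b \<ge> 2" and h: "h \<in> fps_lim 2" and h0: "rat_abs2 (fps_nth (h 0) 0) = 1"
  shows "rat_abs2 (volk_sum N (\<lambda>t. fps_nth (lin_fps 2 t ^ b * h t) (b - 2))) =
    (1 / 2) ^ (b - 2) * rat_abs2 (of_nat (b choose 2))"
proof -
  define C where "C = rat_abs2 (of_nat (b choose 2))"
  have C: "C > 0" using b by (simp add: C_def rat_abs2_pos)
  define G where "G j t = (1 + 2 * of_nat t) ^ (j + 2) * (fps_nth (h t) j / 4 ^ j)" for j t
  have scaled: "2 ^ (b - 2 - j) * ((1 + 2 * of_nat t) ^ (j + 2) * fps_nth (h t) j) = 2 ^ (b - 2) * (2 ^ j * G j t)"
    if "j \<le> b - 2" for j t
  proof -
    have "(2 :: rat) ^ (b - 2) = 2 ^ (b - 2 - j) * 2 ^ j" using that by (simp flip: power_add)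
    moreover have "(4 :: rat) ^ j = 2 ^ j * 2 ^ j" by (simp flip: power_mult_distrib)
    ultimately show ?thesis by (simp add: G_def)
  qed
  have eq: "volk_sum N (\<lambda>t. fps_nth (lin_fps 2 t ^ b * h t) (b - 2)) =
      2 ^ (b - 2) * (\<Sum>j\<le>b - 2. of_nat (b choose (j + 2)) * 2 ^ j * volk_sum N (G j))"
  proof -
    have "volk_sum N (\<lambda>t. fps_nth (lin_fps 2 t ^ b * h t) (b - 2)) =
        volk_sum N (\<lambda>t. \<Sum>j\<le>b - 2. (2 ^ (b - 2) * (of_nat (b choose (j + 2)) * 2 ^ j)) * G j t)"
      unfolding lin_fps_power_mult_nth[OF b]
    proof (intro arg_cong[where f = "volk_sum N"] ext sum.cong refl)
      fix t j assume "j \<in> {..b - 2}"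
      then have "j \<le> b - 2" by simp
      from scaled[OF this, of t]
      show "of_nat (b choose (j + 2)) * 2 ^ (b - 2 - j) * ((1 + 2 * of_nat t) ^ (j + 2) * fps_nth (h t) j) =
          (2 ^ (b - 2) * (of_nat (b choose (j + 2)) * 2 ^ j)) * G j t"
        by (simp only: mult.assoc) (simp only: mult.left_commute)
    qed
    then show ?thesis by (simp only: volk_sum_sum volk_sum_cmult sum_distrib_left mult.assoc)
  qed
  have h': "(\<lambda>t. fps_nth (h t) j / 4 ^ j) \<in> poly_lim 2" for j
    using fps_limD[OF h, of j] by (simp add: power_mult)
  \<comment> \<open>1 + 2t alone belongs only to \<open>poly_lim 1\<close>; the nonconstant
    coefficients of its square are divisible by 4.\<close>
  have G0: "G 0 \<in> poly_lim 2"
  proof -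
    have "(\<lambda>t. 1 + 4 * of_nat t + (4 * of_nat t) * of_nat t) \<in> poly_lim 2"
    proof (rule poly_limI)
      fix M :: nat
      show "\<exists>p. rat_abs2 (coeff p 0) \<le> 1 \<and> (\<forall>i\<ge>1. rat_abs2 (coeff p i) \<le> (1 / 2)\<^sup>2) \<and>
        (\<forall>t. rat_abs2 (1 + 4 * of_nat t + (4 * of_nat t) * of_nat t - poly p (of_nat t)) \<le> (1 / 2) ^ M)"
        by (intro exI[of _ "[:1, 4, 4:]"])
          (auto simp: coeff_pCons power2_eq_square algebra_simps split: nat.split)
    qed
    moreover have "(1 + 2 * of_nat t)\<^sup>2 = 1 + 4 * of_nat t + (4 * of_nat t) * (of_nat t :: rat)" for t
      by (simp add: power2_eq_square algebra_simps)
    ultimately have "(\<lambda>t. (1 + 2 * of_nat t)\<^sup>2 :: rat) \<in> poly_lim 2" by simp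
    then have "(\<lambda>t. (1 + 2 * of_nat t)\<^sup>2 * (fps_nth (h t) 0 / 4 ^ 0)) \<in> poly_lim 2"
      by (rule poly_lim_mult) (rule h')
    then show ?thesis by (simp add: G_def[abs_def] power2_eq_square)
  qed
  have G1: "G j \<in> poly_lim 1" for j
    unfolding G_def[abs_def]
    by (intro poly_lim_mult poly_lim_power poly_lim_linear poly_lim_mono[OF _ h']) auto
  have S0: "rat_abs2 (volk_sum N (G 0)) = 1"
  proof -
    have "rat_abs2 (volk_sum N (G 0) - G 0 0) \<le> 1 / 2"
      using volk_sum_poly_lim[OF G0, of N] by (simp add: power2_eq_square)
    moreover have "rat_abs2 (G 0 0) = 1" using h0 by (simp add: G_def)
    ultimately show ?thesis using rat_abs2_unit_add[of "G 0 0" "volk_sum N (G 0) - G 0 0"] by simp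
  qed
  have S1: "rat_abs2 (volk_sum N (G j)) \<le> 1" for j
  proof -
    have "rat_abs2 (volk_sum N (G j) - G j 0) \<le> 1" using volk_sum_poly_lim[OF G1, of N j] by simp
    then show ?thesis using rat_abs2_add_le[OF _ poly_lim_le_1[OF G1, of j 0]] by fastforce
  qed
  have rest: "rat_abs2 (\<Sum>j=1..b - 2. of_nat (b choose (j + 2)) * 2 ^ j * volk_sum N (G j)) \<le> C / 2"
  proof (rule rat_abs2_sum_le)
    fix j assume "j \<in> {1..b - 2}"
    then have "rat_abs2 (of_nat (b choose (j + 2)) * 2 ^ j) * rat_abs2 (volk_sum N (G j)) \<le> C / 2 * 1"
      unfolding C_def by (intro mult_mono choose_two_dominates S1) auto
    then show "rat_abs2 (of_nat (b choose (j + 2)) * 2 ^ j * volk_sum N (G j)) \<le> C / 2"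
      by (simp only: rat_abs2_mult mult_1_right)
  qed (use C in simp)
  have "(\<Sum>j\<le>b - 2. of_nat (b choose (j + 2)) * 2 ^ j * volk_sum N (G j)) =
      of_nat (b choose 2) * volk_sum N (G 0) + (\<Sum>j=1..b - 2. of_nat (b choose (j + 2)) * 2 ^ j * volk_sum N (G j))"
    by (simp add: atMost_atLeast0 sum.atLeast_Suc_atMost numeral_2_eq_2)
  moreover have "rat_abs2 (of_nat (b choose 2) * volk_sum N (G 0)) = C"
    by (simp add: rat_abs2_mult S0 C_def)
  ultimately have "rat_abs2 (\<Sum>j\<le>b - 2. of_nat (b choose (j + 2)) * 2 ^ j * volk_sum N (G j)) = C"
    using rat_abs2_add_eq[of "\<Sum>j=1..b - 2. of_nat (b choose (j + 2)) * 2 ^ j * volk_sum N (G j)"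
        "of_nat (b choose 2) * volk_sum N (G 0)"] rest C by simp
  then show ?thesis unfolding eq by (simp add: rat_abs2_mult rat_abs2_power C_def)
qed

text \<open>With slope 1 the integrands are only in \<open>poly_lim 0\<close>, so the 2 in the
  Bernoulli denominators is not compensated. The even binomial coefficient of
  \<open>rat_abs2_dyadic_binomial\<close> will pay for it.\<close>

lemma volk_sum_side_term:
  assumes b: "b \<ge> 2" and h: "h \<in> fps_lim 1"
  shows "rat_abs2 (volk_sum N (\<lambda>t. fps_nth (lin_fps 1 t ^ b * h t) (b - 2))) \<le> 2 * rat_abs2 (of_nat (b choose 2))"
proof -
  define C where "C = rat_abs2 (of_nat (b choose 2))"
  define G where "G j t = (1 + 1 * of_nat t) ^ (j + 2) * (fps_nth (h t) j / 2 ^ j)" for j t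
  have "(\<lambda>t. fps_nth (h t) j / 2 ^ j) \<in> poly_lim 1" for j
    using fps_limD[OF h, of j] by simp
  then have G: "G j \<in> poly_lim 0" for j
    unfolding G_def[abs_def]
    by (intro poly_lim_mult poly_lim_power poly_lim_linear poly_lim_mono[of 0 1]) auto
  have S: "rat_abs2 (volk_sum N (G j)) \<le> 2" for j
  proof -
    have "rat_abs2 (volk_sum N (G j) - G j 0) \<le> 2" using volk_sum_poly_lim[OF G, of N j] by simp
    moreover have "rat_abs2 (G j 0) \<le> 2" using poly_lim_le_1[OF G, of j 0] by simp
    ultimately show ?thesis using rat_abs2_add_le[of "volk_sum N (G j) - G j 0" 2 "G j 0"] by simp
  qed
  have "volk_sum N (\<lambda>t. fps_nth (lin_fps 1 t ^ b * h t) (b - 2)) =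
      volk_sum N (\<lambda>t. \<Sum>j\<le>b - 2. (of_nat (b choose (j + 2)) * 2 ^ j) * G j t)"
    unfolding lin_fps_power_mult_nth[OF b] by (simp add: G_def mult.assoc)
  also have "\<dots> = (\<Sum>j\<le>b - 2. (of_nat (b choose (j + 2)) * 2 ^ j) * volk_sum N (G j))"
    by (simp only: volk_sum_sum volk_sum_cmult)
  also have "rat_abs2 \<dots> \<le> 2 * C"
  proof (rule rat_abs2_sum_le)
    fix j
    have "rat_abs2 (of_nat (b choose (j + 2)) * 2 ^ j) \<le> C"
    proof (cases "j = 0")
      case False
      then have "rat_abs2 (of_nat (b choose (j + 2)) * 2 ^ j) \<le> C / 2"
        unfolding C_def by (intro choose_two_dominates) simp
      also have "\<dots> \<le> C" by (simp add: C_def)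
      finally show ?thesis .
    qed (simp add: C_def numeral_2_eq_2)
    then have "rat_abs2 (of_nat (b choose (j + 2)) * 2 ^ j) * rat_abs2 (volk_sum N (G j)) \<le> C * 2"
      using S by (intro mult_mono) (auto simp: C_def)
    then show "rat_abs2 (of_nat (b choose (j + 2)) * 2 ^ j * volk_sum N (G j)) \<le> 2 * C"
      by (simp only: rat_abs2_mult mult.commute[of C])
  qed (simp add: C_def)
  finally show ?thesis by (simp add: C_def)
qed

section \<open>The exact 2-adic absolute value of the Volkenborn sums\<close>

text \<open>The Taylor expansion at u of the linear polynomial x + c, where
  \<open>a = u + c\<close>. With power series in the increment, Hasse derivatives are plain
  coefficients.\<close>

definition shift_fps :: "rat \<Rightarrow> rat fps" where
  "shift_fps a = fps_const a + fps_X"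

definition num_fps :: "nat \<Rightarrow> nat \<Rightarrow> nat \<Rightarrow> rat \<Rightarrow> rat fps" where
  "num_fps n b \<epsilon> u = (\<Prod>m=1..n. shift_fps (u + of_int (4 * int m - 1)) * shift_fps (u + of_int (4 * int m - 3))) ^ b *
     shift_fps (u + of_nat (2 * n)) ^ \<epsilon>"

definition den_fps :: "nat \<Rightarrow> nat \<Rightarrow> rat \<Rightarrow> rat fps" where
  "den_fps n b u = (\<Prod>k=0..n. shift_fps (u + of_nat (4 * k))) ^ (2 * b)"

definition quot_fps :: "nat \<Rightarrow> nat \<Rightarrow> nat \<Rightarrow> rat \<Rightarrow> rat fps" where
  "quot_fps n b \<epsilon> u = num_fps n b \<epsilon> u * inverse (den_fps n b u)"

definition integrand :: "nat \<Rightarrow> nat \<Rightarrow> nat \<Rightarrow> nat \<Rightarrow> rat" where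
  "integrand n b \<epsilon> t = fps_nth (quot_fps n b \<epsilon> (4 * of_nat t + 1)) (b - 2)"

text \<open>Measuring the increment in units of the step \<open>s\<close> leaves a constant times 1
  + (s/\<alpha>)(t + X), so that only the slope s/\<alpha> matters 2-adically.\<close>

lemma shift_fps_scale:
  assumes "\<alpha> \<noteq> 0"
  shows "shift_fps (\<alpha> + s * of_nat t) oo (fps_const s * fps_X) = fps_const \<alpha> * lin_fps (s / \<alpha>) t"
proof -
  have "shift_fps (\<alpha> + s * of_nat t) oo (fps_const s * fps_X) = fps_const (\<alpha> + s * of_nat t) + fps_const s * fps_X"
    by (simp add: shift_fps_def fps_compose_add_distrib)
  also have "\<dots> = fps_const \<alpha> * lin_fps (s / \<alpha>) t"
    by (rule fps_ext) (use assms in \<open>auto simp: lin_fps_nth field_simps\<close>)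
  finally show ?thesis .
qed

lemma rat_abs2_nat_bounds:
  assumes "0 < x" "x < 2 ^ r"
  shows "2 * (1 / 2) ^ r \<le> rat_abs2 (of_nat x)"
proof -
  define e where "e = multiplicity 2 (int x)"
  have "2 ^ e dvd int x" by (simp add: e_def multiplicity_dvd)
  then have "2 ^ e \<le> int x" using assms(1) by (intro zdvd_imp_le) auto
  also have "\<dots> < 2 ^ r" using assms(2) by (metis of_nat_less_iff of_nat_numeral of_nat_power)
  finally have "e < r" by simp
  then have "(1 / 2 :: real) ^ (r - 1) \<le> (1 / 2) ^ e" by (intro power_decreasing) auto
  moreover have "(1 / 2 :: real) ^ (r - 1) = 2 * (1 / 2) ^ r" using \<open>e < r\<close> by (cases r) auto
  moreover have "rat_abs2 (of_nat x) = (1 / 2) ^ e" using rat_abs2_of_int[of "int x"] assms(1) by (simp add: e_def)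
  ultimately show ?thesis by metis
qed

text \<open>Below 2^(r+1) the only positive multiple of 2^r is 2^r itself.\<close>

lemma rat_abs2_nat_bounds_double:
  assumes "0 < x" "x < 2 ^ Suc r" "x \<noteq> 2 ^ r"
  shows "2 * (1 / 2) ^ r \<le> rat_abs2 (of_nat x)"
proof -
  define e where "e = multiplicity 2 (int x)"
  obtain y where y: "int x = 2 ^ e * y" unfolding e_def using multiplicity_dvd[of 2 "int x"] by (auto elim: dvdE)
  have "y > 0" using y assms(1) by (metis of_nat_0_less_iff zero_less_mult_pos zero_less_numeral zero_less_power)
  have "e < r"
  proof (rule ccontr)
    assume "\<not> e < r"
    then obtain d where d: "e = r + d" by (metis le_Suc_ex linorder_not_less)
    have x2: "int x < 2 * 2 ^ r" using assms(2) by (metis of_nat_less_iff of_nat_numeral of_nat_power power_Suc)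
    have "int x = 2 ^ r * (2 ^ d * y)" using y d by (simp add: power_add mult.assoc)
    then have "2 ^ d * y < 2" using x2 by simp
    moreover have "2 ^ d * y > 0" using \<open>y > 0\<close> by simp
    ultimately have "2 ^ d * y = 1" by linarith
    then have "int x = 2 ^ r" using \<open>int x = 2 ^ r * (2 ^ d * y)\<close> by simp
    then show False using assms(3) by (metis of_nat_eq_iff of_nat_numeral of_nat_power)
  qed
  then have "(1 / 2 :: real) ^ (r - 1) \<le> (1 / 2) ^ e" by (intro power_decreasing) auto
  moreover have "(1 / 2 :: real) ^ (r - 1) = 2 * (1 / 2) ^ r" using \<open>e < r\<close> by (cases r) auto
  moreover have "rat_abs2 (of_nat x) = (1 / 2) ^ e" using rat_abs2_of_int[of "int x"] assms(1) by (simp add: e_def)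
  ultimately show ?thesis by metis
qed

text \<open>c times this coefficient is 2^r times another one, and 2^r does not divide c. In
  Kummer's terms, adding c to 2^r - 1 in base 2 produces a carry.\<close>

lemma rat_abs2_dyadic_binomial:
  assumes "0 < c" "c < 2 ^ r"
  shows "rat_abs2 (of_nat ((c + (2 ^ r - 1)) choose c)) \<le> 1 / 2"
proof -
  define N where "N = c + (2 ^ r - 1 :: nat)"
  obtain k where k: "c = Suc k" using assms(1) by (cases c) auto
  have "Suc k * (N choose Suc k) = (N - k) * (N choose k)"
    using binomial_absorption[of k N] binomial_absorb_comp[of N k] by simp
  moreover have "N - k = 2 ^ r" by (simp add: N_def k)
  ultimately have "c * (N choose c) = 2 ^ r * (N choose k)" using k by simp
  then have "rat_abs2 (of_nat (c * (N choose c))) = rat_abs2 (of_nat (2 ^ r * (N choose k)))" by simp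
  then have "rat_abs2 (of_nat c) * rat_abs2 (of_nat (N choose c)) = (1 / 2) ^ r * rat_abs2 (of_nat (N choose k))"
    by (simp add: rat_abs2_mult rat_abs2_power)
  also have "\<dots> \<le> (1 / 2) ^ r * 1" by (intro mult_left_mono) auto
  finally have le: "rat_abs2 (of_nat c) * rat_abs2 (of_nat (N choose c)) \<le> (1 / 2) ^ r" by simp
  have "2 * (1 / 2) ^ r * rat_abs2 (of_nat (N choose c)) \<le> rat_abs2 (of_nat c) * rat_abs2 (of_nat (N choose c))"
    by (intro mult_right_mono rat_abs2_nat_bounds assms) auto
  from order_trans[OF this le] have "(1 / 2) ^ r * (2 * rat_abs2 (of_nat (N choose c))) \<le> (1 / 2) ^ r * 1"
    by (simp only: mult.assoc mult.left_commute mult_1_right)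
  then have "2 * rat_abs2 (of_nat (N choose c)) \<le> 1"
    by (simp only: mult_le_cancel_left_pos zero_less_power half_gt_zero_iff zero_less_one)
  then show ?thesis by (simp add: N_def)
qed

lemma prod_shift_eq_fact: "(\<Prod>m=1..n. c + m) = fact n * ((c + n) choose c)" for c n :: nat
proof -
  have "fact c * (\<Prod>m=1..n. c + m) = (fact (c + n) :: nat)"
    by (induction n) (simp_all add: algebra_simps)
  also have "\<dots> = fact c * (fact n * ((c + n) choose c))"
    using binomial_fact_lemma[of c "c + n"] by (simp add: ac_simps)
  finally show ?thesis by simp
qed

lemma fps_prod_nth_0: "fps_nth (\<Prod>i\<in>A. f i) 0 = (\<Prod>i\<in>A. fps_nth (f i) 0)" for f :: "'b \<Rightarrow> rat fps"
  by (induction A rule: infinite_finite_induct) simp_all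

section \<open>The integrand on the residue classes modulo 2^r\<close>

context
  fixes r n b \<epsilon> :: nat
  assumes r: "r \<ge> 1" and n: "n = 2 ^ r - 1" and b: "b \<ge> 2"
begin

text \<open>The factors whose slope is divisible by 4 in every residue class: their constants are
  odd or, for 4(c+m) - 2, twice an odd number, and r \<ge> 1. The numerators 4(c+m), with slope
  2^r/(c+m), need separate treatment.\<close>

definition unit_part :: "nat \<Rightarrow> nat \<Rightarrow> rat fps" where
  "unit_part c t = (\<Prod>m=1..n. lin_fps (2 ^ (r + 2) / of_int (4 * int (c + m) - 2)) t) ^ b *
     lin_fps (2 ^ (r + 2) / of_nat (4 * c + 1 + 2 * n)) t ^ \<epsilon> *
     (\<Prod>k=0..n. inverse (lin_fps (2 ^ (r + 2) / of_nat (4 * c + 1 + 4 * k)) t)) ^ (2 * b)"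

definition const_part :: "nat \<Rightarrow> rat" where
  "const_part c = (\<Prod>m=1..n. of_nat (4 * (c + m)) * of_int (4 * int (c + m) - 2)) ^ b *
     of_nat (4 * c + 1 + 2 * n) ^ \<epsilon> * inverse (\<Prod>k=0..n. of_nat (4 * c + 1 + 4 * k)) ^ (2 * b)"

text \<open>When t moves in steps of 2^r, u = 4t+1 moves in steps of 2^(r+2); the increment X is
  scaled accordingly, and each linear factor is normalized by
  \<open>shift_fps_scale\<close>.\<close>

lemma quot_fps_scale:
  "quot_fps n b \<epsilon> (4 * of_nat (2 ^ r * t + c) + 1) oo (fps_const (2 ^ (r + 2)) * fps_X) =
    fps_const (const_part c) * ((\<Prod>m=1..n. lin_fps (2 ^ r / of_nat (c + m)) t) ^ b * unit_part c t)"
proof -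
  let ?s = "fps_const (2 ^ (r + 2)) * fps_X :: rat fps"
  have s0: "fps_nth ?s 0 = 0" by simp
  have arg: "4 * of_nat (2 ^ r * t + c) + 1 + a = (4 * of_nat c + 1 + a) + 2 ^ (r + 2) * (of_nat t :: rat)" for a
    by (simp add: power_add)
  have A1: "shift_fps (4 * of_nat (2 ^ r * t + c) + 1 + of_int (4 * int m - 1)) oo ?s =
      fps_const (of_nat (4 * (c + m))) * lin_fps (2 ^ r / of_nat (c + m)) t" if "m \<in> {1..n}" for m
  proof -
    have e: "4 * of_nat c + 1 + of_int (4 * int m - 1) = (of_nat (4 * (c + m)) :: rat)" by simp
    have "(of_nat (4 * (c + m)) :: rat) \<noteq> 0" using that by (subst of_nat_eq_0_iff) auto
    moreover have "2 ^ (r + 2) / of_nat (4 * (c + m)) = (4 * 2 ^ r) / (4 * of_nat (c + m) :: rat)"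
      by (simp only: of_nat_mult of_nat_numeral) (simp add: power_add)
    then have "2 ^ (r + 2) / of_nat (4 * (c + m)) = 2 ^ r / (of_nat (c + m) :: rat)"
      by (simp only: mult_divide_mult_cancel_left zero_neq_numeral[symmetric] not_False_eq_True)
    ultimately show ?thesis unfolding arg e using shift_fps_scale[of "of_nat (4 * (c + m))" "2 ^ (r + 2)" t] by simp
  qed
  have A2: "shift_fps (4 * of_nat (2 ^ r * t + c) + 1 + of_int (4 * int m - 3)) oo ?s =
      fps_const (of_int (4 * int (c + m) - 2)) * lin_fps (2 ^ (r + 2) / of_int (4 * int (c + m) - 2)) t" if "m \<in> {1..n}" for m
  proof -
    have e: "4 * of_nat c + 1 + of_int (4 * int m - 3) = (of_int (4 * int (c + m) - 2) :: rat)" by simp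
    have "(of_int (4 * int (c + m) - 2) :: rat) \<noteq> 0" by (subst of_int_eq_0_iff) presburger
    then show ?thesis unfolding arg e by (rule shift_fps_scale)
  qed
  have A3: "shift_fps (4 * of_nat (2 ^ r * t + c) + 1 + of_nat (2 * n)) oo ?s =
      fps_const (of_nat (4 * c + 1 + 2 * n)) * lin_fps (2 ^ (r + 2) / of_nat (4 * c + 1 + 2 * n)) t"
  proof -
    have e: "4 * of_nat c + 1 + of_nat (2 * n) = (of_nat (4 * c + 1 + 2 * n) :: rat)" by simp
    show ?thesis unfolding arg e by (rule shift_fps_scale, subst of_nat_eq_0_iff) simp
  qed
  have A4: "shift_fps (4 * of_nat (2 ^ r * t + c) + 1 + of_nat (4 * k)) oo ?s =
      fps_const (of_nat (4 * c + 1 + 4 * k)) * lin_fps (2 ^ (r + 2) / of_nat (4 * c + 1 + 4 * k)) t" for k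
  proof -
    have e: "4 * of_nat c + 1 + of_nat (4 * k) = (of_nat (4 * c + 1 + 4 * k) :: rat)" by simp
    show ?thesis unfolding arg e by (rule shift_fps_scale, subst of_nat_eq_0_iff) simp
  qed
  have N: "num_fps n b \<epsilon> (4 * of_nat (2 ^ r * t + c) + 1) oo ?s =
     (\<Prod>m=1..n. (fps_const (of_nat (4 * (c + m))) * lin_fps (2 ^ r / of_nat (c + m)) t) *
        (fps_const (of_int (4 * int (c + m) - 2)) * lin_fps (2 ^ (r + 2) / of_int (4 * int (c + m) - 2)) t)) ^ b *
      (fps_const (of_nat (4 * c + 1 + 2 * n)) * lin_fps (2 ^ (r + 2) / of_nat (4 * c + 1 + 2 * n)) t) ^ \<epsilon>"
    unfolding num_fps_def fps_compose_mult_distrib[OF s0] fps_compose_power[OF s0, symmetric] fps_compose_prod_distrib[OF s0] A3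
    by (intro arg_cong2[where f = "(*)"] arg_cong2[where f = "(^)"] prod.cong refl A1 A2)
  have nz: "fps_nth (den_fps n b (4 * of_nat (2 ^ r * t + c) + 1)) 0 \<noteq> 0"
  proof -
    have "4 * of_nat (2 ^ r * t + c) + 1 + of_nat (4 * k) \<noteq> (0 :: rat)" for k
    proof -
      have "4 * of_nat (2 ^ r * t + c) + 1 + of_nat (4 * k) = (of_nat (4 * (2 ^ r * t + c) + 1 + 4 * k) :: rat)" by simp
      then show ?thesis by (simp only: of_nat_eq_0_iff)
    qed
    then show ?thesis by (simp add: den_fps_def shift_fps_def fps_power_zeroth fps_prod_nth_0)
  qed
  have D: "inverse (den_fps n b (4 * of_nat (2 ^ r * t + c) + 1)) oo ?s =
      inverse ((\<Prod>k=0..n. fps_const (of_nat (4 * c + 1 + 4 * k)) * lin_fps (2 ^ (r + 2) / of_nat (4 * c + 1 + 4 * k)) t) ^ (2 * b))"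
    unfolding fps_inverse_compose[OF s0 nz]
    unfolding den_fps_def fps_compose_power[OF s0, symmetric] fps_compose_prod_distrib[OF s0] A4 ..
  have inv_prod: "inverse (\<Prod>k\<in>A. f k) = (\<Prod>k\<in>A. inverse (f k))" for f :: "nat \<Rightarrow> rat fps" and A
    by (induction A rule: infinite_finite_induct) (simp_all add: fps_inverse_mult)
  have inv_power: "inverse (f ^ m) = inverse f ^ m" for f :: "rat fps" and m
    by (induction m) (simp_all add: fps_inverse_mult)
  have const_prod: "fps_const (\<Prod>k\<in>A. f k) = (\<Prod>k\<in>A. fps_const (f k))" for f :: "nat \<Rightarrow> rat" and A
    by (induction A rule: infinite_finite_induct) (simp_all flip: fps_const_mult)
  have const: "fps_const (const_part c) = (\<Prod>m=1..n. fps_const (of_nat (4 * (c + m)))) ^ b *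
      (\<Prod>m=1..n. fps_const (of_int (4 * int (c + m) - 2))) ^ b * fps_const (of_nat (4 * c + 1 + 2 * n)) ^ \<epsilon> *
      (\<Prod>k=0..n. inverse (fps_const (of_nat (4 * c + 1 + 4 * k)))) ^ (2 * b)"
    unfolding const_part_def fps_const_mult[symmetric] fps_const_power[symmetric] fps_const_inverse[symmetric]
      const_prod prod.distrib power_mult_distrib inv_prod ..
  show ?thesis
    unfolding quot_fps_def fps_compose_mult_distrib[OF s0] N D inv_power inv_prod fps_inverse_mult prod.distrib
      power_mult_distrib const unit_part_def
    by (simp only: mult.assoc mult.commute mult.left_commute)
qed

lemma rat_abs2_unit_coeff:
  assumes "rat_abs2 x = 1"
  shows "rat_abs2 (2 ^ (r + 2) / x) \<le> (1 / 2)\<^sup>2"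
proof -
  have "(1 / 2 :: real) ^ (r + 2) \<le> (1 / 2)\<^sup>2" by (intro power_decreasing) auto
  then show ?thesis using assms by (simp only: rat_abs2_divide rat_abs2_power rat_abs2_2 div_by_1)
qed

lemma rat_abs2_half_unit_coeff: "rat_abs2 (2 ^ (r + 2) / of_int (4 * int x - 2)) \<le> (1 / 2)\<^sup>2"
proof -
  have "(of_int (4 * int x - 2) :: rat) = 2 * of_int (2 * int x - 1)" by simp
  moreover have "rat_abs2 (of_int (2 * int x - 1)) = 1" by (rule rat_abs2_odd) simp
  ultimately have "rat_abs2 (of_int (4 * int x - 2)) = 1 / 2" by (simp only: rat_abs2_mult rat_abs2_2)
  moreover have "(1 / 2 :: real) ^ (r + 1) \<le> (1 / 2)\<^sup>2" using r by (intro power_decreasing) auto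
  moreover have "(1 / 2 :: real) ^ (r + 2) / (1 / 2) = (1 / 2) ^ (r + 1)" by simp
  ultimately show ?thesis by (simp only: rat_abs2_divide rat_abs2_power rat_abs2_2)
qed

lemma unit_part_lim: "unit_part c \<in> fps_lim 2"
  unfolding unit_part_def[abs_def]
  by (intro fps_lim_mult fps_lim_power fps_lim_prod fps_lim_lin_fps fps_lim_inverse_lin_fps
      rat_abs2_half_unit_coeff rat_abs2_unit_coeff rat_abs2_odd_nat) auto

lemma lin_fps_0_0 [simp]: "fps_nth (lin_fps z 0) 0 = 1"
  by (simp add: lin_fps_nth)

lemma unit_part_0: "fps_nth (unit_part c 0) 0 = 1"
  by (simp add: unit_part_def fps_power_zeroth fps_prod_nth_0)

lemma rat_abs2_const_part:
  "rat_abs2 (const_part c) = ((1 / 8) ^ n * rat_abs2 (fact n) * rat_abs2 (of_nat ((c + n) choose c))) ^ b"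
proof -
  have 1: "rat_abs2 (of_nat (4 * (c + m)) * of_int (4 * int (c + m) - 2)) = 1 / 8 * rat_abs2 (of_nat (c + m))" for m
  proof -
    have "(of_nat (4 * (c + m)) * of_int (4 * int (c + m) - 2) :: rat) = 8 * of_nat (c + m) * of_int (2 * int (c + m) - 1)"
      by (simp add: algebra_simps)
    moreover have "rat_abs2 (of_int (2 * int (c + m) - 1)) = 1" by (rule rat_abs2_odd) simp
    moreover have "rat_abs2 8 = 1 / 8" using rat_abs2_mult[of 2 4] by simp
    ultimately show ?thesis by (simp only: rat_abs2_mult mult_1_right)
  qed
  have 2: "rat_abs2 (of_nat (4 * c + 1 + 2 * n)) = 1" "rat_abs2 (of_nat (4 * c + 1 + 4 * k)) = 1" for k
    by (rule rat_abs2_odd_nat, simp)+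
  have "rat_abs2 (const_part c) = (\<Prod>m=1..n. 1 / 8 * rat_abs2 (of_nat (c + m))) ^ b"
    unfolding const_part_def rat_abs2_mult rat_abs2_power rat_abs2_prod rat_abs2_inverse 2
    by (simp only: rat_abs2_mult[symmetric] 1) simp
  also have "(\<Prod>m=1..n. 1 / 8 * rat_abs2 (of_nat (c + m))) = (1 / 8) ^ n * rat_abs2 (\<Prod>m=1..n. of_nat (c + m))"
    unfolding prod.distrib rat_abs2_prod by simp
  also have "(\<Prod>m=1..n. of_nat (c + m)) = (of_nat (fact n * ((c + n) choose c)) :: rat)"
    unfolding prod_shift_eq_fact[symmetric] of_nat_prod ..
  finally show ?thesis by (simp add: rat_abs2_mult mult.assoc)
qed

text \<open>The division by the power of 2^(r+2) is the chain rule for a Hasse derivative of order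
  b-2.\<close>

lemma integrand_scale:
  "integrand n b \<epsilon> (2 ^ r * t + c) =
    const_part c * fps_nth ((\<Prod>m=1..n. lin_fps (2 ^ r / of_nat (c + m)) t) ^ b * unit_part c t) (b - 2) / (2 ^ (r + 2)) ^ (b - 2)"
proof -
  have "(2 ^ (r + 2)) ^ (b - 2) * integrand n b \<epsilon> (2 ^ r * t + c) =
      fps_nth (quot_fps n b \<epsilon> (4 * of_nat (2 ^ r * t + c) + 1) oo (fps_const (2 ^ (r + 2)) * fps_X)) (b - 2)"
    unfolding integrand_def fps_compose_linear by simp
  also have "\<dots> = const_part c * fps_nth ((\<Prod>m=1..n. lin_fps (2 ^ r / of_nat (c + m)) t) ^ b * unit_part c t) (b - 2)"
    unfolding quot_fps_scale by simp
  finally show ?thesis by (simp add: field_simps)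
qed

text \<open>Among 1, ..., 2^r - 1 only 2^(r-1) is divisible by 2^(r-1). Its slope is 2, which is the
  case of \<open>volk_sum_main_term\<close>; all other slopes are divisible by 4.\<close>

lemma integrand_class_0:
  "rat_abs2 (volk_sum N (\<lambda>t. fps_nth ((\<Prod>m=1..n. lin_fps (2 ^ r / of_nat (0 + m)) t) ^ b * unit_part 0 t) (b - 2))) =
    (1 / 2) ^ (b - 2) * rat_abs2 (of_nat (b choose 2))"
proof -
  define m0 :: nat where "m0 = 2 ^ (r - 1)"
  have r2: "2 ^ r = 2 * m0" using r by (cases r) (auto simp: m0_def)
  have m0: "m0 \<in> {1..n}" using r2 by (auto simp: n m0_def)
  define h where "h t = (\<Prod>m\<in>{1..n} - {m0}. lin_fps (2 ^ r / of_nat m) t) ^ b * unit_part 0 t" for t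
  have eq: "(\<Prod>m=1..n. lin_fps (2 ^ r / of_nat (0 + m)) t) ^ b * unit_part 0 t = lin_fps 2 t ^ b * h t" for t
  proof -
    have "2 ^ r / of_nat (0 + m0) = (2 :: rat)"
    proof -
      have "(2 :: rat) ^ r = of_nat (2 ^ r)" by simp
      also have "\<dots> = 2 * of_nat m0" unfolding r2 by simp
      finally show ?thesis by (simp add: m0_def)
    qed
    then show ?thesis unfolding prod.remove[OF finite_atLeastAtMost m0] h_def power_mult_distrib
      by (simp add: mult.assoc)
  qed
  have "h \<in> fps_lim 2"
    unfolding h_def[abs_def]
  proof (intro fps_lim_mult fps_lim_power fps_lim_prod fps_lim_lin_fps unit_part_lim)
    fix m assume m: "m \<in> {1..n} - {m0}"
    have "2 * (1 / 2) ^ (r - 1) \<le> rat_abs2 (of_nat m)"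
      using m r r2 by (intro rat_abs2_nat_bounds_double) (auto simp: n m0_def)
    moreover have "2 * (1 / 2) ^ (r - 1) = 4 * (1 / 2 :: real) ^ r" using r by (cases r) auto
    ultimately have "4 * (1 / 2) ^ r \<le> rat_abs2 (of_nat m)" by simp
    moreover have "rat_abs2 (of_nat m) > 0" using m by (intro rat_abs2_pos) simp
    ultimately have "(1 / 2) ^ r / rat_abs2 (of_nat m) \<le> 1 / 4" by (simp add: pos_divide_le_eq)
    then show "rat_abs2 (2 ^ r / of_nat m) \<le> (1 / 2)\<^sup>2"
      by (simp only: rat_abs2_divide rat_abs2_power rat_abs2_2) (simp add: power2_eq_square)
  qed
  moreover have "rat_abs2 (fps_nth (h 0) 0) = 1"
    by (simp add: h_def fps_power_zeroth fps_prod_nth_0 unit_part_0)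
  ultimately show ?thesis unfolding eq by (rule volk_sum_main_term[OF b])
qed

text \<open>Exactly one of c+1, ..., c+n equals 2^r and has slope 1. The others lie below 2^(r+1)
  and are not divisible by 2^r, so their slopes are even.\<close>

lemma integrand_class_pos:
  assumes c: "0 < c" "c < 2 ^ r"
  shows "rat_abs2 (volk_sum N (\<lambda>t. fps_nth ((\<Prod>m=1..n. lin_fps (2 ^ r / of_nat (c + m)) t) ^ b * unit_part c t) (b - 2))) \<le>
    2 * rat_abs2 (of_nat (b choose 2))"
proof -
  define m0 :: nat where "m0 = 2 ^ r - c"
  have m0: "m0 \<in> {1..n}" using c by (auto simp: n m0_def)
  define h where "h t = (\<Prod>m\<in>{1..n} - {m0}. lin_fps (2 ^ r / of_nat (c + m)) t) ^ b * unit_part c t" for t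
  have eq: "(\<Prod>m=1..n. lin_fps (2 ^ r / of_nat (c + m)) t) ^ b * unit_part c t = lin_fps 1 t ^ b * h t" for t
  proof -
    have "c + m0 = 2 ^ r" using c by (simp add: m0_def)
    then have "2 ^ r / of_nat (c + m0) = (1 :: rat)" by simp
    then show ?thesis unfolding prod.remove[OF finite_atLeastAtMost m0] h_def power_mult_distrib
      by (simp add: mult.assoc)
  qed
  have unit: "unit_part c \<in> fps_lim 1" by (rule fps_lim_mono[OF _ unit_part_lim]) simp
  have "h \<in> fps_lim 1"
    unfolding h_def[abs_def]
  proof (intro fps_lim_mult fps_lim_power fps_lim_prod fps_lim_lin_fps unit)
    fix m assume m: "m \<in> {1..n} - {m0}"
    have le: "2 * (1 / 2) ^ r \<le> rat_abs2 (of_nat (c + m))"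
      using m c by (intro rat_abs2_nat_bounds_double) (auto simp: n m0_def)
    moreover have "rat_abs2 (of_nat (c + m)) > 0" using c by (intro rat_abs2_pos) (simp del: of_nat_add)
    ultimately have "(1 / 2) ^ r / rat_abs2 (of_nat (c + m)) \<le> 1 / 2" by (simp add: pos_divide_le_eq del: of_nat_add)
    then show "rat_abs2 (2 ^ r / of_nat (c + m)) \<le> (1 / 2) ^ 1"
      by (simp only: rat_abs2_divide rat_abs2_power rat_abs2_2) simp
  qed
  then show ?thesis unfolding eq by (rule volk_sum_side_term[OF b])
qed

lemma volk_sum_split:
  assumes "r \<le> N"
  shows "volk_sum N F = (\<Sum>c<2 ^ r. volk_sum (N - r) (\<lambda>t. F (2 ^ r * t + c))) / 2 ^ r"
proof -
  have N: "(2 :: nat) ^ N = 2 ^ (N - r) * 2 ^ r" using assms by (simp flip: power_add)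
  have "(\<Sum>t<2 ^ N. F t) = (\<Sum>t<2 ^ (N - r). \<Sum>i\<in>{t * 2 ^ r..<t * 2 ^ r + 2 ^ r}. F i)"
    unfolding N by (rule sum.nat_group[symmetric])
  also have "\<dots> = (\<Sum>t<2 ^ (N - r). \<Sum>c<2 ^ r. F (2 ^ r * t + c))"
  proof (rule sum.cong[OF refl])
    fix t
    show "(\<Sum>i\<in>{t * 2 ^ r..<t * 2 ^ r + 2 ^ r}. F i) = (\<Sum>c<2 ^ r. F (2 ^ r * t + c))"
      by (rule sum.reindex_bij_witness[of _ "\<lambda>c. 2 ^ r * t + c" "\<lambda>i. i - 2 ^ r * t"]) (auto simp: mult.commute)
  qed
  also have "\<dots> = (\<Sum>c<2 ^ r. \<Sum>t<2 ^ (N - r). F (2 ^ r * t + c))" by (rule sum.swap)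
  finally have "(\<Sum>t<2 ^ N. F t) = (\<Sum>c<2 ^ r. \<Sum>t<2 ^ (N - r). F (2 ^ r * t + c))" .
  moreover have "(2 :: rat) ^ N = 2 ^ (N - r) * 2 ^ r" using assms by (simp flip: power_add)
  ultimately show ?thesis by (simp add: volk_sum_def sum_divide_distrib)
qed

text \<open>The value is positive and the same for all large \<open>N\<close>, so it passes to the
  limit, which is therefore nonzero.\<close>

theorem rat_abs2_volk_sum_integrand:
  assumes N: "r \<le> N"
  shows "rat_abs2 (volk_sum N (integrand n b \<epsilon>)) =
    ((1 / 8) ^ n * rat_abs2 (fact n)) ^ b * (1 / 2) ^ (b - 2) * rat_abs2 (of_nat (b choose 2)) * (2 ^ (r + 2)) ^ (b - 2) * 2 ^ r"
proof -
  define G where "G c = volk_sum (N - r) (\<lambda>t. fps_nth ((\<Prod>m=1..n. lin_fps (2 ^ r / of_nat (c + m)) t) ^ b * unit_part c t) (b - 2))" for c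
  define A where "A = ((1 / 8) ^ n * rat_abs2 (fact n)) ^ b"
  define C where "C = rat_abs2 (of_nat (b choose 2))"
  have A: "A > 0" by (simp add: A_def rat_abs2_pos)
  have C: "C > 0" using b by (simp add: C_def rat_abs2_pos)
  have eq: "volk_sum N (integrand n b \<epsilon>) = (\<Sum>c<2 ^ r. const_part c * G c) / ((2 ^ (r + 2)) ^ (b - 2) * 2 ^ r)"
  proof -
    have "volk_sum (N - r) (\<lambda>t. integrand n b \<epsilon> (2 ^ r * t + c)) = const_part c * G c / (2 ^ (r + 2)) ^ (b - 2)" for c
      unfolding integrand_scale G_def volk_sum_def by (simp add: sum_distrib_left sum_divide_distrib ac_simps)
    then show ?thesis unfolding volk_sum_split[OF N] by (simp add: sum_divide_distrib)
  qed
  have zero: "rat_abs2 (const_part 0 * G 0) = A * ((1 / 2) ^ (b - 2) * C)"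
    unfolding rat_abs2_mult rat_abs2_const_part G_def integrand_class_0 by (simp add: A_def C_def)
  \<comment> \<open>The even binomial coefficient contributes 2^(-b) and the weaker bound on the
    integral loses a factor 2; against the 2^(-(b-2)) of class 0 a net factor 1/2 remains.\<close>
  have pos: "rat_abs2 (const_part c * G c) \<le> A * ((1 / 2) ^ (b - 1) * C)" if c: "c \<in> {1..<2 ^ r}" for c
  proof -
    have "rat_abs2 (of_nat ((c + n) choose c)) \<le> 1 / 2"
      using c unfolding n by (intro rat_abs2_dyadic_binomial) auto
    then have "rat_abs2 (of_nat ((c + n) choose c)) ^ b \<le> (1 / 2) ^ b" by (intro power_mono) auto
    then have "rat_abs2 (const_part c) \<le> A * (1 / 2) ^ b"
      unfolding rat_abs2_const_part A_def power_mult_distrib[of _ "rat_abs2 (of_nat ((c + n) choose c))"]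
      by (intro mult_left_mono) auto
    moreover have "rat_abs2 (G c) \<le> 2 * C" unfolding G_def C_def using c by (intro integrand_class_pos) auto
    ultimately have "rat_abs2 (const_part c) * rat_abs2 (G c) \<le> (A * (1 / 2) ^ b) * (2 * C)"
      using A by (intro mult_mono) auto
    moreover have half: "(1 / 2 :: real) ^ (b - 1) = (1 / 2) ^ b * 2" using b by (cases b) auto
    moreover have "(A * (1 / 2) ^ b) * (2 * C) = A * ((1 / 2) ^ (b - 1) * C)"
      by (simp only: half mult.assoc mult.commute mult.left_commute)
    ultimately show ?thesis by (simp only: rat_abs2_mult)
  qed
  have "rat_abs2 (\<Sum>c=1..<2 ^ r. const_part c * G c) \<le> A * ((1 / 2) ^ (b - 1) * C)"
    using A C by (intro rat_abs2_sum_le pos) auto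
  also have "\<dots> < rat_abs2 (const_part 0 * G 0)"
    unfolding zero using A C b by (intro mult_strict_left_mono mult_strict_right_mono power_strict_decreasing) auto
  finally have "rat_abs2 (const_part 0 * G 0 + (\<Sum>c=1..<2 ^ r. const_part c * G c)) = rat_abs2 (const_part 0 * G 0)"
    by (rule rat_abs2_add_eq)
  moreover have "(\<Sum>c<2 ^ r. const_part c * G c) = const_part 0 * G 0 + (\<Sum>c=1..<2 ^ r. const_part c * G c)"
    by (simp add: lessThan_atLeast0 sum.atLeast_Suc_lessThan)
  ultimately have "rat_abs2 (\<Sum>c<2 ^ r. const_part c * G c) = A * ((1 / 2) ^ (b - 2) * C)"
    using zero by simp
  then show ?thesis
    unfolding eq by (simp add: rat_abs2_divide rat_abs2_mult rat_abs2_power A_def C_def power_one_over)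
qed

end

section \<open>Partial fractions\<close>

definition taylor :: "rat \<Rightarrow> rat poly \<Rightarrow> rat fps" where
  "taylor z p = fps_of_poly (pcompose p [:z, 1:])"

lemma taylor_mult: "taylor z (p * q) = taylor z p * taylor z q"
  by (simp add: taylor_def pcompose_mult fps_of_poly_mult)

lemma taylor_1 [simp]: "taylor z 1 = 1"
  by (simp add: taylor_def pcompose_1)

lemma taylor_diff: "taylor z (p - q) = taylor z p - taylor z q"
  by (simp add: taylor_def pcompose_diff fps_of_poly_diff)

lemma taylor_sum: "taylor z (\<Sum>i\<in>A. f i) = (\<Sum>i\<in>A. taylor z (f i))"
  by (simp add: taylor_def pcompose_sum fps_of_poly_sum)

lemma taylor_smult: "taylor z (smult c p) = fps_const c * taylor z p"
  by (simp add: taylor_def pcompose_smult fps_of_poly_smult)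

lemma taylor_prod: "taylor z (\<Prod>i\<in>A. f i) = (\<Prod>i\<in>A. taylor z (f i))"
  by (induction A rule: infinite_finite_induct) (simp_all add: taylor_mult)

lemma taylor_power: "taylor z (p ^ n) = taylor z p ^ n"
  by (induction n) (simp_all add: taylor_mult)

lemma taylor_linear: "taylor z [:a, 1:] = shift_fps (z + a)"
  by (simp add: taylor_def shift_fps_def pcompose_pCons fps_of_poly_pCons add.commute)

lemma linear_power_dvd:
  assumes "\<And>i. i < M \<Longrightarrow> fps_nth (taylor (- a) p) i = 0"
  shows "[:a, 1:] ^ M dvd p"
proof -
  define q where "q = pcompose p [:- a, 1:]"
  have "monom 1 M dvd q"
    using assms by (simp add: monom_1_dvd_iff' q_def taylor_def)
  then obtain w where w: "q = monom 1 M * w" by (rule dvdE)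
  have lin: "pcompose [:- a, 1:] [:a, 1:] = [:0, 1:]" by (simp add: pcompose_pCons)
  have "pcompose q [:a, 1:] = p"
    unfolding q_def pcompose_assoc[symmetric] lin by (simp add: pcompose_idR)
  moreover have "pcompose (monom 1 M) [:a, 1:] = [:a, 1:] ^ M"
  proof -
    have "pcompose (monom 1 M) [:a, 1:] = pcompose ([:0, 1:] ^ M) [:a, 1:]" by (simp add: monom_altdef)
    also have "\<dots> = (pcompose [:0, 1:] [:a, 1:]) ^ M"
      by (induction M) (simp_all only: power_Suc power_0 pcompose_mult pcompose_1)
    finally show ?thesis by (simp add: pcompose_pCons)
  qed
  ultimately have "p = [:a, 1:] ^ M * pcompose w [:a, 1:]" using w by (simp add: pcompose_mult)
  then show ?thesis by (rule dvdI)
qed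

lemma shift_fps_0 [simp]: "shift_fps 0 = fps_X"
  by (simp add: shift_fps_def)

lemma shift_fps_nth_0 [simp]: "fps_nth (shift_fps a) 0 = a"
  by (simp add: shift_fps_def)

text \<open>The coefficient of (u + a k)^(-i) in the partial fraction expansion of P over the
  product of all (u + a j)^M, read off from the Taylor expansion at the pole.\<close>

definition pf_coeff :: "rat poly \<Rightarrow> 'k set \<Rightarrow> ('k \<Rightarrow> rat) \<Rightarrow> nat \<Rightarrow> 'k \<Rightarrow> nat \<Rightarrow> rat" where
  "pf_coeff P K a M k i = fps_nth (taylor (- a k) P * inverse (\<Prod>j\<in>K - {k}. shift_fps (a j - a k) ^ M)) (M - i)"

text \<open>The common denominator divided by (u + a k)^i, so that partial fractions become an
  identity of polynomials.\<close>

definition pf_cofactor :: "'k set \<Rightarrow> ('k \<Rightarrow> rat) \<Rightarrow> nat \<Rightarrow> 'k \<Rightarrow> nat \<Rightarrow> rat poly" where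
  "pf_cofactor K a M k i = [:a k, 1:] ^ (M - i) * (\<Prod>j\<in>K - {k}. [:a j, 1:] ^ M)"

lemma degree_linear_power: "degree ([:a, 1:] ^ n :: rat poly) = n"
  by (simp add: degree_power_eq)

lemma monic_linear_power: "lead_coeff ([:a, 1:] ^ n :: rat poly) = 1"
  by (simp add: lead_coeff_power)

lemma pf_cofactor_degree:
  assumes "finite K" "k \<in> K" "i \<le> M"
  shows "degree (pf_cofactor K a M k i) = M * card K - i" "lead_coeff (pf_cofactor K a M k i) = 1"
proof -
  have nz: "(\<Prod>j\<in>K - {k}. [:a j, 1:] ^ M) \<noteq> (0 :: rat poly)" using assms(1) by simp
  have "degree (\<Prod>j\<in>K - {k}. [:a j, 1:] ^ M :: rat poly) = (\<Sum>j\<in>K - {k}. M)"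
    by (subst degree_prod_eq_sum_degree) (auto simp: degree_linear_power)
  then have "degree (pf_cofactor K a M k i) = (M - i) + M * (card K - 1)"
    unfolding pf_cofactor_def using nz assms
    by (subst degree_mult_eq) (auto simp: degree_linear_power mult.commute)
  moreover have "card K \<ge> 1" using assms by (metis One_nat_def Suc_leI card_gt_0_iff empty_iff)
  then have "(M - i) + M * (card K - 1) = M * card K - i" using assms(3)
    by (cases "card K") (auto simp: algebra_simps)
  ultimately show "degree (pf_cofactor K a M k i) = M * card K - i" by simp
  show "lead_coeff (pf_cofactor K a M k i) = 1"
    unfolding pf_cofactor_def by (simp add: lead_coeff_mult monic_linear_power lead_coeff_prod)
qed

lemma fps_X_power_dvd_iff: "fps_X ^ M dvd f \<longleftrightarrow> (\<forall>l<M. fps_nth f l = 0)" for f :: "rat fps"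
proof
  assume "\<forall>l<M. fps_nth f l = 0"
  then have "f = fps_X ^ M * fps_shift M f"
    by (intro fps_ext) (simp add: fps_X_power_mult_nth)
  then show "fps_X ^ M dvd f" by (rule dvdI)
qed (auto simp: fps_X_power_mult_nth elim!: dvdE)

text \<open>Both sides have degree less than the degree of the common denominator, and they agree to order
  \<open>M\<close> at each pole.\<close>

lemma partial_fractions_poly:
  fixes a :: "'k \<Rightarrow> rat"
  assumes K: "finite K" "inj_on a K" and deg: "degree P < M * card K"
  shows "P = (\<Sum>k\<in>K. \<Sum>i=1..M. smult (pf_coeff P K a M k i) (pf_cofactor K a M k i))"
proof -
  define D where "D = P - (\<Sum>k\<in>K. \<Sum>i=1..M. smult (pf_coeff P K a M k i) (pf_cofactor K a M k i))"
  have dvd: "[:a k, 1:] ^ M dvd D" if k: "k \<in> K" for k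
  proof (rule linear_power_dvd)
    fix e assume e: "e < M"
    define V where "V = (\<Prod>j\<in>K - {k}. shift_fps (a j - a k) ^ M)"
    have V0: "fps_nth V 0 \<noteq> 0"
      using K k by (auto simp: V_def fps_prod_nth_0 fps_power_zeroth dest: inj_onD)
    define g where "g = taylor (- a k) P * inverse V"
    have gc: "pf_coeff P K a M k i = fps_nth g (M - i)" for i by (simp add: pf_coeff_def g_def V_def)
    have tP: "taylor (- a k) P = g * V" using V0 by (simp add: g_def mult.assoc inverse_mult_eq_1)
    have T: "taylor (- a k) (pf_cofactor K a M k i) = fps_X ^ (M - i) * V" for i
      by (simp add: pf_cofactor_def taylor_mult taylor_power taylor_prod taylor_linear V_def)
    have T': "fps_X ^ M dvd taylor (- a k) (pf_cofactor K a M k' i)" if "k' \<in> K" "k' \<noteq> k" for k' i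
    proof -
      have "[:a k, 1:] ^ M dvd (\<Prod>j\<in>K - {k'}. [:a j, 1:] ^ M)"
        using K k that by (intro dvd_prodI) auto
      then obtain w where "pf_cofactor K a M k' i = [:a k, 1:] ^ M * w"
        unfolding pf_cofactor_def by (metis dvd_def dvd_mult)
      then have "taylor (- a k) (pf_cofactor K a M k' i) = fps_X ^ M * taylor (- a k) w"
        by (simp add: taylor_mult taylor_power taylor_linear)
      then show ?thesis by simp
    qed
    have "taylor (- a k) D = g * V - (\<Sum>k'\<in>K. \<Sum>i=1..M. fps_const (pf_coeff P K a M k' i) * taylor (- a k) (pf_cofactor K a M k' i))"
      by (simp add: D_def taylor_diff taylor_sum taylor_smult tP)
    also have "(\<Sum>k'\<in>K. \<Sum>i=1..M. fps_const (pf_coeff P K a M k' i) * taylor (- a k) (pf_cofactor K a M k' i)) =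
        (\<Sum>i=1..M. fps_const (fps_nth g (M - i)) * (fps_X ^ (M - i) * V)) +
        (\<Sum>k'\<in>K - {k}. \<Sum>i=1..M. fps_const (pf_coeff P K a M k' i) * taylor (- a k) (pf_cofactor K a M k' i))"
      using K k by (subst sum.remove[of K k]) (simp_all add: T gc)
    also have "(\<Sum>i=1..M. fps_const (fps_nth g (M - i)) * (fps_X ^ (M - i) * V)) =
        (\<Sum>i<M. fps_const (fps_nth g i) * fps_X ^ i) * V"
      unfolding sum_distrib_right
      by (rule sum.reindex_bij_witness[of _ "\<lambda>i. M - i" "\<lambda>i. M - i"]) (auto simp: mult.assoc)
    finally have eq: "taylor (- a k) D = (g - (\<Sum>i<M. fps_const (fps_nth g i) * fps_X ^ i)) * V -
        (\<Sum>k'\<in>K - {k}. \<Sum>i=1..M. fps_const (pf_coeff P K a M k' i) * taylor (- a k) (pf_cofactor K a M k' i))"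
      by (simp add: algebra_simps)
    have G: "fps_X ^ M dvd (g - (\<Sum>i<M. fps_const (fps_nth g i) * fps_X ^ i))"
    proof -
      have "fps_nth (g - (\<Sum>i<M. fps_const (fps_nth g i) * fps_X ^ i)) l = 0" if "l < M" for l
        using that by (simp add: fps_sum_nth fps_X_power_nth if_distrib[where f = "(*) _"] cong: if_cong)
      then show ?thesis by (metis fps_X_power_dvd_iff)
    qed
    have "fps_X ^ M dvd taylor (- a k) D"
      unfolding eq by (intro dvd_diff dvd_mult2[OF G] dvd_sum dvd_mult T') auto
    then show "fps_nth (taylor (- a k) D) e = 0" using e by (simp add: fps_X_power_dvd_iff)
  qed
  have "(\<Prod>k\<in>K'. [:a k, 1:] ^ M) dvd D" if "finite K'" "K' \<subseteq> K" for K'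
    using that
  proof (induction K' rule: finite_induct)
    case (insert k K')
    have "coprime ([:a k, 1:] ^ M) ((\<Prod>k\<in>K'. [:a k, 1:] ^ M) :: rat poly)"
    proof (intro prod_coprime_right)
      fix j assume "j \<in> K'"
      then have "a j \<noteq> a k" using insert K(2) by (auto dest: inj_onD)
      have "coprime [:a k, 1:] [:a j, 1:]"
      proof (rule coprimeI)
        fix c assume "c dvd [:a k, 1:]" "c dvd [:a j, 1:]"
        then have "c dvd [:a k, 1:] - [:a j, 1:]" by (rule dvd_diff)
        then have c: "c dvd [:a k - a j:]" by simp
        have "is_unit [:a k - a j:]" using \<open>a j \<noteq> a k\<close> by (simp add: is_unit_const_poly_iff dvd_field_iff)
        then show "is_unit c" using c by (rule dvd_unit_imp_unit[rotated])
      qed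
      then show "coprime ([:a k, 1:] ^ M) ([:a j, 1:] ^ M)" by simp
    qed
    moreover have "(\<Prod>k\<in>K'. [:a k, 1:] ^ M) dvd D" using insert by auto
    moreover have "[:a k, 1:] ^ M dvd D" using insert dvd by auto
    ultimately show ?case using insert by (simp add: divides_mult)
  qed simp
  then have "(\<Prod>k\<in>K. [:a k, 1:] ^ M) dvd D" using K(1) by simp
  moreover have "degree D < degree (\<Prod>k\<in>K. [:a k, 1:] ^ M)"
  proof -
    have pos: "0 < M * card K" using deg by linarith
    have d: "degree (\<Prod>k\<in>K. [:a k, 1:] ^ M) = M * card K"
      by (subst degree_prod_eq_sum_degree) (auto simp: degree_linear_power)
    have inner: "degree (\<Sum>i=1..M. smult (pf_coeff P K a M k i) (pf_cofactor K a M k i)) < M * card K" if "k \<in> K" for k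
    proof (rule degree_sum_less)
      fix i assume i: "i \<in> {1..M}"
      have "degree (smult (pf_coeff P K a M k i) (pf_cofactor K a M k i)) \<le> M * card K - i"
        using pf_cofactor_degree(1)[of K k i M a] K that i by (metis atLeastAtMost_iff degree_smult_le)
      also have "\<dots> < M * card K" using i deg by auto
      finally show "degree (smult (pf_coeff P K a M k i) (pf_cofactor K a M k i)) < M * card K" .
    qed (rule pos)
    have "degree (\<Sum>k\<in>K. \<Sum>i=1..M. smult (pf_coeff P K a M k i) (pf_cofactor K a M k i)) < M * card K"
      by (rule degree_sum_less[OF inner pos])
    then show ?thesis unfolding d D_def using deg by (intro degree_diff_less)
  qed
  ultimately have "D = 0" by (metis dvd_imp_degree_le linorder_not_less)
  then show ?thesis by (simp add: D_def)
qed

lemma inverse_prod_fps: "inverse (\<Prod>k\<in>A. f k) = (\<Prod>k\<in>A. inverse (f k))" for f :: "'b \<Rightarrow> rat fps"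
  by (induction A rule: infinite_finite_induct) (simp_all add: fps_inverse_mult)

text \<open>Dividing the polynomial identity by the common denominator, as power series at a point
  \<open>u\<close> off the poles, gives the expansion of all Hasse derivatives at once.\<close>

lemma partial_fractions_fps:
  fixes a :: "'k \<Rightarrow> rat"
  assumes K: "finite K" "inj_on a K" and deg: "degree P < M * card K"
    and u: "\<And>k. k \<in> K \<Longrightarrow> u + a k \<noteq> 0"
  shows "taylor u P * inverse (\<Prod>k\<in>K. shift_fps (u + a k) ^ M) =
    (\<Sum>k\<in>K. \<Sum>i=1..M. fps_const (pf_coeff P K a M k i) * inverse (shift_fps (u + a k)) ^ i)"
proof -
  define L where "L k = shift_fps (u + a k)" for k
  have L: "L k * inverse (L k) = 1" if "k \<in> K" for k
    using u[OF that] inverse_mult_eq_1'[of "L k"] by (simp add: L_def)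
  have LM: "L k ^ m * inverse (L k) ^ m = 1" if "k \<in> K" for k m
    using L[OF that] by (simp flip: power_mult_distrib)
  have "taylor u P * inverse (\<Prod>k\<in>K. L k ^ M) =
      (\<Sum>k\<in>K. \<Sum>i=1..M. fps_const (pf_coeff P K a M k i) * (taylor u (pf_cofactor K a M k i) * inverse (\<Prod>k\<in>K. L k ^ M)))"
    by (subst partial_fractions_poly[OF K deg])
      (simp add: taylor_sum taylor_smult sum_distrib_right mult.assoc)
  also have "\<dots> = (\<Sum>k\<in>K. \<Sum>i=1..M. fps_const (pf_coeff P K a M k i) * inverse (L k) ^ i)"
  proof (intro sum.cong refl arg_cong[where f = "(*) _"])
    fix k i assume k: "k \<in> K" and i: "i \<in> {1..M}"
    have "taylor u (pf_cofactor K a M k i) = L k ^ (M - i) * (\<Prod>j\<in>K - {k}. L j ^ M)"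
      by (simp add: pf_cofactor_def taylor_mult taylor_power taylor_prod taylor_linear L_def)
    moreover have "inverse (\<Prod>k\<in>K. L k ^ M) = inverse (L k) ^ M * (\<Prod>j\<in>K - {k}. inverse (L j) ^ M)"
      unfolding inverse_prod_fps fps_inverse_power using K(1) k by (rule prod.remove)
    moreover have "inverse (L k) ^ M = inverse (L k) ^ (M - i) * inverse (L k) ^ i"
      using i by (simp flip: power_add)
    ultimately have "taylor u (pf_cofactor K a M k i) * inverse (\<Prod>k\<in>K. L k ^ M) =
        (L k ^ (M - i) * inverse (L k) ^ (M - i)) * inverse (L k) ^ i * (\<Prod>j\<in>K - {k}. L j ^ M * inverse (L j) ^ M)"
      by (simp only: prod.distrib mult.assoc mult.commute mult.left_commute)
    also have "(\<Prod>j\<in>K - {k}. L j ^ M * inverse (L j) ^ M) = 1"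
      by (rule prod.neutral) (use LM in auto)
    finally show "taylor u (pf_cofactor K a M k i) * inverse (\<Prod>k\<in>K. L k ^ M) = inverse (L k) ^ i"
      using LM[OF k] by simp
  qed
  finally show ?thesis by (simp only: L_def)
qed

text \<open>Compare coefficients one below the degree of the common denominator: only the cofactors
  with i = 1 reach that degree, they are monic, and P does not reach it.\<close>

lemma sum_residues_eq_0:
  fixes a :: "'k \<Rightarrow> rat"
  assumes K: "finite K" "inj_on a K" and deg: "degree P + 2 \<le> M * card K" and M: "M \<ge> 1"
  shows "(\<Sum>k\<in>K. pf_coeff P K a M k 1) = 0"
proof -
  define d where "d = M * card K - 1"
  have deg': "degree P < M * card K" using deg by linarith
  have top: "coeff (\<Sum>i=1..M. smult (pf_coeff P K a M k i) (pf_cofactor K a M k i)) d = pf_coeff P K a M k 1" if k: "k \<in> K" for k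
  proof -
    have "coeff (pf_cofactor K a M k i) d = (if i = 1 then 1 else 0)" if i: "i \<in> {1..M}" for i
    proof (cases "i = 1")
      case True
      then show ?thesis using pf_cofactor_degree[OF K(1) k, of 1 M a] M by (simp add: d_def)
    next
      case False
      have "degree (pf_cofactor K a M k i) < d"
        using pf_cofactor_degree(1)[OF K(1) k, of i M a] i False deg by (auto simp: d_def)
      then show ?thesis using False by (simp add: coeff_eq_0)
    qed
    then have "coeff (\<Sum>i=1..M. smult (pf_coeff P K a M k i) (pf_cofactor K a M k i)) d =
        (\<Sum>i=1..M. if i = 1 then pf_coeff P K a M k 1 else 0)"
      unfolding coeff_sum by (intro sum.cong) auto
    then show ?thesis using M by simp
  qed
  have "coeff P d = (\<Sum>k\<in>K. pf_coeff P K a M k 1)"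
    by (subst partial_fractions_poly[OF K deg']) (simp only: coeff_sum[of _ K] top cong: sum.cong)
  moreover have "coeff P d = 0" using deg by (intro coeff_eq_0) (simp add: d_def)
  ultimately show ?thesis by simp
qed

section \<open>Denominators of the partial fraction coefficients\<close>

text \<open>The localization of the integers at the prime \<open>p\<close>; integrality is then
  checked one prime at a time by \<open>local_int_Ints\<close>.\<close>

definition local_int :: "nat \<Rightarrow> rat set" where
  "local_int p = {x. \<exists>a b. \<not> int p dvd b \<and> x = of_int a / of_int b}"

lemma local_int_fraction: "\<not> int p dvd b \<Longrightarrow> of_int a / of_int b \<in> local_int p"
  by (auto simp: local_int_def)

lemma local_int_of_int: "prime p \<Longrightarrow> of_int a \<in> local_int p"
  using local_int_fraction[of p 1 a] by (simp add: prime_nat_iff)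

lemma local_int_of_nat: "prime p \<Longrightarrow> of_nat a \<in> local_int p"
  using local_int_of_int[of p "int a"] by simp

lemma local_int_mult:
  assumes "prime p" "x \<in> local_int p" "y \<in> local_int p"
  shows "x * y \<in> local_int p"
proof -
  obtain a b c d where *: "\<not> int p dvd b" "x = of_int a / of_int b" "\<not> int p dvd d" "y = of_int c / of_int d"
    using assms(2,3) by (auto simp: local_int_def)
  then have "\<not> int p dvd b * d" using assms(1) by (simp add: prime_dvd_mult_iff)
  moreover have "x * y = of_int (a * c) / of_int (b * d)" using * by simp
  ultimately show ?thesis by (metis local_int_fraction)
qed

lemma local_int_add:
  assumes "prime p" "x \<in> local_int p" "y \<in> local_int p"
  shows "x + y \<in> local_int p"
proof -
  obtain a b c d where *: "\<not> int p dvd b" "x = of_int a / of_int b" "\<not> int p dvd d" "y = of_int c / of_int d"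
    using assms(2,3) by (auto simp: local_int_def)
  then have "\<not> int p dvd b * d" using assms(1) by (simp add: prime_dvd_mult_iff)
  moreover have "b \<noteq> 0" "d \<noteq> 0" using * by auto
  then have "x + y = of_int (a * d + c * b) / of_int (b * d)" using * by (simp add: field_simps)
  ultimately show ?thesis by (metis local_int_fraction)
qed

lemma local_int_uminus: "prime p \<Longrightarrow> x \<in> local_int p \<Longrightarrow> - x \<in> local_int p"
  using local_int_mult[of p "of_int (- 1)" x] local_int_of_int[of p "- 1"] by simp

lemma local_int_sum:
  "prime p \<Longrightarrow> (\<And>i. i \<in> A \<Longrightarrow> f i \<in> local_int p) \<Longrightarrow> (\<Sum>i\<in>A. f i) \<in> local_int p"
  using local_int_of_int[of p 0]
  by (induction A rule: infinite_finite_induct) (auto intro: local_int_add)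

lemma local_int_power: "prime p \<Longrightarrow> x \<in> local_int p \<Longrightarrow> x ^ n \<in> local_int p"
  using local_int_of_int[of p 1] by (induction n) (auto intro: local_int_mult)

lemma local_int_divide_mult:
  fixes a b :: int
  assumes p: "prime p" and a: "a \<noteq> 0" and le: "multiplicity (int p) a \<le> multiplicity (int p) b"
  shows "of_int b / of_int a \<in> local_int p"
proof (cases "b = 0")
  case True
  then show ?thesis using local_int_of_int[OF p, of 0] by simp
next
  case False
  have np: "\<not> is_unit (int p)" using p by (simp add: prime_nat_iff)
  obtain a' where a': "a = int p ^ multiplicity (int p) a * a'" "\<not> int p dvd a'"
    using multiplicity_decompose'[of a "int p"] a np by metis
  have "int p ^ multiplicity (int p) a dvd b" using le by (rule multiplicity_dvd')
  then obtain b' where b': "b = int p ^ multiplicity (int p) a * b'" by (rule dvdE)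
  have "p > 0" using p by (simp add: prime_gt_0_nat)
  then have "of_int b / of_int a = (of_int b' / of_int a' :: rat)"
    by (subst a'(1), subst b') simp
  then show ?thesis using local_int_fraction[OF a'(2)] by simp
qed

lemma local_int_Ints:
  assumes "\<And>p. prime p \<Longrightarrow> x \<in> local_int p"
  shows "x \<in> \<int>"
proof -
  obtain a b where ab: "quotient_of x = (a, b)" by fastforce
  have b: "b > 0" "coprime a b" "x = of_int a / of_int b"
    using quotient_of_denom_pos[OF ab] quotient_of_coprime[OF ab] quotient_of_div[OF ab] by auto
  have "b = 1"
  proof (rule ccontr)
    assume "b \<noteq> 1"
    then have "nat b \<noteq> 1" using b(1) by simp
    then obtain p where p: "prime p" "p dvd nat b" using prime_factor_nat by blast
    have pb: "int p dvd b" using p(2) b(1) by (metis int_dvd_int_iff int_nat_eq less_le_not_le)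
    obtain c d where cd: "\<not> int p dvd d" "x = of_int c / of_int d"
      using assms[OF p(1)] by (auto simp: local_int_def)
    have "d \<noteq> 0" using cd(1) by auto
    then have "(of_int (a * d) :: rat) = of_int (c * b)" using cd(2) b by (simp add: field_simps)
    then have "a * d = c * b" by (simp only: of_int_eq_iff)
    then have "int p dvd a * d" using pb by simp
    then have "int p dvd a" using cd(1) p(1) by (simp add: prime_dvd_mult_iff)
    then have "is_unit (int p)" using pb b(2) by (metis coprime_common_divisor)
    then show False using p(1) by (simp add: prime_nat_iff)
  qed
  then show ?thesis using b(3) by simp
qed

text \<open>Power series in \<open>X / q\<close> with \<open>p\<close>-integral coefficients.\<close>

definition scaled_fps :: "nat \<Rightarrow> rat \<Rightarrow> rat fps set" where
  "scaled_fps p q = {h. \<forall>e. fps_nth h e * q ^ e \<in> local_int p}"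

context
  fixes p :: nat and q :: rat
  assumes p: "prime p"
begin

lemma scaled_fps_mult:
  assumes "g \<in> scaled_fps p q" "h \<in> scaled_fps p q"
  shows "g * h \<in> scaled_fps p q"
  unfolding scaled_fps_def
proof (intro CollectI allI)
  fix e
  have "fps_nth (g * h) e * q ^ e = (\<Sum>i=0..e. (fps_nth g i * q ^ i) * (fps_nth h (e - i) * q ^ (e - i)))"
    unfolding fps_mult_nth sum_distrib_right
  proof (intro sum.cong refl)
    fix i assume "i \<in> {0..e}"
    then have "q ^ e = q ^ i * q ^ (e - i)" by (simp flip: power_add)
    then show "fps_nth g i * fps_nth h (e - i) * q ^ e = (fps_nth g i * q ^ i) * (fps_nth h (e - i) * q ^ (e - i))"
      by simp
  qed
  also have "\<dots> \<in> local_int p"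
    using assms unfolding scaled_fps_def by (intro local_int_sum[OF p]) (blast intro: local_int_mult[OF p])
  finally show "fps_nth (g * h) e * q ^ e \<in> local_int p" .
qed

lemma scaled_fps_const: "c \<in> local_int p \<Longrightarrow> fps_const c \<in> scaled_fps p q"
  using local_int_of_int[OF p, of 0] by (auto simp: scaled_fps_def)

lemma scaled_fps_prod: "(\<And>i. i \<in> A \<Longrightarrow> f i \<in> scaled_fps p q) \<Longrightarrow> (\<Prod>i\<in>A. f i) \<in> scaled_fps p q"
  using scaled_fps_const[of 1] local_int_of_int[OF p, of 1]
  by (induction A rule: infinite_finite_induct) (auto intro: scaled_fps_mult)

lemma scaled_fps_power: "f \<in> scaled_fps p q \<Longrightarrow> f ^ n \<in> scaled_fps p q"
  using scaled_fps_const[of 1] local_int_of_int[OF p, of 1]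
  by (induction n) (auto intro: scaled_fps_mult)

lemma scaled_fps_shift:
  assumes "c * a \<in> local_int p" "c * q \<in> local_int p"
  shows "fps_const c * shift_fps a \<in> scaled_fps p q"
proof -
  have "fps_nth (fps_const c * shift_fps a) e * q ^ e \<in> local_int p" for e
    using assms local_int_of_int[OF p, of 0]
    by (cases "e = 0"; cases "e = 1") (auto simp: shift_fps_def)
  then show ?thesis by (simp add: scaled_fps_def)
qed

lemma scaled_fps_inverse_shift:
  assumes "a \<noteq> 0" "q / a \<in> local_int p"
  shows "fps_const a * inverse (shift_fps a) \<in> scaled_fps p q"
proof -
  have "shift_fps a = fps_const a + fps_const 1 * fps_X" by (simp add: shift_fps_def)
  then have inv: "inverse (shift_fps a) = Abs_fps (\<lambda>k. (- 1) ^ k / a ^ Suc k)"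
    using inverse_linear_fps[OF assms(1), of 1] by simp
  have "fps_nth (fps_const a * inverse (shift_fps a)) e * q ^ e = (- (q / a)) ^ e" for e
    using assms(1) by (simp add: inv power_minus' power_divide)
  then show ?thesis using assms(2) p by (auto simp: scaled_fps_def intro!: local_int_power local_int_uminus)
qed

end

section \<open>Prime powers in factorials and in blocks of odd numbers\<close>

lemma card_powers_dvd:
  fixes x :: int
  assumes p: "prime p" and x: "x \<noteq> 0"
  shows "card {e\<in>{1..E}. int p ^ e dvd x} = min (multiplicity (int p) x) E"
proof -
  have iff: "int p ^ e dvd x \<longleftrightarrow> e \<le> multiplicity (int p) x" for e
    using p x by (subst power_dvd_iff_le_multiplicity) (auto simp: prime_nat_iff)
  have "{e\<in>{1..E}. int p ^ e dvd x} = {1..min (multiplicity (int p) x) E}" unfolding iff by auto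
  then show ?thesis by (simp only: card_atLeastAtMost diff_Suc_1 One_nat_def)
qed

text \<open>Double counting of the pairs (x, e) with p^e dividing f x: the argument behind
  Legendre's formula, with the levels cut off at \<open>E\<close>.\<close>

lemma sum_min_multiplicity:
  fixes f :: "'b \<Rightarrow> int"
  assumes p: "prime p" and A: "finite A" "\<And>x. x \<in> A \<Longrightarrow> f x \<noteq> 0"
  shows "(\<Sum>x\<in>A. min (multiplicity (int p) (f x)) E) = (\<Sum>e=1..E. card {x\<in>A. int p ^ e dvd f x})"
proof -
  have "(\<Sum>x\<in>A. min (multiplicity (int p) (f x)) E) = (\<Sum>x\<in>A. card {e\<in>{1..E}. int p ^ e dvd f x})"
    by (intro sum.cong refl card_powers_dvd[OF p, symmetric] A(2))
  also have "\<dots> = (\<Sum>x\<in>A. \<Sum>e=1..E. if int p ^ e dvd f x then 1 else 0)"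
    by (simp only: card_eq_sum sum.inter_filter finite_atLeastAtMost)
  also have "\<dots> = (\<Sum>e=1..E. \<Sum>x\<in>A. if int p ^ e dvd f x then 1 else 0)" by (rule sum.swap)
  also have "\<dots> = (\<Sum>e=1..E. card {x\<in>A. int p ^ e dvd f x})"
    by (simp only: card_eq_sum sum.inter_filter A(1))
  finally show ?thesis .
qed

lemma card_multiples: "card {x\<in>{1..m}. d dvd x} = m div d" for d m :: nat
proof (induction m)
  case (Suc m)
  have "{x\<in>{1..Suc m}. d dvd x} = {x\<in>{1..m}. d dvd x} \<union> (if d dvd Suc m then {Suc m} else {})"
    by (auto simp: le_Suc_eq)
  then have "card {x\<in>{1..Suc m}. d dvd x} = card {x\<in>{1..m}. d dvd x} + (if d dvd Suc m then 1 else 0)"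
    by (auto simp: card_insert_if)
  then show ?case using Suc div_Suc[of m d] by (auto simp: mod_eq_0_iff_dvd)
qed simp

lemma multiplicity_fact:
  assumes p: "prime p" and m: "m < p ^ Suc E"
  shows "multiplicity (int p) (fact m :: int) = (\<Sum>e=1..E. m div p ^ e)"
proof -
  have "multiplicity (int p) (fact m :: int) = multiplicity (int p) (\<Prod>x\<in>{1..m}. int x)"
    by (simp add: fact_prod)
  also have "\<dots> = (\<Sum>x\<in>{1..m}. multiplicity (int p) (int x))"
    using p by (subst prime_elem_multiplicity_prod_distrib) (auto simp: prime_imp_prime_elem)
  also have "\<dots> = (\<Sum>x\<in>{1..m}. min (multiplicity (int p) (int x)) E)"
  proof (intro sum.cong refl)
    fix x assume x: "x \<in> {1..m}"
    have "\<not> int p ^ Suc E dvd int x"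
    proof
      assume "int p ^ Suc E dvd int x"
      then have "p ^ Suc E dvd x" by (metis int_dvd_int_iff of_nat_power)
      then show False using x m by (auto dest: dvd_imp_le)
    qed
    then have "multiplicity (int p) (int x) < Suc E" using x p by (intro multiplicity_lessI) (auto simp: prime_nat_iff)
    then show "multiplicity (int p) (int x) = min (multiplicity (int p) (int x)) E" by simp
  qed
  also have "\<dots> = (\<Sum>e=1..E. card {x\<in>{1..m}. int p ^ e dvd int x})"
    by (rule sum_min_multiplicity[OF p]) auto
  also have "\<dots> = (\<Sum>e=1..E. m div p ^ e)"
  proof (rule sum.cong[OF refl])
    fix e
    have "{x\<in>{1..m}. int p ^ e dvd int x} = {x\<in>{1..m}. p ^ e dvd x}" by (simp flip: of_nat_power)
    then show "card {x\<in>{1..m}. int p ^ e dvd int x} = m div p ^ e" by (simp only: card_multiples)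
  qed
  finally show ?thesis .
qed

text \<open>Since 2 is invertible modulo the odd number \<open>Q\<close>, every block of
  \<open>Q\<close> consecutive t contains a solution.\<close>

lemma card_odd_progression:
  fixes c :: int
  assumes Q: "odd Q" "Q > 0"
  shows "L div Q \<le> card {t\<in>{..<L}. int Q dvd 2 * int t + c}"
proof -
  \<comment> \<open>The inverse of 2 modulo \<open>Q\<close>.\<close>
  define h where "h = (int Q + 1) div 2"
  have h: "2 * h = int Q + 1" using Q(1) by (auto simp: h_def elim!: oddE)
  define t0 where "t0 = nat ((- c * h) mod int Q)"
  have t0: "int t0 = (- c * h) mod int Q" using Q by (simp add: t0_def)
  have t0Q: "t0 < Q" using t0 Q by (metis nat_int of_nat_0_less_iff of_nat_less_iff pos_mod_bound)
  have dvd0: "int Q dvd 2 * int t0 + c"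
  proof -
    have "[2 * int t0 + c = 2 * (- c * h) + c] (mod int Q)"
      unfolding t0 by (intro cong_add cong_mult cong_mod_left) (auto simp: cong_def)
    moreover have "2 * (- c * h) + c = - c * int Q" using h by (simp add: algebra_simps)
    ultimately show ?thesis by (metis cong_dvd_iff dvd_triv_right)
  qed
  have "inj_on (\<lambda>i. t0 + i * Q) {..<L div Q}" using Q by (auto simp: inj_on_def)
  then have "L div Q = card ((\<lambda>i. t0 + i * Q) ` {..<L div Q})" by (simp add: card_image)
  also have "\<dots> \<le> card {t\<in>{..<L}. int Q dvd 2 * int t + c}"
  proof (rule card_mono)
    show "(\<lambda>i. t0 + i * Q) ` {..<L div Q} \<subseteq> {t\<in>{..<L}. int Q dvd 2 * int t + c}"
    proof clarify
      fix i assume "i < L div Q"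
      then have "Suc i * Q \<le> L" by (metis Suc_leI div_times_less_eq_dividend le_trans mult_le_mono1)
      then have "t0 + i * Q < L" using t0Q by simp
      moreover have "2 * int (t0 + i * Q) + c = (2 * int t0 + c) + int Q * (2 * int i)" by (simp add: algebra_simps)
      then have "int Q dvd 2 * int (t0 + i * Q) + c" using dvd0 by (metis dvd_add dvd_triv_left)
      ultimately show "t0 + i * Q \<in> {..<L} \<and> int Q dvd 2 * int (t0 + i * Q) + c" by simp
    qed
  qed simp
  finally show ?thesis .
qed

lemma multiplicity_lcm_upto:
  assumes p: "prime p" and E: "p ^ E \<le> n" "n < p ^ Suc E"
  shows "multiplicity (int p) (int (lcm_upto n)) = E"
proof (rule antisym)
  have np: "\<not> is_unit (int p)" using p by (simp add: prime_nat_iff)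
  have "p ^ E dvd lcm_upto n" using E p by (intro dvd_lcm_upto) (auto simp: prime_gt_0_nat)
  then have "int p ^ E dvd int (lcm_upto n)" by (metis int_dvd_int_iff of_nat_power)
  then show "E \<le> multiplicity (int p) (int (lcm_upto n))" using np by (intro multiplicity_geI) (auto simp: lcm_upto_pos[THEN gr_implies_not0])
  have "\<not> int p ^ Suc E dvd int (lcm_upto n)"
  proof
    assume "int p ^ Suc E dvd int (lcm_upto n)"
    then have "p ^ Suc E dvd lcm_upto n" by (metis int_dvd_int_iff of_nat_power)
    then have "p ^ Suc E \<le> n" using prime_power_dvd_lcm_upto[OF p] by blast
    then show False using E by simp
  qed
  then show "multiplicity (int p) (int (lcm_upto n)) \<le> E"
    using np by (metis less_Suc_eq_le multiplicity_lessI of_nat_eq_0_iff lcm_upto_pos less_numeral_extra(3))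
qed

text \<open>Legendre's formula: among the \<open>2 n\<close> consecutive odd numbers there are at least
  $\lfloor 2n/p^e\rfloor$ multiples of \<open>p ^ e\<close>, as many as in \<open>{1..2 n}\<close>; truncating multiplicities at the
  exponent of \<open>p\<close> in \<open>lcm_upto n\<close> loses at most the exponent of \<open>lcm_upto (2 n)\<close> over it.\<close>

lemma multiplicity_odd_block:
  fixes c :: int
  assumes p: "prime p" "odd p" and n: "n \<ge> 1" and c: "odd c"
  shows "multiplicity (int p) (fact (2 * n) * int (lcm_upto n)) \<le>
    multiplicity (int p) (int (lcm_upto (2 * n)) * (\<Prod>t<2 * n. gcd (2 * int t + c) (int (lcm_upto n))))"
proof -
  have p2: "p \<ge> 2" and pp: "prime_elem (int p)" using p(1) by (auto simp: prime_ge_2_nat prime_imp_prime_elem)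
  obtain E where E: "p ^ E \<le> n" "n < p ^ Suc E" using ex_power_ivl1[OF p2 n] by auto
  obtain E2 where E2: "p ^ E2 \<le> 2 * n" "2 * n < p ^ Suc E2" using ex_power_ivl1[OF p2, of "2 * n"] n by auto
  have "p ^ E < p ^ Suc E2" using E E2 by simp
  then have EE2: "E \<le> E2" using p2 power_less_imp_less_exp[of p E "Suc E2"] by simp
  have "p ^ E2 < p ^ (E + 2)"
  proof -
    have "2 * n < 2 * p ^ Suc E" using E by simp
    also have "\<dots> \<le> p * p ^ Suc E" using p2 by (intro mult_le_mono1)
    finally show ?thesis using E2 by simp
  qed
  then have "E2 < E + 2" using p2 power_less_imp_less_exp[of p E2 "E + 2"] by simp
  then have E2E: "E2 \<le> Suc E" by simp
  have mE: "multiplicity (int p) (int (lcm_upto n)) = E" "multiplicity (int p) (int (lcm_upto (2 * n))) = E2"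
    using multiplicity_lcm_upto[OF p(1)] E E2 by blast+
  have d0: "lcm_upto m \<noteq> 0" for m using lcm_upto_pos[of m] by linarith
  have nz: "2 * int t + c \<noteq> 0" for t using c by presburger
  have g0: "gcd (2 * int t + c) (int (lcm_upto n)) \<noteq> 0" for t using nz by simp
  have "multiplicity (int p) (fact (2 * n) * int (lcm_upto n)) = (\<Sum>e=1..E2. 2 * n div p ^ e) + E"
    using pp d0 multiplicity_fact[OF p(1) E2(2)] mE by (subst prime_elem_multiplicity_mult_distrib) auto
  \<comment> \<open>At most the level E+1 is dropped, and its term is at most 1 because 2n < 2
    p^(E+1).\<close>
  also have "(\<Sum>e=1..E2. 2 * n div p ^ e) + E \<le> (\<Sum>e=1..E. 2 * n div p ^ e) + E2"
  proof (cases "E2 = Suc E")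
    case True
    have "2 * n div p ^ Suc E < 2" using E(2) p2 by (intro div_less_iff_less_mult[THEN iffD2]) auto
    then show ?thesis using True by simp
  next
    case False
    then have "E2 = E" using EE2 E2E by simp
    then show ?thesis by simp
  qed
  also have "(\<Sum>e=1..E. 2 * n div p ^ e) \<le> (\<Sum>e=1..E. card {t\<in>{..<2 * n}. int p ^ e dvd 2 * int t + c})"
  proof (rule sum_mono)
    fix e
    show "2 * n div p ^ e \<le> card {t\<in>{..<2 * n}. int p ^ e dvd 2 * int t + c}"
      using card_odd_progression[of "p ^ e" "2 * n" c] p p2 by simp
  qed
  also have "\<dots> = (\<Sum>t<2 * n. min (multiplicity (int p) (2 * int t + c)) E)"
    using nz by (intro sum_min_multiplicity[OF p(1), symmetric]) auto
  also have "\<dots> = (\<Sum>t<2 * n. multiplicity (int p) (gcd (2 * int t + c) (int (lcm_upto n))))"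
    using nz d0 p(1) by (intro sum.cong refl) (simp add: multiplicity_gcd mE)
  also have "\<dots> = multiplicity (int p) (\<Prod>t<2 * n. gcd (2 * int t + c) (int (lcm_upto n)))"
    using pp d0[of n] nz by (subst prime_elem_multiplicity_prod_distrib) auto
  also have "\<dots> + E2 = multiplicity (int p) (int (lcm_upto (2 * n)) * (\<Prod>t<2 * n. gcd (2 * int t + c) (int (lcm_upto n))))"
    using pp d0 g0 mE by (subst prime_elem_multiplicity_mult_distrib) auto
  finally show ?thesis by simp
qed

text \<open>By Legendre's formula the exponent of 2 in m! is at most m, as the floors m div 2^e at
  least halve from one level to the next.\<close>

lemma two_power_fact_local: "2 ^ m / fact m \<in> local_int 2"
proof -
  obtain E where E: "m < 2 ^ Suc E" using that[of m] less_exp[of m] by simp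
  have "(\<Sum>e=1..E. m div 2 ^ e) + m div 2 ^ E \<le> m"
  proof (induction E)
    case (Suc E)
    have "m div 2 ^ Suc E = m div 2 ^ E div 2" by (simp only: power_Suc2 div_mult2_eq)
    then show ?case using Suc by simp
  qed simp
  then have "multiplicity 2 (fact m :: int) \<le> m" using multiplicity_fact[OF two_is_prime_nat E] by (simp del: power_Suc)
  also have "m = multiplicity 2 (2 ^ m :: int)" by simp
  finally have "of_int (2 ^ m) / of_int (fact m) \<in> local_int 2"
    by (intro local_int_divide_mult) auto
  then show ?thesis by simp
qed

section \<open>Local expansions at the poles\<close>

lemma num_fps_eq:
  "num_fps n b \<epsilon> u = taylor u ((\<Prod>m=1..n. [:of_int (4 * int m - 1), 1:] * [:of_int (4 * int m - 3), 1:]) ^ b * [:of_nat (2 * n), 1:] ^ \<epsilon>)"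
  by (simp only: num_fps_def taylor_mult taylor_power taylor_prod taylor_linear)

definition num_poly :: "nat \<Rightarrow> nat \<Rightarrow> nat \<Rightarrow> rat poly" where
  "num_poly n b \<epsilon> = (\<Prod>m=1..n. [:of_int (4 * int m - 1), 1:] * [:of_int (4 * int m - 3), 1:]) ^ b * [:of_nat (2 * n), 1:] ^ \<epsilon>"

lemma taylor_num_poly: "taylor u (num_poly n b \<epsilon>) = num_fps n b \<epsilon> u"
  by (simp only: num_fps_eq num_poly_def)

definition coeff_quot :: "nat \<Rightarrow> nat \<Rightarrow> nat \<Rightarrow> nat \<Rightarrow> nat \<Rightarrow> rat" where
  "coeff_quot n b \<epsilon> k i = pf_coeff (num_poly n b \<epsilon>) {0..n} (\<lambda>k. of_nat (4 * k)) (2 * b) k i"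

text \<open>The expansion of Q(u) (u+4k)^(2b) at the pole u = -4k is the b-th power of this series,
  apart from the factor (u+2n)^\<epsilon>. Integrality, symmetry and size are therefore studied for
  the block alone.\<close>

definition local_block :: "nat \<Rightarrow> nat \<Rightarrow> rat fps" where
  "local_block n k = (\<Prod>m=1..n. shift_fps (of_int (4 * int m - 1 - 4 * int k)) * shift_fps (of_int (4 * int m - 3 - 4 * int k))) *
     (\<Prod>j\<in>{0..n} - {k}. inverse (shift_fps (of_int (4 * (int j - int k))))) ^ 2"

lemma coeff_quot_block:
  "coeff_quot n b \<epsilon> k i = fps_nth (local_block n k ^ b * shift_fps (of_int (2 * int n - 4 * int k)) ^ \<epsilon>) (2 * b - i)"
proof -
  have 1: "- of_nat (4 * k) + of_int (4 * int m - 1) = (of_int (4 * int m - 1 - 4 * int k) :: rat)"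
    "- of_nat (4 * k) + of_int (4 * int m - 3) = (of_int (4 * int m - 3 - 4 * int k) :: rat)"
    "- of_nat (4 * k) + of_nat (2 * n) = (of_int (2 * int n - 4 * int k) :: rat)"
    "of_nat (4 * j) - of_nat (4 * k) = (of_int (4 * (int j - int k)) :: rat)" for m j
    by simp_all
  have den: "inverse (\<Prod>j\<in>A. L j ^ (2 * b)) = ((\<Prod>j\<in>A. inverse (L j)) ^ 2) ^ b"
    for L :: "nat \<Rightarrow> rat fps" and A
  proof -
    have "inverse (\<Prod>j\<in>A. L j ^ (2 * b)) = (\<Prod>j\<in>A. inverse (L j) ^ (2 * b))"
      unfolding inverse_prod_fps fps_inverse_power ..
    also have "\<dots> = (\<Prod>j\<in>A. inverse (L j)) ^ (2 * b)" by (rule prod_power_distrib[symmetric])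
    finally show ?thesis by (simp only: power_mult)
  qed
  have "num_fps n b \<epsilon> (- of_nat (4 * k)) * inverse (\<Prod>j\<in>{0..n} - {k}. shift_fps (of_nat (4 * j) - of_nat (4 * k)) ^ (2 * b)) =
      local_block n k ^ b * shift_fps (of_int (2 * int n - 4 * int k)) ^ \<epsilon>"
    unfolding num_fps_def 1 local_block_def den power_mult_distrib[of "prod _ _"]
    by (simp only: mult.assoc mult.commute mult.left_commute)
  then show ?thesis unfolding coeff_quot_def pf_coeff_def taylor_num_poly by simp
qed

lemma prod_diff_fact:
  assumes "k \<le> n"
  shows "(\<Prod>j\<in>{0..n} - {k}. int j - int k) = (- 1) ^ k * fact k * fact (n - k)"
proof -
  have split: "{0..n} - {k} = {0..<k} \<union> {k<..n}" using assms by auto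
  have "(\<Prod>j\<in>{0..n} - {k}. int j - int k) = (\<Prod>j\<in>{0..<k}. int j - int k) * (\<Prod>j\<in>{k<..n}. int j - int k)"
    unfolding split by (rule prod.union_disjoint) auto
  also have "(\<Prod>j\<in>{0..<k}. int j - int k) = (\<Prod>i\<in>{1..k}. - int i)"
    by (rule prod.reindex_bij_witness[of _ "\<lambda>i. k - i" "\<lambda>j. k - j"]) auto
  also have "\<dots> = (- 1) ^ k * fact k"
    by (simp add: fact_prod prod_uminus)
  also have "(\<Prod>j\<in>{k<..n}. int j - int k) = (\<Prod>i\<in>{1..n - k}. int i)"
    by (rule prod.reindex_bij_witness[of _ "\<lambda>i. i + k" "\<lambda>j. j - k"]) auto
  also have "\<dots> = fact (n - k)" by (simp add: fact_prod)
  finally show ?thesis .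
qed

definition pole_prod :: "nat \<Rightarrow> nat \<Rightarrow> rat" where
  "pole_prod n k = (\<Prod>j\<in>{0..n} - {k}. of_int (4 * (int j - int k)))"

lemma pole_prod_eq: "k \<le> n \<Longrightarrow> pole_prod n k = 4 ^ n * of_int ((- 1) ^ k * fact k * fact (n - k))"
proof -
  assume k: "k \<le> n"
  have "pole_prod n k = of_int (\<Prod>j\<in>{0..n} - {k}. 4 * (int j - int k))"
    by (simp add: pole_prod_def)
  also have "(\<Prod>j\<in>{0..n} - {k}. 4 * (int j - int k)) = 4 ^ n * ((- 1) ^ k * fact k * fact (n - k))"
    using k by (simp only: prod.distrib prod_diff_fact prod_constant) (simp add: card_Diff_singleton)
  finally show ?thesis by simp
qed

text \<open>The quotient is a binomial coefficient up to sign.\<close>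

lemma pole_prod_divides: "k \<le> n \<Longrightarrow> 4 ^ n * fact n / pole_prod n k \<in> \<int>"
proof -
  assume k: "k \<le> n"
  have "(fact n :: rat) = fact k * fact (n - k) * of_nat (n choose k)"
    using binomial_fact_lemma[OF k] by (metis of_nat_fact of_nat_mult)
  then have "4 ^ n * fact n / pole_prod n k = (- 1) ^ k * of_nat (n choose k)"
    unfolding pole_prod_eq[OF k] by (simp add: field_simps)
  then show ?thesis by simp
qed

lemma Ints_local_int: "prime p \<Longrightarrow> x \<in> \<int> \<Longrightarrow> x \<in> local_int p"
  by (auto elim!: Ints_cases intro: local_int_of_int)

lemma fps_const_prod: "fps_const (\<Prod>k\<in>A. f k) = (\<Prod>k\<in>A. fps_const (f k))" for f :: "'b \<Rightarrow> rat"
  by (induction A rule: infinite_finite_induct) (simp_all flip: fps_const_mult)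

text \<open>The numbers 4m-3-4k and 4m-1-4k interlace to 2n consecutive odd numbers.\<close>

lemma odd_block_reindex:
  "(\<Prod>m=1..n. f (4 * int m - 1 - 4 * int k) * f (4 * int m - 3 - 4 * int k)) = (\<Prod>t<2 * n. f (2 * int t + (1 - 4 * int k)))"
  for f :: "int \<Rightarrow> 'b :: comm_monoid_mult"
proof (induction n)
  case (Suc n)
  have "{..<2 * Suc n} = insert (2 * n + 1) (insert (2 * n) {..<2 * n})" by auto
  then have "(\<Prod>t<2 * Suc n. f (2 * int t + (1 - 4 * int k))) =
      f (2 * int (2 * n + 1) + (1 - 4 * int k)) * (f (2 * int (2 * n) + (1 - 4 * int k)) * (\<Prod>t<2 * n. f (2 * int t + (1 - 4 * int k))))"
    by simp
  also have "2 * int (2 * n + 1) + (1 - 4 * int k) = 4 * int (Suc n) - 1 - 4 * int k" by simp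
  also have "2 * int (2 * n) + (1 - 4 * int k) = 4 * int (Suc n) - 3 - 4 * int k" by simp
  finally show ?case using Suc by (simp add: ac_simps)
qed simp

lemma inverse_block_scaled:
  assumes p: "prime p" and q: "\<And>j. j \<le> n \<Longrightarrow> j \<noteq> k \<Longrightarrow> q / of_int (4 * (int j - int k)) \<in> local_int p"
  shows "fps_const (pole_prod n k) * (\<Prod>j\<in>{0..n} - {k}. inverse (shift_fps (of_int (4 * (int j - int k))))) \<in> scaled_fps p q"
  unfolding pole_prod_def fps_const_prod prod.distrib[symmetric]
  by (intro scaled_fps_prod[OF p] scaled_fps_inverse_shift[OF p] q) auto

text \<open>The local expansion factors as a constant times a series in \<open>X / q\<close>; for the numerators
  the greatest common divisors with \<open>q\<close> are split off.\<close>

lemma local_block_scaled_odd: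
  assumes p: "prime p" "odd p" and n: "n \<ge> 1" and k: "k \<le> n"
  defines "d \<equiv> lcm_upto n" and "d2 \<equiv> lcm_upto (2 * n)"
  shows "fps_const (fact n ^ 2 * of_nat d2 / (fact (2 * n) * of_nat d)) * local_block n k \<in> scaled_fps p (of_nat d)"
proof -
  let ?N = "\<lambda>t. 2 * int t + (1 - 4 * int k)"
  have d0: "d > 0" by (simp add: d_def)
  define G where "G = (\<Prod>t<2 * n. gcd (?N t) (int d))"
  have g0: "gcd (?N t) (int d) \<noteq> 0" for t using d0 by simp
  have "(\<Prod>t<2 * n. fps_const (1 / of_int (gcd (?N t) (int d))) * shift_fps (of_int (?N t))) \<in> scaled_fps p (of_nat d)"
  proof (intro scaled_fps_prod[OF p(1)] scaled_fps_shift[OF p(1)])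
    fix t
    have "of_int (gcd (?N t) (int d)) * of_int (?N t div gcd (?N t) (int d)) = (of_int (?N t) :: rat)"
      "of_int (gcd (?N t) (int d)) * of_int (int d div gcd (?N t) (int d)) = (of_int (int d) :: rat)"
      by (simp_all only: of_int_mult[symmetric] dvd_mult_div_cancel gcd_dvd1 gcd_dvd2)
    then have "1 / of_int (gcd (?N t) (int d)) * of_int (?N t) = (of_int (?N t div gcd (?N t) (int d)) :: rat)"
      "1 / of_int (gcd (?N t) (int d)) * of_nat d = (of_int (int d div gcd (?N t) (int d)) :: rat)"
      using g0[of t] by (simp_all add: field_simps del: of_int_mult)
    then show "1 / of_int (gcd (?N t) (int d)) * of_int (?N t) \<in> local_int p"
      "1 / of_int (gcd (?N t) (int d)) * of_nat d \<in> local_int p"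
      using local_int_of_int[OF p(1)] by simp_all
  qed
  moreover have "(\<Prod>t<2 * n. fps_const (1 / of_int (gcd (?N t) (int d))) * shift_fps (of_int (?N t))) =
      fps_const (1 / of_int G) * (\<Prod>t<2 * n. shift_fps (of_int (?N t)))"
    unfolding G_def prod.distrib by (simp only: fps_const_prod[symmetric] of_int_prod) (simp add: prod_dividef)
  ultimately have num: "fps_const (1 / of_int G) * (\<Prod>t<2 * n. shift_fps (of_int (?N t))) \<in> scaled_fps p (of_nat d)" by simp
  have quarter: "1 / 4 \<in> local_int p"
  proof -
    have "\<not> int p dvd 4"
    proof
      assume "int p dvd 4"
      then have "int p dvd 2 ^ 2" by simp
      then have "int p dvd 2" using p(1) by (metis prime_dvd_power prime_int_nat_transfer prime_nat_int_transfer)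
      then have "p dvd 2" by (metis int_dvd_int_iff of_nat_numeral)
      then show False using p by (metis primes_dvd_imp_eq two_is_prime_nat dvd_refl even_numeral)
    qed
    then show ?thesis using local_int_fraction[of p 4 1] by simp
  qed
  have "of_nat d / of_int (4 * (int j - int k)) \<in> local_int p" if "j \<le> n" "j \<noteq> k" for j
  proof -
    have "int j - int k dvd int d"
    proof -
      have "nat \<bar>int j - int k\<bar> dvd d" unfolding d_def using that k by (intro dvd_lcm_upto) auto
      then show ?thesis by (simp add: nat_abs_dvd_iff)
    qed
    then obtain x where x: "int d = (int j - int k) * x" by (rule dvdE)
    have "(of_nat d :: rat) = of_int (int j - int k) * of_int x" by (metis x of_int_mult of_int_of_nat_eq)
    then have eq: "of_nat d / of_int (4 * (int j - int k)) = 1 / 4 * (of_int x :: rat)"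
      using that by (simp add: field_simps)
    show ?thesis unfolding eq by (rule local_int_mult[OF p(1) quarter local_int_of_int[OF p(1)]])
  qed
  then have den: "fps_const (pole_prod n k) * (\<Prod>j\<in>{0..n} - {k}. inverse (shift_fps (of_int (4 * (int j - int k))))) \<in> scaled_fps p (of_nat d)"
    by (rule inverse_block_scaled[OF p(1)])
  \<comment> \<open>The three factors are p-integral for separate reasons:
    \<open>multiplicity_odd_block\<close>, the binomial coefficient of
    \<open>pole_prod_divides\<close>, and the invertibility of 4 at an odd prime.\<close>
  define c where "c = of_int (int d2 * G) / of_int (fact (2 * n) * int d) * (4 ^ n * fact n / pole_prod n k) ^ 2 * (1 / 4) ^ (2 * n)"
  have c: "c \<in> local_int p"
    unfolding c_def G_def d_def d2_def
    using multiplicity_odd_block[OF p n, of "1 - 4 * int k"] lcm_upto_pos[of n]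
    by (intro local_int_mult[OF p(1)] local_int_power[OF p(1)] quarter Ints_local_int[OF p(1) pole_prod_divides[OF k]]
        local_int_divide_mult[OF p(1)]) auto
  have P0: "pole_prod n k \<noteq> 0" by (simp add: pole_prod_def)
  have G0: "G \<noteq> 0" using d0 by (simp add: G_def)
  have "fact n ^ 2 * of_nat d2 / (fact (2 * n) * of_nat d) = c * (1 / of_int G) * pole_prod n k ^ 2"
  proof -
    have "(4 ^ n :: rat) ^ 2 * (1 / 4) ^ (2 * n) = 1" by (simp add: power_mult[symmetric] power_one_over mult.commute)
    then have "c = of_nat d2 * of_int G / (fact (2 * n) * of_nat d) * (fact n ^ 2 / pole_prod n k ^ 2)"
      unfolding c_def power_divide power_mult_distrib by (simp add: field_simps)
    then show ?thesis using P0 G0 by simp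
  qed
  then have "fps_const (fact n ^ 2 * of_nat d2 / (fact (2 * n) * of_nat d)) * local_block n k =
      fps_const c * (fps_const (1 / of_int G) * (\<Prod>t<2 * n. shift_fps (of_int (?N t)))) *
      (fps_const (pole_prod n k) * (\<Prod>j\<in>{0..n} - {k}. inverse (shift_fps (of_int (4 * (int j - int k)))))) ^ 2"
    unfolding local_block_def odd_block_reindex[of "\<lambda>x. shift_fps (of_int x)"]
    by (simp only: fps_const_mult[symmetric] fps_const_power[symmetric] power_mult_distrib mult.assoc mult.commute mult.left_commute)
  also have "\<dots> \<in> scaled_fps p (of_nat d)"
    by (intro scaled_fps_mult[OF p(1)] scaled_fps_power[OF p(1)] scaled_fps_const[OF p(1)] c num den)
  finally show ?thesis .
qed

text \<open>At the prime 2 the numerators are odd, so no common divisors are split off. The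
  distances 4(j-k) between the poles force the scale 4 d_n instead of d_n.\<close>

lemma local_block_scaled_2:
  assumes k: "k \<le> n"
  shows "fps_const (16 ^ n * fact n ^ 2) * local_block n k \<in> scaled_fps 2 (4 * of_nat (lcm_upto n))"
proof -
  let ?q = "4 * of_nat (lcm_upto n) :: rat"
  let ?N = "\<lambda>t. 2 * int t + (1 - 4 * int k)"
  note p = two_is_prime_nat
  have lin: "fps_const 1 * shift_fps (of_int x) \<in> scaled_fps 2 ?q" for x
    using local_int_of_int[OF p, of x] local_int_of_int[OF p, of "4 * int (lcm_upto n)"]
    by (intro scaled_fps_shift[OF p]) auto
  have num: "(\<Prod>t<2 * n. shift_fps (of_int (?N t))) \<in> scaled_fps 2 ?q"
    by (rule scaled_fps_prod[OF p]) (rule lin[unfolded fps_const_1_eq_1 mult_1_left])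
  have "?q / of_int (4 * (int j - int k)) \<in> local_int 2" if "j \<le> n" "j \<noteq> k" for j
  proof -
    have "nat \<bar>int j - int k\<bar> dvd lcm_upto n" using that k by (intro dvd_lcm_upto) auto
    then have "int j - int k dvd int (lcm_upto n)" by (simp add: nat_abs_dvd_iff)
    then obtain x where x: "int (lcm_upto n) = (int j - int k) * x" by (rule dvdE)
    have "(of_nat (lcm_upto n) :: rat) = of_int (int j - int k) * of_int x" by (metis x of_int_mult of_int_of_nat_eq)
    then have "?q / of_int (4 * (int j - int k)) = (of_int x :: rat)"
      using that by (simp add: field_simps)
    then show ?thesis using local_int_of_int[OF p] by simp
  qed
  then have den: "fps_const (pole_prod n k) * (\<Prod>j\<in>{0..n} - {k}. inverse (shift_fps (of_int (4 * (int j - int k))))) \<in> scaled_fps 2 ?q"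
    by (rule inverse_block_scaled[OF p])
  define c where "c = (4 ^ n * fact n / pole_prod n k) ^ 2"
  have c: "c \<in> local_int 2"
    unfolding c_def by (intro local_int_power[OF p] Ints_local_int[OF p pole_prod_divides[OF k]])
  have P0: "pole_prod n k \<noteq> 0" by (simp add: pole_prod_def)
  have "(4 ^ n) ^ 2 = (16 ^ n :: rat)" by (simp add: power_mult[symmetric] mult.commute[of n] power_mult)
  then have "16 ^ n * fact n ^ 2 = c * pole_prod n k ^ 2"
    using P0 by (simp add: c_def power_divide power_mult_distrib)
  then have "fps_const (16 ^ n * fact n ^ 2) * local_block n k =
      fps_const c * (\<Prod>t<2 * n. shift_fps (of_int (?N t))) *
      (fps_const (pole_prod n k) * (\<Prod>j\<in>{0..n} - {k}. inverse (shift_fps (of_int (4 * (int j - int k)))))) ^ 2"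
    unfolding local_block_def odd_block_reindex[of "\<lambda>x. shift_fps (of_int x)"]
    by (simp only: fps_const_mult[symmetric] fps_const_power[symmetric] power_mult_distrib mult.assoc mult.commute mult.left_commute)
  also have "\<dots> \<in> scaled_fps 2 ?q"
    by (intro scaled_fps_mult[OF p] scaled_fps_power[OF p] scaled_fps_const[OF p] c num den)
  finally show ?thesis .
qed

lemma coeff_quot_local:
  assumes p: "prime p" and q: "q \<in> local_int p"
    and block: "fps_const c * local_block n k \<in> scaled_fps p q"
  shows "c ^ b * q ^ (2 * b - i) * coeff_quot n b \<epsilon> k i \<in> local_int p"
proof -
  have "fps_const 1 * shift_fps (of_int (2 * int n - 4 * int k)) \<in> scaled_fps p q"
    using q local_int_of_int[OF p, of "2 * int n - 4 * int k"] by (intro scaled_fps_shift[OF p]) auto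
  then have "(fps_const c * local_block n k) ^ b * shift_fps (of_int (2 * int n - 4 * int k)) ^ \<epsilon> \<in> scaled_fps p q"
    by (intro scaled_fps_mult[OF p] scaled_fps_power[OF p] block) simp
  then have F: "fps_nth ((fps_const c * local_block n k) ^ b * shift_fps (of_int (2 * int n - 4 * int k)) ^ \<epsilon>) (2 * b - i) * q ^ (2 * b - i) \<in> local_int p"
    by (simp add: scaled_fps_def)
  have eq: "(fps_const c * local_block n k) ^ b * shift_fps (of_int (2 * int n - 4 * int k)) ^ \<epsilon> =
      fps_const (c ^ b) * (local_block n k ^ b * shift_fps (of_int (2 * int n - 4 * int k)) ^ \<epsilon>)"
    by (simp add: power_mult_distrib fps_const_power mult.assoc)
  show ?thesis using F unfolding coeff_quot_block eq fps_mult_left_const_nth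
    by (simp only: mult.assoc mult.commute mult.left_commute)
qed

section \<open>Hasse derivatives and the common denominator\<close>

text \<open>The Hasse derivative of order \<open>d\<close> of $u^{-i}$ at $u=1$.\<close>

definition hasse_coeff :: "nat \<Rightarrow> nat \<Rightarrow> int" where
  "hasse_coeff i d = (- 1) ^ d * int ((i + d - 1) choose d)"

lemma inverse_shift_power_nth:
  assumes "a \<noteq> 0"
  shows "fps_nth (inverse (shift_fps a) ^ i) d = of_int (hasse_coeff i d) / a ^ (i + d)"
proof (induction i arbitrary: d)
  case 0
  then show ?case by (cases d) (auto simp: hasse_coeff_def)
next
  case (Suc i)
  have "shift_fps a = fps_const a + fps_const 1 * fps_X" by (simp add: shift_fps_def)
  then have inv: "fps_nth (inverse (shift_fps a)) k = (- 1) ^ k / a ^ Suc k" for k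
    using inverse_linear_fps[OF assms, of 1] by simp
  have "fps_nth (inverse (shift_fps a) ^ Suc i) d =
      (\<Sum>k=0..d. (- 1) ^ (d - k) / a ^ Suc (d - k) * (of_int (hasse_coeff i k) / a ^ (i + k)))"
    unfolding power_Suc2[of "inverse (shift_fps a)"] fps_mult_nth Suc by (intro sum.cong refl) (subst mult.commute, simp only: inv)
  also have "\<dots> = (\<Sum>k=0..d. (- 1) ^ d * of_nat ((i + k - 1) choose k) / a ^ (Suc i + d))"
  proof (intro sum.cong refl)
    fix k assume "k \<in> {0..d}"
    then have k: "k \<le> d" by simp
    have "(- 1 :: rat) ^ (d - k) * (- 1) ^ k = (- 1) ^ d" using k by (simp flip: power_add)
    moreover have "Suc (d - k) + (i + k) = Suc i + d" using k by simp
    then have "a ^ Suc (d - k) * a ^ (i + k) = a ^ (Suc i + d)" by (simp only: power_add[symmetric])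
    ultimately show "(- 1) ^ (d - k) / a ^ Suc (d - k) * (of_int (hasse_coeff i k) / a ^ (i + k)) =
        (- 1) ^ d * of_nat ((i + k - 1) choose k) / a ^ (Suc i + d)"
      by (simp only: hasse_coeff_def times_divide_times_eq of_int_mult of_int_power of_int_minus of_int_1
          of_int_of_nat_eq mult.assoc[symmetric])
  qed
  also have "\<dots> = (- 1) ^ d * of_nat (\<Sum>k=0..d. (i + k - 1) choose k) / a ^ (Suc i + d)"
    by (simp add: sum_distrib_left sum_divide_distrib)
  also have "(\<Sum>k=0..d. (i + k - 1) choose k) = (Suc i + d - 1) choose d"
  proof (cases i)
    case 0
    have "(\<Sum>k=0..d. (k - 1) choose k) = (\<Sum>k=0..d. if k = 0 then 1 else 0)"
      by (intro sum.cong) auto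
    then show ?thesis using 0 by simp
  next
    case (Suc j)
    then show ?thesis using sum_choose_lower[of j d] by (simp add: atMost_atLeast0)
  qed
  finally show ?case by (simp add: hasse_coeff_def)
qed

text \<open>Differentiating a Hasse derivative of order d gives d+1 times the one of order d+1. This
  turns the derivatives that arise from translating the Volkenborn integral into
  \<open>tail_part\<close>.\<close>

lemma hasse_coeff_Suc: "(int d + 1) * hasse_coeff i (Suc d) = - int (i + d) * hasse_coeff i d" if "i \<ge> 1"
proof -
  have "Suc d * ((i + d) choose Suc d) = (i + d) * ((i + d - 1) choose d)"
    by (rule binomial_absorption)
  then have "(int d + 1) * int ((i + d) choose Suc d) = int (i + d) * int ((i + d - 1) choose d)"
    by (metis of_nat_Suc of_nat_mult add.commute)
  note eq = this
  have "(int d + 1) * hasse_coeff i (Suc d) = (- 1) ^ Suc d * ((int d + 1) * int ((i + d) choose Suc d))"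
    by (simp add: hasse_coeff_def)
  also have "\<dots> = (- 1) ^ Suc d * (int (i + d) * int ((i + d - 1) choose d))" by (simp only: eq)
  also have "\<dots> = - int (i + d) * hasse_coeff i d"
    by (simp add: hasse_coeff_def mult.left_commute del: of_nat_add)
  finally show ?thesis .
qed

lemma multiplier_regroup:
  "(P * S) ^ b * (4 ^ e * 4 ^ i) * (((F * z / G) ^ b * D ^ e * C) * x * (D / y) ^ f) =
    ((P / G) ^ b * z ^ b * 4 ^ i * D ^ f) * ((S * F) ^ b * (4 * D) ^ e * C) * x * (1 / y) ^ f"
  for P S F G z D C x y :: rat
  by (simp only: power_mult_distrib power_divide power_one times_divide_eq_left times_divide_eq_right
      divide_divide_eq_left mult_1_left mult.assoc mult.commute mult.left_commute)

lemma multiplier_split_aux: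
  "T * A * D ^ (e + f) * (C * x / y ^ f) = T * ((A * D ^ e * C) * x * (D / y) ^ f)" for T A D C x y :: rat
  by (simp add: power_add power_divide)

text \<open>The exponent \<open>3 * b - 1\<close> is \<open>(2 * b - i) + (i + b - 1)\<close>: a coefficient of index \<open>2 * b - i\<close> of a series
  in \<open>X / lcm_upto n\<close>, divided by the power \<open>i + b - 1\<close> of a linear factor.\<close>

definition multiplier :: "nat \<Rightarrow> nat \<Rightarrow> rat" where
  "multiplier n b = 2 ^ (6 * n * b + 4 * b) * (fact n ^ 2 * of_nat (lcm_upto (2 * n)) / (fact (2 * n) * of_nat (lcm_upto n))) ^ b *
     of_nat (lcm_upto n) ^ (3 * b - 1)"

text \<open>The share of the pole -4k in the Hasse derivative of order b-1 of Q at u = 1-4m, where u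
  + 4k = 4(k-m) + 1.\<close>

definition tail_part :: "nat \<Rightarrow> nat \<Rightarrow> nat \<Rightarrow> nat \<Rightarrow> nat \<Rightarrow> rat" where
  "tail_part n b \<epsilon> m k = (\<Sum>i=1..2 * b. coeff_quot n b \<epsilon> k i * of_int (hasse_coeff i (b - 1)) / of_int (4 * (int k - int m) + 1) ^ (i + (b - 1)))"

context
  fixes n b \<epsilon> :: nat
  assumes n: "n \<ge> 1" and b: "b \<ge> 2" and \<epsilon>: "\<epsilon> \<le> 1"
begin

lemma num_poly_degree: "degree (num_poly n b \<epsilon>) \<le> 2 * n * b + \<epsilon>"
proof -
  have "degree (\<Prod>m=1..n. [:of_int (4 * int m - 1), 1:] * [:of_int (4 * int m - 3), 1:] :: rat poly) \<le> (\<Sum>m=1..n. 2)"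
    using degree_prod_sum_le[of "{1..n}" "\<lambda>m. [:of_int (4 * int m - 1), 1:] * [:of_int (4 * int m - 3), 1:] :: rat poly"]
    by (simp add: degree_mult_eq)
  then have "degree ((\<Prod>m=1..n. [:of_int (4 * int m - 1), 1:] * [:of_int (4 * int m - 3), 1:] :: rat poly) ^ b) \<le> (2 * n) * b"
    by (intro order_trans[OF degree_power_le] mult_le_mono1) simp
  moreover have "degree ([:of_nat (2 * n), 1:] ^ \<epsilon> :: rat poly) \<le> \<epsilon>"
    by (rule order_trans[OF degree_power_le]) simp
  ultimately show ?thesis
    unfolding num_poly_def by (intro order_trans[OF degree_mult_le]) simp
qed

text \<open>The degrees differ by at least 2b - \<epsilon> >= 3. Hence there is no polynomial part,
  and the residues sum to 0.\<close>

lemma num_poly_degree_add_2_le: "degree (num_poly n b \<epsilon>) + 2 \<le> 2 * b * card {0..n}"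
proof -
  have "2 * b * card {0..n} = 2 * n * b + 2 * b" by (simp add: algebra_simps)
  then show ?thesis using num_poly_degree b \<epsilon> by linarith
qed

lemma inj_poles: "inj_on (\<lambda>k. of_nat (4 * k) :: rat) {0..n}"
  by (auto simp: inj_on_def)

lemma quot_fps_partial_fractions:
  assumes u: "\<And>k. k \<le> n \<Longrightarrow> u + of_nat (4 * k) \<noteq> 0"
  shows "fps_nth (quot_fps n b \<epsilon> u) d =
    (\<Sum>k=0..n. \<Sum>i=1..2 * b. coeff_quot n b \<epsilon> k i * of_int (hasse_coeff i d) / (u + of_nat (4 * k)) ^ (i + d))"
proof -
  have "degree (num_poly n b \<epsilon>) < 2 * b * card {0..n}" using num_poly_degree_add_2_le by linarith
  then have "taylor u (num_poly n b \<epsilon>) * inverse (\<Prod>k\<in>{0..n}. shift_fps (u + of_nat (4 * k)) ^ (2 * b)) =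
      (\<Sum>k\<in>{0..n}. \<Sum>i=1..2 * b. fps_const (coeff_quot n b \<epsilon> k i) * inverse (shift_fps (u + of_nat (4 * k))) ^ i)"
    unfolding coeff_quot_def by (intro partial_fractions_fps inj_poles) (use u in auto)
  then have "quot_fps n b \<epsilon> u = (\<Sum>k\<in>{0..n}. \<Sum>i=1..2 * b. fps_const (coeff_quot n b \<epsilon> k i) * inverse (shift_fps (u + of_nat (4 * k))) ^ i)"
    by (simp only: quot_fps_def den_fps_def taylor_num_poly prod_power_distrib)
  then have "fps_nth (quot_fps n b \<epsilon> u) d = (\<Sum>k\<in>{0..n}. \<Sum>i=1..2 * b. coeff_quot n b \<epsilon> k i * fps_nth (inverse (shift_fps (u + of_nat (4 * k))) ^ i) d)"
    by (simp add: fps_sum_nth)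
  also have "\<dots> = (\<Sum>k=0..n. \<Sum>i=1..2 * b. coeff_quot n b \<epsilon> k i * of_int (hasse_coeff i d) / (u + of_nat (4 * k)) ^ (i + d))"
    using u by (intro sum.cong refl) (simp add: inverse_shift_power_nth)
  finally show ?thesis .
qed

lemma coeff_quot_residues: "(\<Sum>k=0..n. coeff_quot n b \<epsilon> k 1) = 0"
  unfolding coeff_quot_def
  by (rule sum_residues_eq_0) (use inj_poles num_poly_degree_add_2_le b in auto)

text \<open>At u = 1-4m the factor u + 4m - 1 of the numerator vanishes, and it occurs to the power
  b.\<close>

lemma quot_fps_vanish:
  assumes m: "m \<in> {1..n}"
  shows "fps_nth (quot_fps n b \<epsilon> (1 - 4 * of_nat m)) (b - 1) = 0"
proof -
  define f where "f m' = shift_fps (1 - 4 * of_nat m + of_int (4 * int m' - 1)) *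
      shift_fps (1 - 4 * of_nat m + of_int (4 * int m' - 3))" for m'
  have "shift_fps (1 - 4 * of_nat m + of_int (4 * int m - 1)) = fps_X" by simp
  then have "fps_X dvd f m" unfolding f_def by (simp only: dvd_triv_left)
  also have "f m dvd (\<Prod>m'=1..n. f m')" using m by (intro dvd_prodI) auto
  finally have "fps_X ^ b dvd (\<Prod>m'=1..n. f m') ^ b" by (rule dvd_power_same)
  then have "fps_X ^ b dvd quot_fps n b \<epsilon> (1 - 4 * of_nat m)"
    unfolding quot_fps_def num_fps_def f_def by (intro dvd_mult2)
  then show ?thesis using b unfolding fps_X_power_dvd_iff by simp
qed

lemma tail_part_sum:
  assumes m: "m \<in> {1..n}"
  shows "(\<Sum>k=0..n. tail_part n b \<epsilon> m k) = 0"
proof -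
  have e: "1 - 4 * of_nat m + of_nat (4 * k) = (of_int (4 * (int k - int m) + 1) :: rat)" for k by simp
  have nz: "1 - 4 * of_nat m + of_nat (4 * k) \<noteq> (0 :: rat)" for k
    unfolding e of_int_eq_0_iff by presburger
  have "fps_nth (quot_fps n b \<epsilon> (1 - 4 * of_nat m)) (b - 1) = (\<Sum>k=0..n. tail_part n b \<epsilon> m k)"
    unfolding tail_part_def e[symmetric] by (rule quot_fps_partial_fractions) (rule nz)
  then show ?thesis using quot_fps_vanish[OF m] by simp
qed

lemma multiplier_split:
  assumes i: "i \<in> {1..2 * b}"
  shows "multiplier n b * (coeff_quot n b \<epsilon> k i * x / y ^ (i + (b - 1))) =
    2 ^ (6 * n * b + 4 * b) * (((fact n ^ 2 * of_nat (lcm_upto (2 * n)) / (fact (2 * n) * of_nat (lcm_upto n))) ^ b *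
      of_nat (lcm_upto n) ^ (2 * b - i) * coeff_quot n b \<epsilon> k i) * x * (of_nat (lcm_upto n) / y) ^ (i + (b - 1)))"
proof -
  have "3 * b - 1 = (2 * b - i) + (i + (b - 1))" using i b by auto
  then show ?thesis unfolding multiplier_def by (simp only: multiplier_split_aux)
qed

lemma multiplier_odd_local:
  assumes p: "prime p" "odd p" and k: "k \<le> n" and i: "i \<in> {1..2 * b}"
    and x: "x \<in> local_int p" and y: "of_nat (lcm_upto n) / y \<in> local_int p"
  shows "multiplier n b * (coeff_quot n b \<epsilon> k i * x / y ^ (i + (b - 1))) \<in> local_int p"
proof -
  have two: "2 ^ (6 * n * b + 4 * b) \<in> local_int p"
    using local_int_of_int[OF p(1), of "2 ^ (6 * n * b + 4 * b)"] by simp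
  have c: "(fact n ^ 2 * of_nat (lcm_upto (2 * n)) / (fact (2 * n) * of_nat (lcm_upto n))) ^ b *
      of_nat (lcm_upto n) ^ (2 * b - i) * coeff_quot n b \<epsilon> k i \<in> local_int p"
    by (rule coeff_quot_local[OF p(1) local_int_of_nat[OF p(1)] local_block_scaled_odd[OF p n k]])
  show ?thesis
    unfolding multiplier_split[OF i]
    by (rule local_int_mult[OF p(1) two local_int_mult[OF p(1) local_int_mult[OF p(1) c x] local_int_power[OF p(1) y]]])
qed

lemma multiplier_coeff_odd:
  assumes p: "prime p" "odd p" and k: "k \<le> n" and i: "i \<in> {1..2 * b}"
  shows "multiplier n b * coeff_quot n b \<epsilon> k i \<in> local_int p"
proof -
  have one: "1 \<in> local_int p" "of_nat (lcm_upto n) / 1 \<in> local_int p"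
    using local_int_of_int[OF p(1), of 1] local_int_of_nat[OF p(1), of "lcm_upto n"] by simp_all
  show ?thesis
    using multiplier_odd_local[OF p k i one] by (simp only: power_one div_by_1 mult_1_right)
qed

lemma multiplier_coeff_2:
  assumes k: "k \<le> n" and i: "i \<in> {1..2 * b}" and x: "x \<in> local_int 2" and y: "1 / y \<in> local_int 2"
  shows "multiplier n b * (coeff_quot n b \<epsilon> k i * x / y ^ (i + (b - 1))) \<in> local_int 2"
proof -
  note p = two_is_prime_nat
  let ?d = "of_nat (lcm_upto n) :: rat"
  obtain z where z: "lcm_upto (2 * n) = lcm_upto n * z"
    using lcm_upto_dvd_mono[of n "2 * n"] by (auto elim: dvdE)
  have d: "?d \<noteq> 0" using lcm_upto_pos[of n] by simp
  \<comment> \<open>How the power of 2 in \<open>multiplier\<close> is spent: 2^(2n) against (2n)!,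
    16^n against the factors 4 in the distances of the poles, 4^(2b-i) for the scale 4 d_n; the
    factor 4^i is left over.\<close>
  have e1: "(2 :: rat) ^ (6 * n * b + 4 * b) = ((2 ^ (2 * n) * 16 ^ n) ^ b) * (4 ^ (2 * b - i) * 4 ^ i)"
  proof -
    have "(4 :: rat) ^ (2 * b - i) * 4 ^ i = 4 ^ (2 * b)" using i by (simp flip: power_add)
    also have "\<dots> = 2 ^ (4 * b)" by (simp add: power_mult)
    moreover have "(2 :: rat) ^ (6 * n * b) = (2 ^ (2 * n) * 2 ^ (4 * n)) ^ b"
      by (simp add: power_mult[symmetric] power_add[symmetric])
    ultimately show ?thesis by (simp add: power_add power_mult)
  qed
  have e2: "fact n ^ 2 * of_nat (lcm_upto (2 * n)) / (fact (2 * n) * ?d) = fact n ^ 2 * of_nat z / fact (2 * n)"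
    using d by (simp add: z)
  have "multiplier n b * (coeff_quot n b \<epsilon> k i * x / y ^ (i + (b - 1))) =
      ((2 ^ (2 * n) / fact (2 * n)) ^ b * of_nat z ^ b * 4 ^ i * ?d ^ (i + (b - 1))) *
      ((16 ^ n * fact n ^ 2) ^ b * (4 * ?d) ^ (2 * b - i) * coeff_quot n b \<epsilon> k i) * x * (1 / y) ^ (i + (b - 1))"
    unfolding multiplier_split[OF i] e1 e2 by (rule multiplier_regroup)
  moreover have "(2 ^ (2 * n) / fact (2 * n)) ^ b * of_nat z ^ b * 4 ^ i * ?d ^ (i + (b - 1)) \<in> local_int 2"
    using local_int_of_int[OF p, of 4] by (intro local_int_mult[OF p] local_int_power[OF p] two_power_fact_local local_int_of_nat[OF p]) simp
  moreover have "4 * ?d \<in> local_int 2" using local_int_of_nat[OF p, of "4 * lcm_upto n"] by simp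
  then have "(16 ^ n * fact n ^ 2) ^ b * (4 * ?d) ^ (2 * b - i) * coeff_quot n b \<epsilon> k i \<in> local_int 2"
    by (rule coeff_quot_local[OF p _ local_block_scaled_2[OF k]])
  ultimately show ?thesis
    by (simp only: local_int_mult[OF p] x local_int_power[OF p y])
qed

lemma multiplier_coeff_Ints:
  assumes k: "k \<le> n" and i: "i \<in> {1..2 * b}"
  shows "multiplier n b * coeff_quot n b \<epsilon> k i \<in> \<int>"
proof (rule local_int_Ints)
  fix p :: nat assume p: "prime p"
  show "multiplier n b * coeff_quot n b \<epsilon> k i \<in> local_int p"
  proof (cases "p = 2")
    case True
    have one: "1 \<in> local_int 2" "1 / 1 \<in> local_int 2" using local_int_of_int[OF two_is_prime_nat, of 1] by simp_all
    show ?thesis unfolding True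
      using multiplier_coeff_2[OF k i one] by (simp only: power_one div_by_1 mult_1_right)
  next
    case False
    then have "odd p" using p prime_ge_2_nat[OF p] by (intro prime_odd_nat) auto
    then show ?thesis using multiplier_coeff_odd[OF p _ k i] by blast
  qed
qed

text \<open>At an odd prime only one index \<open>k\<close> can contribute a power of \<open>p\<close> exceeding \<open>lcm_upto n\<close>; if
  it occurs in the truncated sum, replace that sum by minus the complementary one.\<close>

lemma multiplier_tail_Ints:
  assumes m: "m \<in> {1..n}"
  shows "multiplier n b * (\<Sum>k=m..n. tail_part n b \<epsilon> m k) \<in> \<int>"
proof (rule local_int_Ints)
  fix p :: nat assume p: "prime p"
  let ?N = "\<lambda>k. 4 * (int k - int m) + 1"
  show "multiplier n b * (\<Sum>k=m..n. tail_part n b \<epsilon> m k) \<in> local_int p"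
  proof (cases "p = 2")
    case True
    have "multiplier n b * tail_part n b \<epsilon> m k \<in> local_int 2" if "k \<in> {m..n}" for k
    proof -
      have "1 / of_int (?N k) \<in> local_int 2"
        using local_int_fraction[of 2 "?N k" 1] by simp
      then show ?thesis
        unfolding tail_part_def sum_distrib_left using that
        by (intro local_int_sum[OF two_is_prime_nat] multiplier_coeff_2 local_int_of_int[OF two_is_prime_nat]) auto
    qed
    then show ?thesis unfolding True sum_distrib_left by (intro local_int_sum[OF two_is_prime_nat])
  next
    case False
    then have odd: "odd p" using p prime_ge_2_nat[OF p] by (intro prime_odd_nat) auto
    obtain E where E: "p ^ E \<le> n" "n < p ^ Suc E" using ex_power_ivl1[OF prime_ge_2_nat[OF p] n] by auto
    have nz: "?N k \<noteq> 0" for k by presburger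
    have good: "multiplier n b * tail_part n b \<epsilon> m k \<in> local_int p" if k: "k \<le> n" and nd: "\<not> int p ^ Suc E dvd ?N k" for k
    proof -
      have "multiplicity (int p) (?N k) < Suc E" using nz nd p by (intro multiplicity_lessI) (auto simp: prime_nat_iff)
      then have "multiplicity (int p) (?N k) \<le> multiplicity (int p) (int (lcm_upto n))"
        using multiplicity_lcm_upto[OF p E] by simp
      then have y: "of_nat (lcm_upto n) / of_int (?N k) \<in> local_int p"
        using local_int_divide_mult[OF p nz, of k "int (lcm_upto n)"] by simp
      show ?thesis
        unfolding tail_part_def sum_distrib_left
      proof (rule local_int_sum[OF p])
        fix i assume i: "i \<in> {1..2 * b}"
        show "multiplier n b * (coeff_quot n b \<epsilon> k i * of_int (hasse_coeff i (b - 1)) / of_int (?N k) ^ (i + (b - 1))) \<in> local_int p"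
          by (rule multiplier_odd_local[OF p odd k i local_int_of_int[OF p] y])
      qed
    qed
    show ?thesis
    proof (cases "\<exists>k\<in>{m..n}. int p ^ Suc E dvd ?N k")
      case False
      then show ?thesis unfolding sum_distrib_left by (intro local_int_sum[OF p] good) auto
    next
      case True
      then obtain k0 where k0: "k0 \<in> {m..n}" "int p ^ Suc E dvd ?N k0" by blast
      \<comment> \<open>Two such indices would differ by at most n < p^(E+1), although 4 is
        invertible modulo \<open>p\<close>.\<close>
      have uniq: "\<not> int p ^ Suc E dvd ?N k" if "k < m" for k
      proof
        assume "int p ^ Suc E dvd ?N k"
        then have "int p ^ Suc E dvd ?N k0 - ?N k" by (intro dvd_diff k0(2))
        moreover have "?N k0 - ?N k = 2 ^ 2 * (int k0 - int k)" by simp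
        ultimately have "int p ^ Suc E dvd 2 ^ 2 * (int k0 - int k)" by (simp only:)
        moreover have "coprime (int p) 2" using odd by (metis coprime_commute coprime_left_2_iff_odd even_of_nat)
        then have "coprime (int p ^ Suc E) (2 ^ 2)"
          by (simp only: coprime_power_left_iff coprime_power_right_iff simp_thms)
        ultimately have "int p ^ Suc E dvd int k0 - int k" by (simp only: coprime_dvd_mult_right_iff)
        then have "int p ^ Suc E \<le> int k0 - int k" using k0(1) that by (intro zdvd_imp_le) auto
        moreover have "int k0 - int k \<le> int n" using k0(1) by simp
        ultimately have "int (p ^ Suc E) \<le> int n" unfolding of_nat_power by linarith
        then show False using E(2) by linarith
      qed
      have split: "{0..n} = {0..<m} \<union> {m..n}" using m by auto
      have "(\<Sum>k=0..n. tail_part n b \<epsilon> m k) = (\<Sum>k=0..<m. tail_part n b \<epsilon> m k) + (\<Sum>k=m..n. tail_part n b \<epsilon> m k)"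
        unfolding split by (rule sum.union_disjoint) auto
      then have "(\<Sum>k=m..n. tail_part n b \<epsilon> m k) = - (\<Sum>k=0..<m. tail_part n b \<epsilon> m k)"
        using tail_part_sum[OF m] by simp
      then have "multiplier n b * (\<Sum>k=m..n. tail_part n b \<epsilon> m k) = - (\<Sum>k=0..<m. multiplier n b * tail_part n b \<epsilon> m k)"
        by (simp add: sum_distrib_left)
      also have "\<dots> \<in> local_int p"
        using m by (intro local_int_uminus[OF p] local_int_sum[OF p] good uniq) auto
      finally show ?thesis .
    qed
  qed
qed

end

section \<open>Symmetry and size of the partial fraction coefficients\<close>

lemma shift_fps_reflect: "shift_fps a oo (- fps_X) = - shift_fps (- a)"
  by (simp add: shift_fps_def fps_compose_add_distrib fps_compose_uminus fps_const_neg[symmetric] del: fps_const_neg)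

lemma local_block_odd:
  "local_block n k = (\<Prod>t<2 * n. shift_fps (of_int (2 * int t + (1 - 4 * int k)))) *
     (\<Prod>j\<in>{0..n} - {k}. inverse (shift_fps (of_int (4 * (int j - int k))))) ^ 2"
  unfolding local_block_def odd_block_reindex[of "\<lambda>x. shift_fps (of_int x)"] ..

text \<open>The reflection u -> -4n-u exchanges the poles -4k and -4(n-k) and permutes the linear
  factors up to sign. The signs cancel: the numerator has 2n factors, and the denominator is
  squared.\<close>

lemma local_block_reflect:
  assumes k: "k \<le> n"
  shows "local_block n (n - k) oo (- fps_X) = local_block n k"
proof -
  have X0: "fps_nth (- fps_X :: rat fps) 0 = 0" by simp
  have "(\<Prod>t<2 * n. shift_fps (of_int (2 * int t + (1 - 4 * int (n - k)))) oo (- fps_X)) =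
      (\<Prod>t<2 * n. - shift_fps (of_int (2 * int (2 * n - Suc t) + (1 - 4 * int k))))"
  proof (rule prod.cong[OF refl])
    fix t assume "t \<in> {..<2 * n}"
    then have "- (2 * int t + (1 - 4 * int (n - k))) = 2 * int (2 * n - Suc t) + (1 - 4 * int k)" using k by auto
    then show "shift_fps (of_int (2 * int t + (1 - 4 * int (n - k)))) oo (- fps_X) =
        - shift_fps (of_int (2 * int (2 * n - Suc t) + (1 - 4 * int k)))"
      unfolding shift_fps_reflect by (simp only: of_int_minus[symmetric])
  qed
  also have "\<dots> = (\<Prod>t<2 * n. shift_fps (of_int (2 * int (2 * n - Suc t) + (1 - 4 * int k))))"
    by (subst prod_uminus) simp
  also have "\<dots> = (\<Prod>t<2 * n. shift_fps (of_int (2 * int t + (1 - 4 * int k))))"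
    by (rule prod.nat_diff_reindex)
  finally have num: "(\<Prod>t<2 * n. shift_fps (of_int (2 * int t + (1 - 4 * int (n - k)))) oo (- fps_X)) =
      (\<Prod>t<2 * n. shift_fps (of_int (2 * int t + (1 - 4 * int k))))" .
  have "(\<Prod>j\<in>{0..n} - {n - k}. inverse (shift_fps (of_int (4 * (int j - int (n - k))))) oo (- fps_X)) =
      (\<Prod>j\<in>{0..n} - {n - k}. - inverse (shift_fps (of_int (4 * (int (n - j) - int k)))))"
  proof (rule prod.cong[OF refl])
    fix j assume j: "j \<in> {0..n} - {n - k}"
    have nz: "fps_nth (shift_fps (of_int (4 * (int j - int (n - k))))) 0 \<noteq> 0" using j by simp
    have "inverse (shift_fps (of_int (4 * (int j - int (n - k))))) oo (- fps_X) =
        inverse (- shift_fps (- of_int (4 * (int j - int (n - k)))))"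
      unfolding fps_inverse_compose[OF X0 nz] shift_fps_reflect ..
    also have "- of_int (4 * (int j - int (n - k))) = (of_int (4 * (int (n - j) - int k)) :: rat)"
      using j k by (simp only: of_int_minus[symmetric] of_int_eq_iff) auto
    finally show "inverse (shift_fps (of_int (4 * (int j - int (n - k))))) oo (- fps_X) =
        - inverse (shift_fps (of_int (4 * (int (n - j) - int k))))"
      by (simp only: fps_inverse_minus)
  qed
  also have "\<dots> = (- 1) ^ n * (\<Prod>j\<in>{0..n} - {n - k}. inverse (shift_fps (of_int (4 * (int (n - j) - int k)))))"
    by (subst prod_uminus) (simp add: card_Diff_singleton)
  also have "(\<Prod>j\<in>{0..n} - {n - k}. inverse (shift_fps (of_int (4 * (int (n - j) - int k))))) =
      (\<Prod>j\<in>{0..n} - {k}. inverse (shift_fps (of_int (4 * (int j - int k)))))"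
    by (rule prod.reindex_bij_witness[of _ "\<lambda>j. n - j" "\<lambda>j. n - j"]) (use k in auto)
  finally have den: "(\<Prod>j\<in>{0..n} - {n - k}. inverse (shift_fps (of_int (4 * (int j - int (n - k))))) oo (- fps_X)) =
      (- 1) ^ n * (\<Prod>j\<in>{0..n} - {k}. inverse (shift_fps (of_int (4 * (int j - int k)))))" .
  have sq: "((- 1) ^ n * f) ^ 2 = f ^ 2" for f :: "rat fps"
    by (simp add: power_mult_distrib flip: power_mult)
  show ?thesis
    unfolding local_block_odd fps_compose_mult_distrib[OF X0] fps_compose_power[OF X0, symmetric]
      fps_compose_prod_distrib[OF X0] num den sq ..
qed

text \<open>The block is symmetric, so the sign comes only from the factor (u+2n)^\<epsilon>, which
  is odd under the reflection if \<epsilon> = 1, and from the power X^(2b-i).\<close>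

lemma coeff_quot_reflect:
  assumes k: "k \<le> n" and i: "i \<le> 2 * b"
  shows "coeff_quot n b \<epsilon> (n - k) i = (- 1) ^ (i + \<epsilon>) * coeff_quot n b \<epsilon> k i"
proof -
  have X0: "fps_nth (- fps_X :: rat fps) 0 = 0" by simp
  define h where "h k = local_block n k ^ b * shift_fps (of_int (2 * int n - 4 * int k)) ^ \<epsilon>" for k
  have "- of_int (2 * int n - 4 * int (n - k)) = (of_int (2 * int n - 4 * int k) :: rat)"
    using k by (simp only: of_int_minus[symmetric] of_int_eq_iff)
  then have "h (n - k) oo (- fps_X) = local_block n k ^ b * (- shift_fps (of_int (2 * int n - 4 * int k))) ^ \<epsilon>"
    unfolding h_def fps_compose_mult_distrib[OF X0] fps_compose_power[OF X0, symmetric] local_block_reflect[OF k] shift_fps_reflect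
    by (simp only:)
  also have "\<dots> = fps_const ((- 1) ^ \<epsilon>) * h k"
    unfolding power_minus[of "shift_fps _"] h_def by (simp add: fps_const_power[symmetric] mult.left_commute del: fps_const_power)
  finally have eq: "h (n - k) oo (- fps_X) = fps_const ((- 1) ^ \<epsilon>) * h k" .
  have "fps_nth (h (n - k) oo (fps_const (- 1) * fps_X)) (2 * b - i) = (- 1) ^ (2 * b - i) * fps_nth (h (n - k)) (2 * b - i)"
    by (simp only: fps_compose_linear fps_nth_Abs_fps)
  moreover have "fps_const (- 1) * fps_X = (- fps_X :: rat fps)" by (simp add: fps_const_neg[symmetric] del: fps_const_neg)
  ultimately have "(- 1) ^ (2 * b - i) * fps_nth (h (n - k)) (2 * b - i) = (- 1) ^ \<epsilon> * fps_nth (h k) (2 * b - i)"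
    using eq by simp
  moreover have "(- 1 :: rat) ^ (2 * b - i) = (- 1) ^ i"
    using i by (simp add: minus_one_power_iff)
  ultimately have "(- 1) ^ i * ((- 1) ^ i * coeff_quot n b \<epsilon> (n - k) i) = (- 1) ^ i * ((- 1) ^ \<epsilon> * coeff_quot n b \<epsilon> k i)"
    unfolding coeff_quot_block h_def by simp
  then show ?thesis by (simp add: power_add mult.assoc[symmetric] power_mult_distrib[symmetric])
qed

lemma coeff_quot_parity:
  assumes i: "i \<le> 2 * b" and odd: "odd (i + \<epsilon>)"
  shows "(\<Sum>k=0..n. coeff_quot n b \<epsilon> k i) = 0"
proof -
  have "(\<Sum>k=0..n. coeff_quot n b \<epsilon> k i) = (\<Sum>k=0..n. coeff_quot n b \<epsilon> (n - k) i)"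
    by (rule sum.reindex_bij_witness[of _ "\<lambda>k. n - k" "\<lambda>k. n - k"]) auto
  also have "\<dots> = (\<Sum>k=0..n. - coeff_quot n b \<epsilon> k i)"
    by (intro sum.cong refl, subst coeff_quot_reflect) (use i odd in auto)
  finally show ?thesis by (simp add: sum_negf)
qed

section \<open>Archimedean bounds for the coefficients\<close>

text \<open>The bounds add under multiplication, by the binomial theorem. As coefficients are needed
  only up to the index 2b with b fixed, a bound s linear in n yields coefficients polynomial in
  n.\<close>

definition exp_bounded :: "nat \<Rightarrow> rat fps set" where
  "exp_bounded s = {h. \<forall>e. \<bar>fps_nth h e\<bar> \<le> of_nat s ^ e}"

lemma exp_bounded_mult:
  assumes "g \<in> exp_bounded s" "h \<in> exp_bounded t"
  shows "g * h \<in> exp_bounded (s + t)"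
  unfolding exp_bounded_def
proof (intro CollectI allI)
  fix e
  have "\<bar>fps_nth (g * h) e\<bar> \<le> (\<Sum>i\<le>e. \<bar>fps_nth g i\<bar> * \<bar>fps_nth h (e - i)\<bar>)"
    unfolding fps_mult_nth atMost_atLeast0 abs_mult[symmetric] by (rule sum_abs)
  also have "\<dots> \<le> (\<Sum>i\<le>e. of_nat (e choose i) * of_nat s ^ i * of_nat t ^ (e - i))"
  proof (rule sum_mono)
    fix i assume i: "i \<in> {..e}"
    have "\<bar>fps_nth g i\<bar> * \<bar>fps_nth h (e - i)\<bar> \<le> of_nat s ^ i * of_nat t ^ (e - i)"
      using assms by (intro mult_mono) (auto simp: exp_bounded_def)
    also have "\<dots> \<le> of_nat (e choose i) * (of_nat s ^ i * of_nat t ^ (e - i))"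
    proof -
      have "1 \<le> e choose i" using i by (simp add: Suc_leI)
      then have "(1 :: rat) \<le> of_nat (e choose i)" by (metis of_nat_1 of_nat_le_iff)
      then show ?thesis
        using mult_right_mono[of 1 "of_nat (e choose i)" "of_nat s ^ i * of_nat t ^ (e - i) :: rat"] by simp
    qed
    finally show "\<bar>fps_nth g i\<bar> * \<bar>fps_nth h (e - i)\<bar> \<le> of_nat (e choose i) * of_nat s ^ i * of_nat t ^ (e - i)"
      by (simp only: mult.assoc)
  qed
  also have "\<dots> = (of_nat s + of_nat t) ^ e" by (rule binomial_ring[symmetric])
  finally show "\<bar>fps_nth (g * h) e\<bar> \<le> of_nat (s + t) ^ e" by simp
qed

lemma exp_bounded_1: "1 \<in> exp_bounded 0"
  by (auto simp: exp_bounded_def)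

lemma exp_bounded_prod:
  "finite A \<Longrightarrow> (\<And>i. i \<in> A \<Longrightarrow> f i \<in> exp_bounded s) \<Longrightarrow> (\<Prod>i\<in>A. f i) \<in> exp_bounded (card A * s)"
  by (induction A rule: finite_induct) (auto simp: exp_bounded_1 intro: exp_bounded_mult)

lemma exp_bounded_power: "f \<in> exp_bounded s \<Longrightarrow> f ^ m \<in> exp_bounded (m * s)"
  by (induction m) (auto simp: exp_bounded_1 intro: exp_bounded_mult)

lemma exp_bounded_shift:
  fixes x :: int
  assumes "x \<noteq> 0"
  shows "fps_const (1 / of_int x) * shift_fps (of_int x) \<in> exp_bounded 1"
proof -
  have "\<bar>1 / of_int x :: rat\<bar> \<le> 1" using assms by (simp add: abs_divide divide_le_eq flip: of_int_abs)
  then have "\<bar>fps_nth (fps_const (1 / of_int x) * shift_fps (of_int x)) e\<bar> \<le> 1" for e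
    using assms by (cases "e = 0"; cases "e = 1") (auto simp: shift_fps_def)
  then show ?thesis by (simp add: exp_bounded_def)
qed

lemma exp_bounded_inverse_shift:
  fixes x :: int
  assumes "x \<noteq> 0"
  shows "fps_const (of_int x) * inverse (shift_fps (of_int x)) \<in> exp_bounded 1"
proof -
  have x: "\<bar>1 / of_int x :: rat\<bar> \<le> 1" using assms by (simp add: abs_divide divide_le_eq flip: of_int_abs)
  have "shift_fps (of_int x) = fps_const (of_int x) + fps_const 1 * fps_X" by (simp add: shift_fps_def)
  then have inv: "inverse (shift_fps (of_int x)) = Abs_fps (\<lambda>k. (- 1) ^ k / of_int x ^ Suc k)"
    using inverse_linear_fps[of "of_int x :: rat" 1] assms by simp
  have "\<bar>fps_nth (fps_const (of_int x) * inverse (shift_fps (of_int x))) e\<bar> = \<bar>1 / of_int x :: rat\<bar> ^ e" for e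
    using assms by (simp add: inv abs_divide abs_mult power_abs power_divide)
  then show ?thesis using power_le_one[OF abs_ge_zero x] by (simp add: exp_bounded_def)
qed

text \<open>Each pair (4m-1-4k)(4m-3-4k) has the form (4i+1)(4i+3) <= (4(i+1))^2, and as m varies
  i+1 runs through 1, ..., k and 1, ..., n-k. The right-hand side is the square of
  \<open>pole_prod\<close>, so the block has constant term at most 1 in absolute value.\<close>

lemma odd_block_le:
  assumes k: "k \<le> n"
  shows "\<bar>\<Prod>t<2 * n. 2 * int t + (1 - 4 * int k)\<bar> \<le> (4 ^ n * fact k * fact (n - k)) ^ 2"
proof -
  define c where "c m = (if m \<le> k then int k - int m + 1 else int m - int k)" for m
  have "\<bar>\<Prod>t<2 * n. 2 * int t + (1 - 4 * int k)\<bar> = (\<Prod>m=1..n. \<bar>(4 * int m - 1 - 4 * int k) * (4 * int m - 3 - 4 * int k)\<bar>)"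
    unfolding odd_block_reindex[of "\<lambda>x. x", symmetric] abs_prod ..
  also have "\<dots> \<le> (\<Prod>m=1..n. (4 * c m) ^ 2)"
  proof (rule prod_mono)
    fix m assume m: "m \<in> {1..n}"
    have "(4 * int m - 1 - 4 * int k) * (4 * int m - 3 - 4 * int k) \<le> (4 * c m) ^ 2 \<and>
        0 \<le> (4 * int m - 1 - 4 * int k) * (4 * int m - 3 - 4 * int k)"
    proof (cases "m \<le> k")
      case True
      then obtain i where i: "k = m + i" using le_Suc_ex by blast
      show ?thesis unfolding c_def i by (simp add: algebra_simps power2_eq_square)
    next
      case False
      then obtain i where i: "m = Suc (k + i)" using less_imp_Suc_add not_le by blast
      show ?thesis unfolding c_def i by (simp add: algebra_simps power2_eq_square)
    qed
    then show "0 \<le> \<bar>(4 * int m - 1 - 4 * int k) * (4 * int m - 3 - 4 * int k)\<bar> \<and>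
        \<bar>(4 * int m - 1 - 4 * int k) * (4 * int m - 3 - 4 * int k)\<bar> \<le> (4 * c m) ^ 2" by simp
  qed
  also have "\<dots> = (4 ^ n * (\<Prod>m=1..n. c m)) ^ 2"
    unfolding prod_power_distrib[symmetric] by (simp add: prod.distrib)
  also have "(\<Prod>m=1..n. c m) = fact k * fact (n - k)"
  proof -
    have split: "{1..n} = {1..k} \<union> {k<..n}" using k by auto
    have "(\<Prod>m=1..n. c m) = (\<Prod>m=1..k. c m) * (\<Prod>m\<in>{k<..n}. c m)"
      unfolding split by (rule prod.union_disjoint) auto
    also have "(\<Prod>m=1..k. c m) = (\<Prod>i=1..k. int i)"
      by (rule prod.reindex_bij_witness[of _ "\<lambda>i. Suc k - i" "\<lambda>m. Suc k - m"]) (auto simp: c_def)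
    also have "(\<Prod>m\<in>{k<..n}. c m) = (\<Prod>i=1..n - k. int i)"
      by (rule prod.reindex_bij_witness[of _ "\<lambda>i. i + k" "\<lambda>m. m - k"]) (auto simp: c_def)
    finally show ?thesis by (simp add: fact_prod)
  qed
  finally show ?thesis by (simp add: mult.assoc)
qed

text \<open>After normalization the block consists of 2n numerators and 2n inverse linear factors,
  each in \<open>exp_bounded 1\<close>, which gives 4 n b for the b-th power. The factor 2n+1
  accounts for (u+2n)^\<epsilon>, whose constant term is at most 2n in absolute value.\<close>

lemma coeff_quot_bound:
  assumes k: "k \<le> n" and n: "n \<ge> 1" and b: "b \<ge> 1" and \<epsilon>: "\<epsilon> \<le> 1"
  shows "\<bar>coeff_quot n b \<epsilon> k i\<bar> \<le> of_nat ((2 * n + 1) * (4 * n * b) ^ (2 * b))"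
proof -
  let ?N = "\<lambda>t. 2 * int t + (1 - 4 * int k)"
  define S where "S = 4 * n * b"
  define \<kappa> :: rat where "\<kappa> = of_int (\<Prod>t<2 * n. ?N t) / pole_prod n k ^ 2"
  define h where "h = (\<Prod>t<2 * n. fps_const (1 / of_int (?N t)) * shift_fps (of_int (?N t))) *
     (\<Prod>j\<in>{0..n} - {k}. fps_const (of_int (4 * (int j - int k))) * inverse (shift_fps (of_int (4 * (int j - int k))))) ^ 2"
  have nz: "?N t \<noteq> 0" for t by presburger
  have "h \<in> exp_bounded (card {..<2 * n} * 1 + 2 * (card ({0..n} - {k}) * 1))"
    unfolding h_def
    by (intro exp_bounded_mult exp_bounded_power exp_bounded_prod exp_bounded_shift exp_bounded_inverse_shift nz) auto
  then have "h \<in> exp_bounded (4 * n)" using k by (simp add: card_Diff_singleton)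
  then have hb: "h ^ b \<in> exp_bounded S" using exp_bounded_power[of h "4 * n" b] by (simp add: S_def mult.commute)
  have P0: "pole_prod n k \<noteq> 0" by (simp add: pole_prod_def)
  have prodinv: "(\<Prod>t<2 * n. 1 / of_int (?N t)) = (1 / of_int (\<Prod>t<2 * n. ?N t) :: rat)"
    by (simp only: of_int_prod prod_dividef prod.neutral_const)
  have nzp: "of_int (\<Prod>t<2 * n. ?N t) \<noteq> (0 :: rat)"
    using nz by (simp only: of_int_eq_0_iff prod_zero_iff finite_lessThan) blast
  have one: "\<kappa> * (1 / of_int (\<Prod>t<2 * n. ?N t)) * pole_prod n k ^ 2 = 1"
    unfolding \<kappa>_def using P0 nzp by simp
  have two: "fps_const \<kappa> * h = fps_const (\<kappa> * (1 / of_int (\<Prod>t<2 * n. ?N t)) * pole_prod n k ^ 2) * local_block n k"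
    unfolding h_def local_block_odd prod.distrib fps_const_prod[symmetric] prodinv pole_prod_def[symmetric]
    by (simp only: fps_const_mult[symmetric] fps_const_power[symmetric] power_mult_distrib mult.assoc mult.commute mult.left_commute)
  have block: "local_block n k = fps_const \<kappa> * h" using two unfolding one by simp
  have \<kappa>: "\<bar>\<kappa>\<bar> \<le> 1"
  proof -
    have "pole_prod n k ^ 2 = of_int ((4 ^ n * fact k * fact (n - k)) ^ 2)"
      unfolding pole_prod_eq[OF k] by (simp add: power_mult_distrib power_mult[symmetric] mult.commute)
    moreover have "(of_int \<bar>\<Prod>t<2 * n. ?N t\<bar> :: rat) \<le> of_int ((4 ^ n * fact k * fact (n - k)) ^ 2)"
      using odd_block_le[OF k] by (simp only: of_int_le_iff)
    ultimately have "\<bar>of_int (\<Prod>t<2 * n. ?N t)\<bar> \<le> pole_prod n k ^ 2" by (simp only: of_int_abs)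
    then show ?thesis unfolding \<kappa>_def abs_divide using P0 by (simp add: divide_le_eq)
  qed
  have h1: "\<bar>fps_nth (local_block n k ^ b) e\<bar> \<le> of_nat S ^ e" for e
  proof -
    have "\<bar>fps_nth (local_block n k ^ b) e\<bar> = \<bar>\<kappa>\<bar> ^ b * \<bar>fps_nth (h ^ b) e\<bar>"
      unfolding block power_mult_distrib fps_const_power fps_mult_left_const_nth abs_mult power_abs ..
    also have "\<dots> \<le> 1 * of_nat S ^ e"
      using \<kappa> hb by (intro mult_mono power_le_one) (auto simp: exp_bounded_def)
    finally show ?thesis by simp
  qed
  have "1 \<le> S" using n b by (simp add: S_def)
  then have S1: "(1 :: rat) \<le> of_nat S" by (metis of_nat_1 of_nat_le_iff)
  have mono: "of_nat S ^ e \<le> (of_nat S :: rat) ^ (2 * b)" if "e \<le> 2 * b" for e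
    using S1 that by (intro power_increasing) auto
  have "\<bar>fps_nth (local_block n k ^ b * shift_fps (of_int (2 * int n - 4 * int k)) ^ \<epsilon>) e\<bar> \<le> (2 * of_nat n + 1) * of_nat S ^ (2 * b)"
    if e: "e \<le> 2 * b" for e
  proof (cases "\<epsilon> = 0")
    case True
    have "\<bar>fps_nth (local_block n k ^ b) e\<bar> \<le> 1 * of_nat S ^ (2 * b)" using order_trans[OF h1 mono[OF e]] by simp
    also have "\<dots> \<le> (2 * of_nat n + 1) * of_nat S ^ (2 * b)" by (intro mult_right_mono) auto
    finally show ?thesis using True by simp
  next
    case False
    then have \<epsilon>1: "\<epsilon> = 1" using \<epsilon> by simp
    define a where "a = (of_int (2 * int n - 4 * int k) :: rat)"
    have "\<bar>2 * int n - 4 * int k\<bar> \<le> 2 * int n" using k by auto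
    then have "(of_int \<bar>2 * int n - 4 * int k\<bar> :: rat) \<le> of_int (2 * int n)" by (simp only: of_int_le_iff)
    then have a: "\<bar>a\<bar> \<le> 2 * of_nat n" unfolding a_def by (simp only: of_int_abs of_int_mult of_int_numeral of_int_of_nat_eq)
    define g where "g = local_block n k ^ b"
    have g: "\<bar>fps_nth g e\<bar> \<le> of_nat S ^ (2 * b)" if "e \<le> 2 * b" for e
      unfolding g_def using order_trans[OF h1 mono[OF that]] .
    have eq: "fps_nth (g * shift_fps a) e = fps_nth g e * a + (if e = 0 then 0 else fps_nth g (e - 1))"
      by (simp add: shift_fps_def distrib_left)
    have "\<bar>fps_nth (g * shift_fps a) e\<bar> \<le> \<bar>fps_nth g e\<bar> * \<bar>a\<bar> + \<bar>if e = 0 then 0 else fps_nth g (e - 1)\<bar>"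
      unfolding eq by (metis abs_mult abs_triangle_ineq)
    also have "\<dots> \<le> of_nat S ^ (2 * b) * (2 * of_nat n) + of_nat S ^ (2 * b)"
      using a g[OF e] g[of "e - 1"] e by (intro add_mono mult_mono) auto
    finally show ?thesis unfolding \<epsilon>1 g_def a_def power_one_right by (simp only: distrib_right mult_1_left mult.commute)
  qed
  moreover have "of_nat ((2 * n + 1) * (4 * n * b) ^ (2 * b)) = (2 * of_nat n + 1) * (of_nat S :: rat) ^ (2 * b)"
    by (simp only: S_def of_nat_mult of_nat_power of_nat_add of_nat_1 of_nat_numeral)
  ultimately show ?thesis unfolding coeff_quot_block by (simp only: diff_le_self)
qed

section \<open>The limit as a linear form in zeta values\<close>

text \<open>Convergence to a rational number in the 2-adic metric. Since rationality of the zeta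
  values is assumed for contradiction, the rest of the argument can stay in
  \<open>rat\<close>.\<close>

definition tends2 :: "(nat \<Rightarrow> rat) \<Rightarrow> rat \<Rightarrow> bool" where
  "tends2 X x \<longleftrightarrow> null2 (\<lambda>n. X n - x)"

lemma tends2_const: "tends2 (\<lambda>n. c) c"
  by (simp add: tends2_def)

lemma tends2_add: "tends2 X x \<Longrightarrow> tends2 Y y \<Longrightarrow> tends2 (\<lambda>n. X n + Y n) (x + y)"
  unfolding tends2_def using null2_add[of "\<lambda>n. X n - x" "\<lambda>n. Y n - y"] by (simp add: algebra_simps)

lemma tends2_imp_cauchy2: "tends2 X x \<Longrightarrow> cauchy2 X"
  unfolding cauchy2_def
proof (intro allI impI)
  fix e :: real assume X: "tends2 X x" and e: "e > 0"
  obtain M where M: "\<And>n. n \<ge> M \<Longrightarrow> rat_abs2 (X n - x) < e"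
    using order_tendstoD(2)[OF X[unfolded tends2_def null2_def] e] by (auto simp: eventually_sequentially)
  have "rat_abs2 (X m - X n) < e" if "m \<ge> M" "n \<ge> M" for m n
    using rat_abs2_ultra[of "X m - x" "x - X n"] M[OF that(1)] M[OF that(2)] rat_abs2_diff_commute[of x "X n"] by simp
  then show "\<exists>M. \<forall>m\<ge>M. \<forall>n\<ge>M. rat_abs2 (X m - X n) < e" by blast
qed

lemma tends2_mult:
  assumes X: "tends2 X x" and Y: "tends2 Y y"
  shows "tends2 (\<lambda>n. X n * Y n) (x * y)"
proof -
  have "null2 (\<lambda>n. (X n - x) * Y n + (Y n - y) * x)"
    using X Y unfolding tends2_def
    by (intro null2_add null2_mult tends2_imp_cauchy2[OF Y] cauchy2_const) auto
  then show ?thesis by (simp add: tends2_def algebra_simps)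
qed

lemma tends2_cmult: "tends2 X x \<Longrightarrow> tends2 (\<lambda>n. c * X n) (c * x)"
  by (rule tends2_mult[OF tends2_const])

lemma tends2_sum: "(\<And>i. i \<in> A \<Longrightarrow> tends2 (X i) (x i)) \<Longrightarrow> tends2 (\<lambda>n. \<Sum>i\<in>A. X i n) (\<Sum>i\<in>A. x i)"
  by (induction A rule: infinite_finite_induct) (auto intro: tends2_add tends2_const)

lemma tends2_power: "tends2 X x \<Longrightarrow> tends2 (\<lambda>n. X n ^ k) (x ^ k)"
  by (induction k) (auto intro: tends2_mult tends2_const)

lemma tends2_rat_abs2:
  assumes "tends2 X x" "\<And>N. N \<ge> M \<Longrightarrow> rat_abs2 (X N) = c"
  shows "rat_abs2 x = c"
proof -
  have "(\<lambda>n. rat_abs2 (X n - x)) \<longlonglongrightarrow> 0" using assms(1) by (simp add: tends2_def null2_def)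
  then have "(\<lambda>n. rat_abs2 (X n) - rat_abs2 x) \<longlonglongrightarrow> 0"
    by (rule tendsto_0_le[where K = 1]) (auto simp: rat_abs2_triangle_diff)
  then have "(\<lambda>n. rat_abs2 (X n)) \<longlonglongrightarrow> rat_abs2 x" by (simp add: LIM_zero_iff)
  moreover have "(\<lambda>n. rat_abs2 (X n)) \<longlonglongrightarrow> c"
    by (rule tendsto_eventually) (use assms(2) in \<open>auto simp: eventually_sequentially\<close>)
  ultimately show ?thesis by (rule LIMSEQ_unique)
qed

section \<open>Translation of the Volkenborn integral\<close>

definition inv_pow :: "nat \<Rightarrow> nat \<Rightarrow> rat" where
  "inv_pow m t = 1 / (4 * of_nat t + 1) ^ m"

lemma odd_nonzero: "(4 * of_nat t + 1 :: rat) \<noteq> 0"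
proof -
  have "(4 * of_nat t + 1 :: rat) = of_nat (4 * t + 1)" by simp
  then show ?thesis by (simp only: of_nat_eq_0_iff)
qed

lemma rat_abs2_odd_linear: "rat_abs2 (4 * of_nat t + 1) = 1"
  using rat_abs2_odd_nat[of "4 * t + 1"] by (simp add: add.commute)

lemma inv_pow_poly_lim: "inv_pow m \<in> poly_lim 2"
proof -
  have "(\<lambda>t. inverse (1 + 4 * of_nat t) ^ m) \<in> poly_lim 2"
    by (intro poly_lim_power poly_lim_inverse) (auto simp: power2_eq_square)
  moreover have "inv_pow m = (\<lambda>t. inverse (1 + 4 * of_nat t) ^ m)"
    by (auto simp: inv_pow_def fun_eq_iff divide_inverse power_inverse add.commute)
  ultimately show ?thesis by simp
qed

text \<open>The difference quotient tends to the derivative of $(4t+1)^{-m}$.\<close>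

lemma inv_pow_difference:
  "tends2 (\<lambda>N. (inv_pow m (2 ^ N + l) - inv_pow m l) / 2 ^ N) (- 4 * of_nat m / (4 * of_nat l + 1) ^ (m + 1))"
proof -
  define x where "x = 1 / (4 * of_nat l + 1 :: rat)"
  define y where "y N = 1 / (4 * of_nat (2 ^ N + l) + 1 :: rat)" for N
  have diff: "y N - x = - 4 * 2 ^ N * (x * y N)" for N
  proof -
    have "a \<noteq> 0 \<Longrightarrow> c \<noteq> 0 \<Longrightarrow> c = a + h \<Longrightarrow> 1 / c - 1 / a = - h * (1 / a * (1 / c))" for a c h :: rat
      by (simp add: field_simps)
    from this[OF odd_nonzero[of l] odd_nonzero[of "2 ^ N + l"], of "4 * 2 ^ N"]
    show ?thesis by (simp add: x_def y_def)
  qed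
  have xy: "rat_abs2 x = 1" "rat_abs2 (y N) = 1" for N
    unfolding x_def y_def rat_abs2_divide rat_abs2_odd_linear by simp_all
  have y: "tends2 y x"
    unfolding tends2_def null2_def
  proof (rule tendsto_sandwich[OF _ _ tendsto_const])
    show "(\<lambda>N. (1 / 2 :: real) ^ N) \<longlonglongrightarrow> 0" by (rule LIMSEQ_power_zero) simp
    have "rat_abs2 (y N - x) \<le> (1 / 2) ^ N" for N
      unfolding diff by (simp add: rat_abs2_mult rat_abs2_power xy)
    then show "\<forall>\<^sub>F N in sequentially. rat_abs2 (y N - x) \<le> (1 / 2) ^ N" by simp
  qed simp
  have eq: "(inv_pow m (2 ^ N + l) - inv_pow m l) / 2 ^ N = - 4 * ((x * y N) * (\<Sum>j<m. y N ^ j * x ^ (m - Suc j)))" for N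
  proof -
    have "inv_pow m (2 ^ N + l) - inv_pow m l = y N ^ m - x ^ m"
      by (simp add: inv_pow_def x_def y_def power_one_over)
    also have "\<dots> = (y N - x) * (\<Sum>j<m. x ^ (m - Suc j) * y N ^ j)" by (rule power_diff_sumr2)
    finally show ?thesis unfolding diff by (simp add: mult.commute)
  qed
  have "tends2 (\<lambda>N. - 4 * ((x * y N) * (\<Sum>j<m. y N ^ j * x ^ (m - Suc j)))) (- 4 * ((x * x) * (\<Sum>j<m. x ^ j * x ^ (m - Suc j))))"
    by (intro tends2_mult tends2_cmult tends2_sum tends2_power y tends2_const)
  moreover have "(\<Sum>j<m. x ^ j * x ^ (m - Suc j)) = of_nat m * x ^ (m - 1)"
  proof -
    have "x ^ j * x ^ (m - Suc j) = x ^ (m - 1)" if "j < m" for j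
      using that by (simp flip: power_add)
    then show ?thesis by simp
  qed
  moreover have "- 4 * ((x * x) * (of_nat m * x ^ (m - 1))) = - 4 * of_nat m / (4 * of_nat l + 1) ^ (m + 1)"
    by (cases m) (simp_all add: x_def power_one_over)
  ultimately show ?thesis unfolding eq by simp
qed

text \<open>Telescoping in \<open>k\<close>. In the limit each difference quotient becomes a
  derivative, which is the translation formula of the Volkenborn integral.\<close>

lemma volk_sum_shift:
  "volk_sum N (\<lambda>t. F (t + k)) = volk_sum N F + (\<Sum>l<k. (F (2 ^ N + l) - F l) / 2 ^ N)"
proof (induction k)
  case (Suc k)
  have "(\<Sum>t<2 ^ N. F (t + Suc k)) + F k = (\<Sum>t<2 ^ N. F (t + k)) + F (2 ^ N + k)"
    using sum.lessThan_Suc_shift[of "\<lambda>t. F (t + k)" "2 ^ N"] by (simp add: add.commute)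
  then have "volk_sum N (\<lambda>t. F (t + Suc k)) = volk_sum N (\<lambda>t. F (t + k)) + (F (2 ^ N + k) - F k) / 2 ^ N"
    by (simp add: volk_sum_def flip: add_divide_distrib)
  then show ?case using Suc by simp
qed simp

text \<open>The derivative terms at 4l+1 for l < k, indexed by m = k-l. The factor 4 is the inner
  derivative of 4t+1, and b-1 comes from \<open>hasse_coeff_Suc\<close>.\<close>

definition rational_part :: "nat \<Rightarrow> nat \<Rightarrow> nat \<Rightarrow> rat" where
  "rational_part n b \<epsilon> = 4 * of_nat (b - 1) * (\<Sum>m=1..n. \<Sum>k=m..n. tail_part n b \<epsilon> m k)"

text \<open>As u + 4k = 4(t+k) + 1, the pole -4k contributes translates by k of the functions
  \<open>inv_pow\<close>. Undoing the translations collects the same power from all poles; the sums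
  over k then vanish for i = 1 by the residues and for the wrong parity by the reflection.\<close>

lemma volk_sum_integrand_tends:
  assumes n: "n \<ge> 1" and b: "b \<ge> 2" and \<epsilon>: "\<epsilon> \<le> 1"
    and q: "\<And>i. i \<in> {2..2 * b} \<Longrightarrow> even (i + \<epsilon>) \<Longrightarrow> tends2 (\<lambda>N. volk_sum N (inv_pow (i + (b - 2)))) (q i)"
  shows "tends2 (\<lambda>N. volk_sum N (integrand n b \<epsilon>))
    ((\<Sum>i | i \<in> {2..2 * b} \<and> even (i + \<epsilon>). of_int (hasse_coeff i (b - 2)) * (\<Sum>k=0..n. coeff_quot n b \<epsilon> k i) * q i) +
     rational_part n b \<epsilon>)"
proof -
  let ?I = "{i. i \<in> {2..2 * b} \<and> even (i + \<epsilon>)}"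
  let ?C = "coeff_quot n b \<epsilon>"
  let ?h = "\<lambda>i. of_int (hasse_coeff i (b - 2)) :: rat"
  define D where "D i l N = (inv_pow (i + (b - 2)) (2 ^ N + l) - inv_pow (i + (b - 2)) l) / 2 ^ N" for i l N
  have int: "integrand n b \<epsilon> t = (\<Sum>k=0..n. \<Sum>i=1..2 * b. (?C k i * ?h i) * inv_pow (i + (b - 2)) (t + k))" for t
  proof -
    have e: "4 * of_nat t + 1 + of_nat (4 * k) = (4 * of_nat (t + k) + 1 :: rat)" for k by simp
    have "integrand n b \<epsilon> t = (\<Sum>k=0..n. \<Sum>i=1..2 * b. ?C k i * ?h i / (4 * of_nat t + 1 + of_nat (4 * k)) ^ (i + (b - 2)))"
      unfolding integrand_def
      by (rule quot_fps_partial_fractions[OF n b \<epsilon>]) (unfold e, rule odd_nonzero)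
    then show ?thesis unfolding e by (simp add: inv_pow_def)
  qed
  have "volk_sum N (integrand n b \<epsilon>) =
      (\<Sum>k=0..n. \<Sum>i=1..2 * b. (?C k i * ?h i) * (volk_sum N (inv_pow (i + (b - 2))) + (\<Sum>l<k. D i l N)))" for N
  proof -
    have "volk_sum N (integrand n b \<epsilon>) = (\<Sum>k=0..n. \<Sum>i=1..2 * b. (?C k i * ?h i) * volk_sum N (\<lambda>t. inv_pow (i + (b - 2)) (t + k)))"
      unfolding int[abs_def] volk_sum_sum volk_sum_cmult ..
    then show ?thesis unfolding volk_sum_shift D_def .
  qed
  also have "(\<Sum>k=0..n. \<Sum>i=1..2 * b. (?C k i * ?h i) * (volk_sum N (inv_pow (i + (b - 2))) + (\<Sum>l<k. D i l N))) =
      (\<Sum>i=1..2 * b. ?h i * (\<Sum>k=0..n. ?C k i) * volk_sum N (inv_pow (i + (b - 2)))) +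
      (\<Sum>k=0..n. \<Sum>i=1..2 * b. (?C k i * ?h i) * (\<Sum>l<k. D i l N))" for N
    unfolding distrib_left sum.distrib
    by (subst sum.swap) (simp add: sum_distrib_left sum_distrib_right mult_ac)
  also have "(\<Sum>i=1..2 * b. ?h i * (\<Sum>k=0..n. ?C k i) * volk_sum N (inv_pow (i + (b - 2)))) =
      (\<Sum>i\<in>?I. ?h i * (\<Sum>k=0..n. ?C k i) * volk_sum N (inv_pow (i + (b - 2))))" for N
  proof (rule sum.mono_neutral_right)
    show "\<forall>i\<in>{1..2 * b} - ?I. ?h i * (\<Sum>k=0..n. ?C k i) * volk_sum N (inv_pow (i + (b - 2))) = 0"
    proof
      fix i assume i: "i \<in> {1..2 * b} - ?I"
      have "(\<Sum>k=0..n. ?C k i) = 0"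
      proof (cases "odd (i + \<epsilon>)")
        case True
        then show ?thesis using i by (intro coeff_quot_parity) auto
      next
        case False
        then have "i = 1" using i by auto
        then show ?thesis using coeff_quot_residues[OF n b \<epsilon>] by simp
      qed
      then show "?h i * (\<Sum>k=0..n. ?C k i) * volk_sum N (inv_pow (i + (b - 2))) = 0" by simp
    qed
  qed auto
  finally have eq: "volk_sum N (integrand n b \<epsilon>) =
      (\<Sum>i\<in>?I. ?h i * (\<Sum>k=0..n. ?C k i) * volk_sum N (inv_pow (i + (b - 2)))) +
      (\<Sum>k=0..n. \<Sum>i=1..2 * b. (?C k i * ?h i) * (\<Sum>l<k. D i l N))" for N .
  have D: "tends2 (D i l) (- 4 * of_nat (i + (b - 2)) / (4 * of_nat l + 1) ^ (i + (b - 2) + 1))" for i l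
    unfolding D_def[abs_def] by (rule inv_pow_difference)
  have "tends2 (\<lambda>N. volk_sum N (integrand n b \<epsilon>))
      ((\<Sum>i\<in>?I. ?h i * (\<Sum>k=0..n. ?C k i) * q i) +
       (\<Sum>k=0..n. \<Sum>i=1..2 * b. (?C k i * ?h i) * (\<Sum>l<k. - 4 * of_nat (i + (b - 2)) / (4 * of_nat l + 1) ^ (i + (b - 2) + 1))))"
    unfolding eq by (intro tends2_add tends2_sum tends2_cmult D q) auto
  also have "(\<Sum>k=0..n. \<Sum>i=1..2 * b. (?C k i * ?h i) * (\<Sum>l<k. - 4 * of_nat (i + (b - 2)) / (4 * of_nat l + 1) ^ (i + (b - 2) + 1))) =
      rational_part n b \<epsilon>"
  proof -
    have tail: "(\<Sum>i=1..2 * b. (?C k i * ?h i) * (\<Sum>l<k. - 4 * of_nat (i + (b - 2)) / (4 * of_nat l + 1) ^ (i + (b - 2) + 1))) =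
        4 * of_nat (b - 1) * (\<Sum>m=1..k. tail_part n b \<epsilon> m k)" for k
    proof -
      have "(\<Sum>i=1..2 * b. (?C k i * ?h i) * (\<Sum>l<k. - 4 * of_nat (i + (b - 2)) / (4 * of_nat l + 1) ^ (i + (b - 2) + 1))) =
          (\<Sum>i=1..2 * b. \<Sum>l<k. 4 * of_nat (b - 1) * (?C k i * of_int (hasse_coeff i (b - 1)) / (4 * of_nat l + 1) ^ (i + (b - 1))))"
        unfolding sum_distrib_left
      proof (intro sum.cong refl)
        fix i l assume i: "i \<in> {1..2 * b}"
        have "(int (b - 2) + 1) * hasse_coeff i (Suc (b - 2)) = - int (i + (b - 2)) * hasse_coeff i (b - 2)"
          using i by (intro hasse_coeff_Suc) simp
        moreover have "Suc (b - 2) = b - 1" "int (b - 2) + 1 = int (b - 1)" "i + (b - 2) + 1 = i + (b - 1)" using b by auto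
        ultimately have h: "int (b - 1) * hasse_coeff i (b - 1) = - int (i + (b - 2)) * hasse_coeff i (b - 2)" by simp
        have "(of_int (int (b - 1) * hasse_coeff i (b - 1)) :: rat) = of_int (- int (i + (b - 2)) * hasse_coeff i (b - 2))"
          by (simp only: h)
        then have h': "of_nat (b - 1) * of_int (hasse_coeff i (b - 1)) = - of_nat (i + (b - 2)) * ?h i" by simp
        have "?C k i * ?h i * (- 4 * of_nat (i + (b - 2)) / (4 * of_nat l + 1) ^ (i + (b - 2) + 1)) =
            4 * ?C k i * (- of_nat (i + (b - 2)) * ?h i) / (4 * of_nat l + 1) ^ (i + (b - 2) + 1)"
          by (simp add: mult_ac)
        also have "\<dots> = 4 * ?C k i * (of_nat (b - 1) * of_int (hasse_coeff i (b - 1))) / (4 * of_nat l + 1) ^ (i + (b - 1))"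
          unfolding h'[symmetric] using \<open>i + (b - 2) + 1 = i + (b - 1)\<close> by (simp only:)
        finally show "?C k i * ?h i * (- 4 * of_nat (i + (b - 2)) / (4 * of_nat l + 1) ^ (i + (b - 2) + 1)) =
            4 * of_nat (b - 1) * (?C k i * of_int (hasse_coeff i (b - 1)) / (4 * of_nat l + 1) ^ (i + (b - 1)))"
          by (simp only: times_divide_eq_right mult.assoc mult.left_commute)
      qed
      also have "\<dots> = 4 * of_nat (b - 1) * (\<Sum>l<k. \<Sum>i=1..2 * b. ?C k i * of_int (hasse_coeff i (b - 1)) / (4 * of_nat l + 1) ^ (i + (b - 1)))"
        unfolding sum_distrib_left by (rule sum.swap)
      also have "(\<Sum>l<k. \<Sum>i=1..2 * b. ?C k i * of_int (hasse_coeff i (b - 1)) / (4 * of_nat l + 1) ^ (i + (b - 1))) =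
          (\<Sum>m=1..k. tail_part n b \<epsilon> m k)"
        unfolding tail_part_def
        by (rule sum.reindex_bij_witness[of _ "\<lambda>m. k - m" "\<lambda>l. k - l"]) (auto simp: of_nat_diff)
      finally show ?thesis .
    qed
    have swap: "(\<Sum>k=0..n. \<Sum>m=1..k. tail_part n b \<epsilon> m k) = (\<Sum>m=1..n. \<Sum>k=m..n. tail_part n b \<epsilon> m k)"
      unfolding sum.Sigma[OF finite_atLeastAtMost ballI[OF finite_atLeastAtMost]]
      by (rule sum.reindex_bij_witness[of _ "\<lambda>(m, k). (k, m)" "\<lambda>(k, m). (m, k)"]) auto
    show ?thesis unfolding tail sum_distrib_left[symmetric] swap rational_part_def ..
  qed
  finally show ?thesis .
qed

section \<open>Identification with the zeta values\<close>

text \<open>t + 1/4 is (4t+1)/4 with 4t+1 congruent to 1 modulo 4, so its valuation is -2, the sign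
  is 1, and its Teichmueller character is 1/4.\<close>

lemma angle2_quarter: "angle2 (of_nat t + 1 / 4) = of_rat (4 * of_nat t + 1)"
proof -
  define w where "w = (4 * of_nat t + 1 :: rat)"
  define x where "x = (of_nat t + 1 / 4 :: q2)"
  have w: "rat_abs2 w = 1" unfolding w_def by (rule rat_abs2_odd_linear)
  have x: "x = of_rat (w / 4)"
  proof -
    have "w / 4 = of_nat t + 1 / 4" unfolding w_def by (simp add: add_divide_distrib)
    moreover have "x = of_rat (of_nat t + 1 / 4)" unfolding x_def by (simp add: of_rat_add of_rat_divide)
    ultimately show ?thesis by (simp only:)
  qed
  have nx: "norm2 x = 4" unfolding x by (simp add: rat_abs2_divide w)
  then have "x \<noteq> 0" using norm2_eq_0_iff[of x] by auto
  have "v2 x = - 2"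
    unfolding v2_def by (rule the1_equality[OF norm2_eq_power[OF \<open>x \<noteq> 0\<close>]]) (simp add: nx)
  moreover have "teichmueller_unit (x / 2 powi (- 2)) = 1"
  proof -
    have xw: "x / 2 powi (- 2) = of_rat w"
      by (simp add: x power_int_minus of_rat_divide)
    show ?thesis unfolding xw teichmueller_unit_def
    proof (rule the_equality)
      have "of_rat w - 1 = 4 * (of_nat t :: q2)" by (simp add: w_def of_rat_add of_rat_mult)
      moreover have "(of_nat t :: q2) \<in> Z2"
        using norm2_of_rat[of "of_nat t"] by (simp add: Z2_def del: norm2_of_rat)
      ultimately show "(1 :: q2) \<in> {1, - 1} \<and> (\<exists>y\<in>Z2. of_rat w - 1 = 4 * y)" by blast
    next
      fix e :: q2 assume e: "e \<in> {1, - 1} \<and> (\<exists>y\<in>Z2. of_rat w - e = 4 * y)"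
      show "e = 1"
      proof (rule ccontr)
        \<comment> \<open>For e = -1 the difference is 4t+2, twice an odd number and thus not
          divisible by 4.\<close>
        assume "e \<noteq> 1"
        then obtain y where y: "norm2 y \<le> 1" "of_rat w + 1 = 4 * y" using e by (auto simp: Z2_def)
        have "of_rat w + 1 = (of_rat (2 * of_nat (2 * t + 1)) :: q2)" by (simp add: w_def of_rat_add of_rat_mult)
        then have "norm2 (4 * y) = 1 / 2 * rat_abs2 (of_nat (2 * t + 1))"
          using y(2) by (metis norm2_of_rat rat_abs2_mult rat_abs2_2)
        also have "rat_abs2 (of_nat (2 * t + 1)) = 1" by (rule rat_abs2_odd_nat) simp
        also have "norm2 (4 * y) = 1 / 4 * norm2 y"
          using norm2_of_rat[of 4] by (simp add: norm2_mult)
        finally show False using y(1) by simp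
      qed
    qed
  qed
  ultimately have "angle2 x = x / 2 powi (- 2)" by (simp add: angle2_def teichmueller_def)
  then show ?thesis by (simp add: x_def[symmetric] w_def[symmetric] x power_int_minus of_rat_divide)
qed

lemma volkenborn_quarter:
  "volkenborn_integral (\<lambda>t. angle2 (t + 1 / 4) powi (- int m)) = class_q2 (\<lambda>N. volk_sum N (inv_pow m))"
proof -
  have "angle2 (of_nat t + 1 / 4) powi (- int m) = of_rat (inv_pow m t)" for t
    unfolding angle2_quarter inv_pow_def
    by (simp add: power_int_minus of_rat_divide of_rat_power of_rat_add of_rat_mult of_rat_inverse divide_inverse)
  then have "1 / 2 ^ N * (\<Sum>k<2 ^ N. angle2 (of_nat k + 1 / 4) powi (- int m)) = of_rat (volk_sum N (inv_pow m))" for N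
    by (simp add: volk_sum_def of_rat_divide of_rat_sum of_rat_power)
  then have "volkenborn_integral (\<lambda>t. angle2 (t + 1 / 4) powi (- int m)) = lim (\<lambda>N. of_rat (volk_sum N (inv_pow m)))"
    by (simp add: volkenborn_integral_def)
  also have "\<dots> = class_q2 (\<lambda>N. volk_sum N (inv_pow m))"
    by (rule limI[OF of_rat_tendsto_class_q2[OF cauchy2_volk_sum[OF inv_pow_poly_lim]]])
  finally show ?thesis .
qed

lemma rational_zeta_tends2:
  assumes "hurwitz_zeta2 (int m + 1) (1 / 4) \<in> \<rat>" "m \<ge> 1"
  obtains q where "tends2 (\<lambda>N. volk_sum N (inv_pow m)) q"
proof -
  let ?X = "\<lambda>N. volk_sum N (inv_pow m)"
  have "1 - (int m + 1) = - int m" by simp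
  then have "hurwitz_zeta2 (int m + 1) (1 / 4) = 1 / of_nat m * class_q2 ?X"
    unfolding hurwitz_zeta2_def by (simp only: volkenborn_quarter) simp
  then have "class_q2 ?X = of_nat m * hurwitz_zeta2 (int m + 1) (1 / 4)" using assms(2) by simp
  then have "class_q2 ?X \<in> \<rat>" using assms(1) by simp
  then obtain q where "class_q2 ?X = of_rat q" by (auto elim: Rats_cases)
  then have "null2 (\<lambda>N. ?X N - q)"
    using class_q2_eq_iff[OF cauchy2_volk_sum[OF inv_pow_poly_lim] cauchy2_const] by (simp add: of_rat_q2)
  then show ?thesis using that by (simp add: tends2_def)
qed

section \<open>Comparison of absolute values\<close>

lemma local_int_2_rat_abs2: "x \<in> local_int 2 \<Longrightarrow> rat_abs2 x \<le> 1"
  by (auto simp: local_int_def rat_abs2_divide rat_abs2_odd)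

lemma rat_abs2_fact_lower: "(1 / 2) ^ m \<le> rat_abs2 (fact m)"
proof -
  have "rat_abs2 (2 ^ m / fact m) \<le> 1" by (rule local_int_2_rat_abs2[OF two_power_fact_local])
  then show ?thesis by (simp add: rat_abs2_divide rat_abs2_power rat_abs2_pos pos_divide_le_eq)
qed

lemma rat_abs2_fact_double: "rat_abs2 (fact (2 * m)) \<le> (1 / 2) ^ m * rat_abs2 (fact m)"
proof -
  have "2 ^ m * fact m dvd (fact (2 * m) :: nat)"
  proof (induction m)
    case (Suc m)
    have "(fact (2 * Suc m) :: nat) = 2 * Suc m * (2 * m + 1) * fact (2 * m)" by (simp add: algebra_simps)
    moreover have "(2 :: nat) ^ Suc m * fact (Suc m) = 2 * Suc m * (2 ^ m * fact m)" by (simp add: algebra_simps)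
    ultimately show ?case using mult_dvd_mono[OF dvd_triv_left[of "2 * Suc m" "2 * m + 1"] Suc] by (simp only:)
  qed simp
  then obtain z where "(fact (2 * m) :: nat) = 2 ^ m * fact m * z" by (rule dvdE)
  then have "(fact (2 * m) :: rat) = 2 ^ m * fact m * of_nat z" by (metis of_nat_fact of_nat_mult of_nat_numeral of_nat_power)
  then have "rat_abs2 (fact (2 * m)) = (1 / 2) ^ m * rat_abs2 (fact m) * rat_abs2 (of_nat z)"
    by (simp add: rat_abs2_mult rat_abs2_power)
  also have "\<dots> \<le> (1 / 2) ^ m * rat_abs2 (fact m) * 1" by (intro mult_left_mono) auto
  finally show ?thesis by simp
qed

text \<open>Repeated doubling gives an exponent of at least 2^r - 1 for (2^r)!; removing the last
  factor 2^r costs r. This is only a polynomial loss in 2^r.\<close>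

lemma rat_abs2_fact_dyadic: "rat_abs2 (fact (2 ^ r - 1)) \<le> 2 ^ r * (1 / 2) ^ (2 ^ r - 1)"
proof -
  have "rat_abs2 (fact (2 ^ r)) \<le> (1 / 2) ^ (2 ^ r - 1)"
  proof (induction r)
    case (Suc r)
    have "rat_abs2 (fact (2 ^ Suc r)) \<le> (1 / 2) ^ (2 ^ r) * rat_abs2 (fact (2 ^ r))"
      using rat_abs2_fact_double[of "2 ^ r"] by simp
    also have "\<dots> \<le> (1 / 2) ^ (2 ^ r) * (1 / 2) ^ (2 ^ r - 1)" using Suc by (intro mult_left_mono) auto
    also have "\<dots> = (1 / 2) ^ (2 ^ Suc r - 1)"
    proof -
      have "2 ^ Suc r - 1 = 2 ^ r + (2 ^ r - 1 :: nat)" by simp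
      then show ?thesis by (simp only: power_add)
    qed
    finally show ?case .
  qed simp
  moreover have "(fact (2 ^ r) :: rat) = 2 ^ r * fact (2 ^ r - 1)"
    by (subst fact_reduce) simp_all
  ultimately have "(1 / 2) ^ r * rat_abs2 (fact (2 ^ r - 1)) \<le> (1 / 2) ^ (2 ^ r - 1)"
    by (simp add: rat_abs2_mult rat_abs2_power)
  then have "2 ^ r * ((1 / 2) ^ r * rat_abs2 (fact (2 ^ r - 1))) \<le> 2 ^ r * (1 / 2) ^ (2 ^ r - 1)"
    by (intro mult_left_mono) auto
  moreover have "2 ^ r * ((1 / 2) ^ r * rat_abs2 (fact (2 ^ r - 1))) = rat_abs2 (fact (2 ^ r - 1))"
  proof -
    have "(2 :: real) ^ r * (1 / 2) ^ r = 1" by (simp flip: power_mult_distrib)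
    then show ?thesis by (simp only: mult.assoc[symmetric] mult_1_left)
  qed
  ultimately show ?thesis by (simp only:)
qed

section \<open>The product of the archimedean and the 2-adic size\<close>

lemma int_times_rat_abs2: "z \<noteq> 0 \<Longrightarrow> 1 \<le> real_of_int \<bar>z\<bar> * rat_abs2 (of_int z)"
proof -
  assume z: "z \<noteq> 0"
  have "2 ^ multiplicity 2 z dvd \<bar>z\<bar>" by (simp add: multiplicity_dvd)
  then have "2 ^ multiplicity 2 z \<le> \<bar>z\<bar>" using z by (intro zdvd_imp_le) auto
  then have "real_of_int (2 ^ multiplicity 2 z) \<le> real_of_int \<bar>z\<bar>" by (simp only: of_int_le_iff)
  then show ?thesis using z by (simp add: rat_abs2_of_int power_one_over field_simps)
qed

lemma fact_square_bound: "n \<ge> 1 \<Longrightarrow> (fact n) ^ 2 / fact (2 * n) \<le> 2 * real n / 4 ^ n"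
proof -
  assume n: "n \<ge> 1"
  have "4 ^ n / (2 * real n) \<le> real ((2 * n) choose n)" using n by (intro central_binomial_lower_bound) simp
  also have "real ((2 * n) choose n) = fact (2 * n) / (fact n * fact n)" by (subst binomial_fact) simp_all
  finally show ?thesis using n by (simp add: field_simps power2_eq_square)
qed

text \<open>The exponents of 2 in (n!)^2 and (2n)! agree up to 2r on the side that matters, so their
  quotient has 2-adic absolute value at most 4^r; the quotient d_{2n}/d_n is an integer. What
  remains is 64^(-nb) up to a power of 2^r.\<close>

lemma rat_abs2_multiplier:
  assumes n: "n = 2 ^ r - 1"
  shows "rat_abs2 (multiplier n b) \<le> (1 / 2) ^ (6 * n * b) * ((2 ^ r) ^ 2) ^ b"
proof -
  obtain z where z: "lcm_upto (2 * n) = lcm_upto n * z"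
    using lcm_upto_dvd_mono[of n "2 * n"] by (auto elim: dvdE)
  have m: "multiplier n b = 2 ^ (6 * n * b) * (2 ^ (4 * b)) * ((fact n ^ 2 / fact (2 * n)) * of_nat z) ^ b * of_nat (lcm_upto n) ^ (3 * b - 1)"
    unfolding multiplier_def z by (simp add: power_add)
  have "rat_abs2 (fact n ^ 2 / fact (2 * n)) \<le> (2 ^ r) ^ 2"
  proof -
    have "rat_abs2 (fact n) ^ 2 \<le> (2 ^ r * (1 / 2) ^ n) ^ 2"
      using rat_abs2_fact_dyadic[of r] unfolding n by (intro power_mono) auto
    also have "\<dots> = (2 ^ r) ^ 2 * (1 / 2) ^ (2 * n)" by (simp add: power_mult_distrib power_mult[symmetric] mult.commute)
    also have "\<dots> \<le> (2 ^ r) ^ 2 * rat_abs2 (fact (2 * n))" by (intro mult_left_mono rat_abs2_fact_lower) auto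
    finally show ?thesis by (simp add: rat_abs2_divide rat_abs2_power rat_abs2_pos pos_divide_le_eq)
  qed
  then have "rat_abs2 (fact n ^ 2 / fact (2 * n)) * rat_abs2 (of_nat z) \<le> (2 ^ r) ^ 2 * 1"
    by (intro mult_mono) auto
  then have "(rat_abs2 (fact n ^ 2 / fact (2 * n)) * rat_abs2 (of_nat z)) ^ b \<le> ((2 ^ r) ^ 2) ^ b"
    by (intro power_mono) auto
  then have "(1 / 2) ^ (6 * n * b) * (1 / 2) ^ (4 * b) * (rat_abs2 (fact n ^ 2 / fact (2 * n)) * rat_abs2 (of_nat z)) ^ b *
      rat_abs2 (of_nat (lcm_upto n)) ^ (3 * b - 1) \<le> (1 / 2) ^ (6 * n * b) * 1 * ((2 ^ r) ^ 2) ^ b * 1"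
    by (intro mult_mono power_le_one mult_nonneg_nonneg) auto
  then show ?thesis unfolding m rat_abs2_mult rat_abs2_power rat_abs2_2 by simp
qed

text \<open>The central binomial coefficient takes 4^n out of 64^n, which leaves 16^n. The division
  by d_n^b in the definition reduces the exponent 3b-1 of d_n to 2b-1.\<close>

lemma multiplier_bound:
  assumes nb: "n \<ge> 1" "b \<ge> 1"
  shows "real_of_rat (multiplier n b) \<le>
    64 ^ (n * b) * 16 ^ b * (2 * real n / 4 ^ n) ^ b * (real (lcm_upto (2 * n)) * real (lcm_upto n) ^ 2) ^ b"
    "0 \<le> multiplier n b"
proof -
  define d d2 where "d = real (lcm_upto n)" and "d2 = real (lcm_upto (2 * n))"
  have d: "d \<ge> 1" unfolding d_def using lcm_upto_pos[of n] by (simp add: Suc_leI del: lcm_upto_pos)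
  have d2: "d2 \<ge> 0" by (simp add: d2_def)
  have p: "(2 :: real) ^ (6 * n * b) = 64 ^ (n * b)" "(2 :: real) ^ (4 * b) = 16 ^ b"
    by (simp_all add: power_mult[symmetric] power_mult[of 2 6] power_mult[of 2 4] mult.assoc)
  have of_rat_fact: "real_of_rat (fact m) = fact m" for m by (metis of_nat_fact of_rat_of_nat_eq)
  have "real_of_rat (multiplier n b) = 2 ^ (6 * n * b) * 2 ^ (4 * b) * ((fact n) ^ 2 * d2 / (fact (2 * n) * d)) ^ b * d ^ (3 * b - 1)"
    unfolding multiplier_def d_def d2_def by (simp add: of_rat_mult of_rat_divide of_rat_power power_add of_rat_fact)
  also have "\<dots> = 64 ^ (n * b) * 16 ^ b * ((fact n) ^ 2 / fact (2 * n)) ^ b * (d2 ^ b * d ^ (2 * b - 1))"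
  proof -
    have "3 * b - 1 = b + (2 * b - 1)" using nb by simp
    then have "d ^ (3 * b - 1) = d ^ b * d ^ (2 * b - 1)" by (simp only: power_add)
    then show ?thesis unfolding p using d by (simp add: power_divide power_mult_distrib)
  qed
  also have "\<dots> \<le> 64 ^ (n * b) * 16 ^ b * (2 * real n / 4 ^ n) ^ b * (d2 ^ b * d ^ (2 * b))"
    using d d2 nb by (intro mult_mono power_mono fact_square_bound power_increasing mult_nonneg_nonneg) auto
  also have "d2 ^ b * d ^ (2 * b) = (d2 * d ^ 2) ^ b" by (simp add: power_mult_distrib power_mult)
  finally show "real_of_rat (multiplier n b) \<le>
    64 ^ (n * b) * 16 ^ b * (2 * real n / 4 ^ n) ^ b * (real (lcm_upto (2 * n)) * real (lcm_upto n) ^ 2) ^ b"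
    by (simp add: d_def d2_def)
  show "0 \<le> multiplier n b" unfolding multiplier_def by simp
qed

lemma sum_coeff_bound:
  assumes n: "n \<ge> 1" and b: "b \<ge> 1" and \<epsilon>: "\<epsilon> \<le> 1"
  shows "\<bar>\<Sum>k=0..n. coeff_quot n b \<epsilon> k i\<bar> \<le> of_nat (n + 1) * of_nat ((2 * n + 1) * (4 * n * b) ^ (2 * b))"
proof -
  have "\<bar>\<Sum>k=0..n. coeff_quot n b \<epsilon> k i\<bar> \<le> (\<Sum>k=0..n. of_nat ((2 * n + 1) * (4 * n * b) ^ (2 * b)))"
    by (rule order_trans[OF sum_abs sum_mono]) (rule coeff_quot_bound[OF _ n b \<epsilon>], simp)
  then show ?thesis by simp
qed

text \<open>The denominators 4(k-m) + 1 are nonzero integers, hence at least 1 in absolute value,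
  and the coefficient bound carries over to the sum of at most (n+1)^2 terms.\<close>

lemma rational_part_bound:
  assumes nb: "n \<ge> 1" "b \<ge> 2" "\<epsilon> \<le> 1"
  shows "\<bar>rational_part n b \<epsilon>\<bar> \<le> 4 * of_nat b * (\<Sum>i=1..2 * b. \<bar>of_int (hasse_coeff i (b - 1))\<bar>) *
    (of_nat ((n + 1) ^ 2) * of_nat ((2 * n + 1) * (4 * n * b) ^ (2 * b)))"
proof -
  define H where "H = (\<Sum>i=1..2 * b. \<bar>of_int (hasse_coeff i (b - 1)) :: rat\<bar>)"
  define B where "B = (of_nat ((2 * n + 1) * (4 * n * b) ^ (2 * b)) :: rat)"
  have B0: "B \<ge> 0" by (simp add: B_def)
  have H0: "H \<ge> 0" unfolding H_def by (intro sum_nonneg) simp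
  have tail: "\<bar>tail_part n b \<epsilon> m k\<bar> \<le> B * H" if k: "k \<le> n" for m k
  proof -
    have "\<bar>tail_part n b \<epsilon> m k\<bar> \<le> (\<Sum>i=1..2 * b. B * \<bar>of_int (hasse_coeff i (b - 1))\<bar>)"
      unfolding tail_part_def
    proof (rule order_trans[OF sum_abs sum_mono])
      fix i
      define y where "y = (of_int (4 * (int k - int m) + 1) :: rat)"
      have "1 \<le> \<bar>4 * (int k - int m) + 1\<bar>" by presburger
      then have "(of_int 1 :: rat) \<le> of_int \<bar>4 * (int k - int m) + 1\<bar>" by (simp only: of_int_le_iff)
      then have y: "1 \<le> \<bar>y\<bar>" unfolding y_def by (simp only: of_int_abs of_int_1)
      have "\<bar>coeff_quot n b \<epsilon> k i * of_int (hasse_coeff i (b - 1)) / y ^ (i + (b - 1))\<bar> =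
          \<bar>coeff_quot n b \<epsilon> k i\<bar> * \<bar>of_int (hasse_coeff i (b - 1))\<bar> / \<bar>y\<bar> ^ (i + (b - 1))"
        by (simp only: abs_mult abs_divide power_abs)
      also have "\<dots> \<le> \<bar>coeff_quot n b \<epsilon> k i\<bar> * \<bar>of_int (hasse_coeff i (b - 1))\<bar> / 1"
      proof (rule divide_left_mono)
        show pow: "1 \<le> \<bar>y\<bar> ^ (i + (b - 1))" by (rule one_le_power[OF y])
        show "0 < \<bar>y\<bar> ^ (i + (b - 1)) * 1" using pow by linarith
      qed simp
      also have "\<dots> \<le> B * \<bar>of_int (hasse_coeff i (b - 1))\<bar>"
        unfolding B_def div_by_1 using nb k by (intro mult_right_mono coeff_quot_bound) auto
      finally show "\<bar>coeff_quot n b \<epsilon> k i * of_int (hasse_coeff i (b - 1)) / of_int (4 * (int k - int m) + 1) ^ (i + (b - 1))\<bar> \<le>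
          B * \<bar>of_int (hasse_coeff i (b - 1))\<bar>" unfolding y_def .
    qed
    then show ?thesis by (simp add: H_def sum_distrib_left)
  qed
  have "\<bar>\<Sum>m=1..n. \<Sum>k=m..n. tail_part n b \<epsilon> m k\<bar> \<le> (\<Sum>m=1..n. of_nat (n + 1) * (B * H))"
  proof (rule order_trans[OF sum_abs sum_mono])
    fix m assume m: "m \<in> {1..n}"
    have "\<bar>\<Sum>k=m..n. tail_part n b \<epsilon> m k\<bar> \<le> (\<Sum>k=m..n. B * H)"
      by (rule order_trans[OF sum_abs sum_mono]) (rule tail, simp)
    also have "\<dots> \<le> of_nat (n + 1) * (B * H)"
      using B0 H0 by (simp del: of_nat_Suc, intro mult_right_mono) auto
    finally show "\<bar>\<Sum>k=m..n. tail_part n b \<epsilon> m k\<bar> \<le> of_nat (n + 1) * (B * H)" .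
  qed
  also have "\<dots> = of_nat n * (of_nat (n + 1) * (B * H))" by simp
  also have "\<dots> \<le> of_nat (n + 1) * (of_nat (n + 1) * (B * H))"
    using B0 H0 by (intro mult_right_mono) auto
  finally have "\<bar>\<Sum>m=1..n. \<Sum>k=m..n. tail_part n b \<epsilon> m k\<bar> \<le> of_nat ((n + 1) ^ 2) * (B * H)"
    by (simp only: of_nat_power of_nat_mult power2_eq_square mult.assoc)
  moreover have "(of_nat (b - 1) :: rat) \<le> of_nat b" by simp
  ultimately have "4 * of_nat (b - 1) * \<bar>\<Sum>m=1..n. \<Sum>k=m..n. tail_part n b \<epsilon> m k\<bar> \<le> 4 * of_nat b * (of_nat ((n + 1) ^ 2) * (B * H))"
    by (intro mult_mono) auto
  then have "\<bar>rational_part n b \<epsilon>\<bar> \<le> 4 * of_nat b * (of_nat ((n + 1) ^ 2) * (B * H))"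
    unfolding rational_part_def abs_mult by simp
  then show ?thesis unfolding H_def[symmetric] B_def[symmetric] by (simp only: mult.assoc mult.commute mult.left_commute)
qed

text \<open>The product is a nonzero integer, so \<open>int_times_rat_abs2\<close> applies. The
  exponential factors per copy of b are 16^n from the size of the multiplier, 64^(-n) from its
  2-adic value and 16^(-n) from that of \<open>l\<close>, in total 64^(-n); all else is a power of
  2^r, apart from the lcm factors.\<close>

lemma nonvanishing_bound:
  fixes D :: nat and L l :: rat
  assumes r: "r \<ge> 1" and n: "n = 2 ^ r - 1" and b: "b \<ge> 2" and D: "D > 0" and L: "L \<ge> 0"
    and int: "of_nat D * multiplier n b * l \<in> \<int>"
    and bound: "\<bar>l\<bar> \<le> L * of_nat ((n + 1) ^ 2 * ((2 * n + 1) * (4 * n * b) ^ (2 * b)))"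
    and val: "rat_abs2 l = ((1 / 8) ^ n * rat_abs2 (fact n)) ^ b * (1 / 2) ^ (b - 2) * rat_abs2 (of_nat (b choose 2)) *
      (2 ^ (r + 2)) ^ (b - 2) * 2 ^ r"
  shows "1 \<le> 2 * real D * of_rat L * (2 ^ r) ^ 4 *
    (131072 * real b ^ 2 * (2 ^ r) ^ 7 * (real (lcm_upto (2 * n)) * real (lcm_upto n) ^ 2 / 64 ^ (2 ^ r))) ^ b"
proof -
  define x u P where "x = (2 :: real) ^ r" and "u = (2 :: real) ^ n"
    and "P = real (lcm_upto (2 * n)) * real (lcm_upto n) ^ 2"
  have n1: "n + 1 = 2 ^ r" using n by simp
  have "(2 :: nat) \<le> 2 ^ r" using r power_increasing[of 1 r "2 :: nat"] by simp
  then have n0: "n \<ge> 1" using n1 by linarith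
  have x: "real n + 1 = x" using n1 unfolding x_def by (metis of_nat_1 of_nat_add of_nat_numeral of_nat_power)
  then have x1: "1 \<le> x" by linarith
  have u: "u > 0" by (simp add: u_def)
  have P: "P \<ge> 0" by (simp add: P_def)
  have pw: "(4 :: real) ^ n = u ^ 2" "(8 :: real) ^ n = u ^ 3" "(64 :: real) ^ n = u ^ 6"
    using power_mult[of "2 :: real" 2 n] power_mult[of "2 :: real" 3 n] power_mult[of "2 :: real" 6 n]
    unfolding u_def by (simp_all add: power_mult[symmetric] mult.commute)
  have pw': "(64 :: real) ^ (2 ^ r) = 64 * u ^ 6" unfolding n1[symmetric] by (simp add: pw)
  have fact_pos: "rat_abs2 (fact n) > 0" by (simp add: rat_abs2_pos)
  have "b choose 2 > 0" using b by (simp add: zero_less_binomial)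
  then have "rat_abs2 (of_nat (b choose 2)) > 0" by (intro rat_abs2_pos) simp
  then have "rat_abs2 l > 0" unfolding val using fact_pos by (intro mult_pos_pos zero_less_power) auto
  then have l0: "l \<noteq> 0" by auto
  obtain z where z: "of_nat D * multiplier n b * l = of_int z" using int by (auto elim: Ints_cases)
  have m0: "multiplier n b \<ge> 0" using multiplier_bound(2)[OF n0] b by simp
  have m1: "multiplier n b \<noteq> 0"
    unfolding multiplier_def using lcm_upto_pos[of n] lcm_upto_pos[of "2 * n"] by (simp del: lcm_upto_pos)
  have "z \<noteq> 0" using z D l0 m1 by auto
  then have "1 \<le> real_of_int \<bar>z\<bar> * rat_abs2 (of_int z)" by (rule int_times_rat_abs2)
  also have "real_of_int \<bar>z\<bar> = of_rat (of_nat D * multiplier n b * \<bar>l\<bar>)"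
  proof -
    have "of_int \<bar>z\<bar> = of_nat D * multiplier n b * \<bar>l\<bar>"
      using m0 by (simp add: z[symmetric] abs_mult)
    then show ?thesis by (metis of_rat_of_int_eq)
  qed
  also have "\<dots> = real D * of_rat (multiplier n b) * of_rat \<bar>l\<bar>" by (simp add: of_rat_mult)
  also have "rat_abs2 (of_int z) = rat_abs2 (of_nat D) * rat_abs2 (multiplier n b) * rat_abs2 l"
    unfolding z[symmetric] rat_abs2_mult ..
  also have "real D * of_rat (multiplier n b) * of_rat \<bar>l\<bar> * (rat_abs2 (of_nat D) * rat_abs2 (multiplier n b) * rat_abs2 l) \<le>
    real D * ((64 ^ n) ^ b * 16 ^ b * (2 * x / 4 ^ n) ^ b * P ^ b) * (of_rat L * (x ^ 2 * (2 * x * ((4 * x * b) ^ 2) ^ b))) *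
    (1 * (((1 / 64) ^ n) ^ b * (x ^ 2) ^ b) * (((1 / 8) ^ n * (x * (1 / 2) ^ n)) ^ b * 1 * 1 * (4 * x) ^ b * x))"
  proof (intro mult_mono mult_nonneg_nonneg)
    have "(2 * real n / 4 ^ n) ^ b \<le> (2 * x / 4 ^ n) ^ b"
      using x by (intro power_mono divide_right_mono) auto
    then have "64 ^ (n * b) * 16 ^ b * (2 * real n / 4 ^ n) ^ b * P ^ b \<le> (64 ^ n) ^ b * 16 ^ b * (2 * x / 4 ^ n) ^ b * P ^ b"
      unfolding power_mult using P by (intro mult_right_mono mult_left_mono) auto
    then show "of_rat (multiplier n b) \<le> (64 ^ n) ^ b * 16 ^ b * (2 * x / 4 ^ n) ^ b * P ^ b"
      using multiplier_bound(1)[OF n0, of b] b unfolding P_def by linarith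
    have "(of_rat \<bar>l\<bar> :: real) \<le> of_rat (L * of_nat ((n + 1) ^ 2 * ((2 * n + 1) * (4 * n * b) ^ (2 * b))))"
      using bound by (simp only: of_rat_less_eq)
    also have "\<dots> = of_rat L * ((real n + 1) ^ 2 * ((2 * real n + 1) * ((4 * real n * b) ^ 2) ^ b))"
      by (simp only: of_rat_mult of_rat_of_nat_eq) (simp only: of_nat_mult of_nat_power of_nat_add of_nat_numeral of_nat_1 power_mult)
    also have "\<dots> \<le> of_rat L * (x ^ 2 * (2 * x * ((4 * x * b) ^ 2) ^ b))"
      using x L by (intro mult_left_mono mult_mono power_mono) (auto simp: zero_le_of_rat_iff)
    finally show "of_rat \<bar>l\<bar> \<le> of_rat L * (x ^ 2 * (2 * x * ((4 * x * b) ^ 2) ^ b))" .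
    have "(1 / 2 :: real) ^ (6 * n * b) = ((1 / 64) ^ n) ^ b"
      by (simp add: power_one_over power_mult)
    then show "rat_abs2 (multiplier n b) \<le> ((1 / 64) ^ n) ^ b * (x ^ 2) ^ b"
      using rat_abs2_multiplier[OF n, of b] unfolding x_def by simp
    have f: "rat_abs2 (fact n) \<le> x * (1 / 2) ^ n" unfolding n x_def by (rule rat_abs2_fact_dyadic)
    have "(4 * x) ^ (b - 2) \<le> (4 * x) ^ b" using x1 by (intro power_increasing) auto
    then show "rat_abs2 l \<le> ((1 / 8) ^ n * (x * (1 / 2) ^ n)) ^ b * 1 * 1 * (4 * x) ^ b * x"
      unfolding val using f x1 fact_pos
      by (intro mult_mono power_mono mult_nonneg_nonneg power_le_one) (auto simp: x_def)
  qed (use D L P x1 m0 in \<open>auto simp: zero_le_of_rat_iff\<close>)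
  also have "\<dots> = 2 * real D * of_rat L * x ^ 4 *
      (64 ^ n * 16 * (2 * x / 4 ^ n) * P * (4 * x * b) ^ 2 * (1 / 64) ^ n * x ^ 2 * ((1 / 8) ^ n * (x * (1 / 2) ^ n)) * (4 * x)) ^ b"
    unfolding power_mult_distrib[of _ _ b] by (simp only: power2_eq_square power4_eq_xxxx mult_1_left mult_1_right mult.assoc mult.commute mult.left_commute)
  \<comment> \<open>131072 = 16 * 2 * 16 * 4 * 64, where the last 64 appears because 64^n is
    replaced by 64^(n+1) with n+1 = 2^r.\<close>
  also have "64 ^ n * 16 * (2 * x / 4 ^ n) * P * (4 * x * b) ^ 2 * (1 / 64) ^ n * x ^ 2 * ((1 / 8) ^ n * (x * (1 / 2) ^ n)) * (4 * x) =
      131072 * real b ^ 2 * x ^ 7 * (P / 64 ^ (2 ^ r))"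
    unfolding pw' power_one_over pw u_def[symmetric] using u by (simp add: field_simps) (simp add: eval_nat_numeral)
  finally show ?thesis unfolding x_def P_def .
qed

section \<open>Conclusion\<close>

lemma power_times_exp_small:
  fixes c \<eta> K :: real
  assumes "\<eta> > 0"
  shows "\<exists>r0. \<forall>r\<ge>r0. K * (2 ^ r) ^ 11 * exp (- \<eta> * 2 ^ r) < 1"
proof -
  have "((\<lambda>y :: real. y ^ 11 / exp y) \<longlongrightarrow> 0) at_top" by (rule tendsto_power_div_exp_0)
  moreover have "filterlim (\<lambda>r. 2 ^ r :: real) at_top sequentially"
    by (rule filterlim_at_top_mono[OF filterlim_real_sequentially]) (simp add: of_nat_less_two_power less_imp_le)
  then have "filterlim (\<lambda>r. \<eta> * 2 ^ r) at_top sequentially"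
    using assms by (intro filterlim_tendsto_pos_mult_at_top[OF tendsto_const])
  ultimately have "(\<lambda>r. (\<eta> * 2 ^ r) ^ 11 / exp (\<eta> * 2 ^ r)) \<longlonglongrightarrow> 0" by (rule filterlim_compose)
  then have "(\<lambda>r. K / \<eta> ^ 11 * ((\<eta> * 2 ^ r) ^ 11 / exp (\<eta> * 2 ^ r))) \<longlonglongrightarrow> 0" by (rule tendsto_mult_right_zero)
  moreover have "K / \<eta> ^ 11 * ((\<eta> * 2 ^ r) ^ 11 / exp (\<eta> * 2 ^ r)) = K * (2 ^ r) ^ 11 * exp (- \<eta> * 2 ^ r)" for r
    using assms by (simp add: power_mult_distrib exp_minus field_simps)
  ultimately have "(\<lambda>r. K * (2 ^ r) ^ 11 * exp (- \<eta> * 2 ^ r)) \<longlonglongrightarrow> 0" by simp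
  from order_tendstoD(2)[OF this, of 1] show ?thesis by (simp add: eventually_sequentially)
qed

lemma multiplier_limit_Ints:
  fixes D :: nat
  assumes n: "n \<ge> 1" and b: "b \<ge> 2" and \<epsilon>: "\<epsilon> \<le> 1" and I: "I \<subseteq> {1..2 * b}"
    and q: "\<And>i. i \<in> I \<Longrightarrow> of_nat D * q i \<in> \<int>"
  shows "of_nat D * multiplier n b * ((\<Sum>i\<in>I. of_int (hasse_coeff i (b - 2)) * (\<Sum>k=0..n. coeff_quot n b \<epsilon> k i) * q i) +
     rational_part n b \<epsilon>) \<in> \<int>"
proof -
  let ?S = "\<lambda>i. \<Sum>k=0..n. coeff_quot n b \<epsilon> k i"
  let ?T = "\<Sum>m=1..n. \<Sum>k=m..n. tail_part n b \<epsilon> m k"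
  have "of_nat D * multiplier n b * (of_int (hasse_coeff i (b - 2)) * ?S i * q i) \<in> \<int>" if i: "i \<in> I" for i
  proof -
    have "multiplier n b * ?S i \<in> \<int>"
      unfolding sum_distrib_left using i I by (intro Ints_sum multiplier_coeff_Ints[OF n b \<epsilon>]) auto
    then have "of_int (hasse_coeff i (b - 2)) * (multiplier n b * ?S i) * (of_nat D * q i) \<in> \<int>"
      by (intro Ints_mult[OF Ints_mult[OF Ints_of_int] q[OF i]])
    then show ?thesis by (simp only: mult.assoc mult.commute mult.left_commute)
  qed
  then have "of_nat D * multiplier n b * (\<Sum>i\<in>I. of_int (hasse_coeff i (b - 2)) * ?S i * q i) \<in> \<int>"
    unfolding sum_distrib_left by (intro Ints_sum)
  moreover have "of_nat D * multiplier n b * rational_part n b \<epsilon> \<in> \<int>"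
  proof -
    have "multiplier n b * ?T \<in> \<int>"
      unfolding sum_distrib_left[of "multiplier n b" _ "{1..n}"] by (intro Ints_sum multiplier_tail_Ints[OF n b \<epsilon>])
    then have "of_nat D * (4 * of_nat (b - 1)) * (multiplier n b * ?T) \<in> \<int>"
      by (rule Ints_mult[rotated]) (intro Ints_mult Ints_of_nat Ints_numeral)
    then show ?thesis unfolding rational_part_def by (simp only: mult.assoc mult.commute mult.left_commute)
  qed
  ultimately show ?thesis unfolding distrib_left by (rule Ints_add)
qed

lemma rat_common_denominator:
  assumes "finite I"
  obtains D :: nat where "D > 0" "\<And>i. i \<in> I \<Longrightarrow> of_nat D * (q i :: rat) \<in> \<int>"
proof
  let ?e = "\<lambda>i. nat (snd (quotient_of (q i)))"
  show "(\<Prod>i\<in>I. ?e i) > 0" by (intro prod_pos) (simp add: quotient_of_denom_pos')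
  fix i assume i: "i \<in> I"
  obtain a c where ac: "quotient_of (q i) = (a, c)" by (cases "quotient_of (q i)") auto
  have c: "c > 0" by (rule quotient_of_denom_pos[OF ac])
  have "(\<Prod>i\<in>I. ?e i) = ?e i * (\<Prod>j\<in>I - {i}. ?e j)" by (rule prod.remove[OF assms i])
  then have "of_nat (\<Prod>i\<in>I. ?e i) * q i = of_nat (\<Prod>j\<in>I - {i}. ?e j) * (of_int c * q i)"
    using ac c by (simp del: of_nat_prod)
  also have "of_int c * q i = of_int a" using quotient_of_div[OF ac] c by simp
  finally show "of_nat (\<Prod>i\<in>I. ?e i) * q i \<in> \<int>" by (simp del: of_nat_prod)
qed

theorem no_rational_limits:
  assumes b: "b \<ge> 2" and \<epsilon>: "\<epsilon> \<le> 1"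
    and q: "\<And>i. i \<in> {2..2 * b} \<Longrightarrow> even (i + \<epsilon>) \<Longrightarrow> tends2 (\<lambda>N. volk_sum N (inv_pow (i + (b - 2)))) (q i)"
  shows False
proof -
  define I where "I = {i. i \<in> {2..2 * b} \<and> even (i + \<epsilon>)}"
  have I: "finite I" "I \<subseteq> {1..2 * b}" by (auto simp: I_def)
  obtain D :: nat where D: "D > 0" "\<And>i. i \<in> I \<Longrightarrow> of_nat D * q i \<in> \<int>"
    by (rule rat_common_denominator[OF I(1), where q = q]) blast
  \<comment> \<open>\<open>L\<close> and the denominator \<open>D\<close> depend only on b,
    \<epsilon> and the limits q, not on r, which is chosen afterwards.\<close>
  define L where "L = (\<Sum>i\<in>I. \<bar>of_int (hasse_coeff i (b - 2)) * q i\<bar>) +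
    4 * of_nat b * (\<Sum>i=1..2 * b. \<bar>of_int (hasse_coeff i (b - 1))\<bar>)"
  have L0: "L \<ge> 0" unfolding L_def by (intro add_nonneg_nonneg sum_nonneg mult_nonneg_nonneg) auto
  define K C where "K = 2 * real D * of_rat L + 1" and "C = 131072 * real b ^ 2"
  have K: "K \<ge> 1" "2 * real D * of_rat L \<le> K" and C: "C \<ge> 0" using L0 by (auto simp: K_def C_def zero_le_of_rat_iff)
  obtain \<eta> where \<eta>: "\<eta> > 0"
    "\<And>r0. \<exists>r\<ge>r0. 2 * ln (real (lcm_upto (2 ^ r))) + ln (real (lcm_upto (2 ^ Suc r))) \<le> (6 * ln 2 - \<eta>) * 2 ^ r"
    using lcm_upto_dyadic_bound by blast
  obtain r0 where r0: "\<And>r. r \<ge> r0 \<Longrightarrow> K * C * (2 ^ r) ^ 11 * exp (- \<eta> * 2 ^ r) < 1"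
    using power_times_exp_small[OF \<eta>(1), of "K * C"] by blast
  obtain r where r: "r \<ge> max r0 1"
    and lcm: "2 * ln (real (lcm_upto (2 ^ r))) + ln (real (lcm_upto (2 ^ Suc r))) \<le> (6 * ln 2 - \<eta>) * 2 ^ r"
    using \<eta>(2) by blast
  define n where "n = (2 :: nat) ^ r - 1"
  have "(2 :: nat) \<le> 2 ^ r" using r power_increasing[of 1 r "2 :: nat"] by simp
  then have n: "n \<ge> 1" "n \<le> 2 ^ r" "2 * n \<le> 2 ^ Suc r" by (auto simp: n_def)
  define P where "P = real (lcm_upto (2 * n)) * real (lcm_upto n) ^ 2"
  define x where "x = (2 :: real) ^ r"
  have x: "x \<ge> 1" by (simp add: x_def)
  have mono: "real (lcm_upto m) \<le> real (lcm_upto m')" if "m \<le> m'" for m m'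
    using dvd_imp_le[OF lcm_upto_dvd_mono[OF that] lcm_upto_pos] by simp
  have pos: "real (lcm_upto m) > 0" for m using lcm_upto_pos[of m] by (simp del: lcm_upto_pos)
  have "P \<le> real (lcm_upto (2 ^ Suc r)) * real (lcm_upto (2 ^ r)) ^ 2"
    unfolding P_def using n by (intro mult_mono power_mono mono) auto
  also have "\<dots> = exp (2 * ln (real (lcm_upto (2 ^ r))) + ln (real (lcm_upto (2 ^ Suc r))))"
    using pos[of "2 ^ r"] pos[of "2 ^ Suc r"] by (simp add: exp_add exp_double)
  also have "\<dots> \<le> exp ((6 * ln 2 - \<eta>) * 2 ^ r)" using lcm by simp
  also have "\<dots> = 64 ^ (2 ^ r) * exp (- \<eta> * x)"
  proof -
    have "exp (6 * ln 2 * 2 ^ r) = (exp (6 * ln 2) :: real) ^ (2 ^ r)"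
      by (simp add: exp_of_nat_mult[symmetric] mult.commute)
    also have "exp (6 * ln 2) = (64 :: real)" using exp_of_nat_mult[of 6 "ln 2 :: real"] by simp
    finally show ?thesis by (simp add: x_def left_diff_distrib exp_diff exp_minus field_simps)
  qed
  finally have P: "P / 64 ^ (2 ^ r) \<le> exp (- \<eta> * x)" by (simp add: field_simps)
  have P0: "P / 64 ^ (2 ^ r) \<ge> 0" by (simp add: P_def)
  define l where "l = (\<Sum>i\<in>I. of_int (hasse_coeff i (b - 2)) * (\<Sum>k=0..n. coeff_quot n b \<epsilon> k i) * q i) + rational_part n b \<epsilon>"
  have lim: "tends2 (\<lambda>N. volk_sum N (integrand n b \<epsilon>)) l"
    using volk_sum_integrand_tends[OF n(1) b \<epsilon> q] by (simp add: l_def I_def)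
  have "\<bar>l\<bar> \<le> L * of_nat ((n + 1) ^ 2 * ((2 * n + 1) * (4 * n * b) ^ (2 * b)))"
  proof -
    let ?B = "(2 * n + 1) * (4 * n * b) ^ (2 * b)"
    have "\<bar>of_int (hasse_coeff i (b - 2)) * (\<Sum>k=0..n. coeff_quot n b \<epsilon> k i) * q i\<bar> \<le>
        \<bar>of_int (hasse_coeff i (b - 2)) * q i\<bar> * of_nat ((n + 1) ^ 2 * ?B)" for i
    proof -
      have "\<bar>\<Sum>k=0..n. coeff_quot n b \<epsilon> k i\<bar> \<le> of_nat ((n + 1) * ?B)"
        using sum_coeff_bound[OF n(1) _ \<epsilon>, of b i] b by (simp only: of_nat_mult)
      also have "\<dots> \<le> of_nat ((n + 1) ^ 2 * ?B)"
        unfolding of_nat_le_iff by (intro mult_right_mono) (simp_all add: power2_eq_square)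
      finally have "\<bar>of_int (hasse_coeff i (b - 2)) * q i\<bar> * \<bar>\<Sum>k=0..n. coeff_quot n b \<epsilon> k i\<bar> \<le>
          \<bar>of_int (hasse_coeff i (b - 2)) * q i\<bar> * of_nat ((n + 1) ^ 2 * ?B)" by (rule mult_left_mono) simp
      then show ?thesis by (simp only: abs_mult mult.assoc mult.commute mult.left_commute)
    qed
    then have "\<bar>\<Sum>i\<in>I. of_int (hasse_coeff i (b - 2)) * (\<Sum>k=0..n. coeff_quot n b \<epsilon> k i) * q i\<bar> \<le>
        (\<Sum>i\<in>I. \<bar>of_int (hasse_coeff i (b - 2)) * q i\<bar>) * of_nat ((n + 1) ^ 2 * ?B)"
      unfolding sum_distrib_right by (intro order_trans[OF sum_abs sum_mono])
    moreover have "\<bar>rational_part n b \<epsilon>\<bar> \<le> 4 * of_nat b * (\<Sum>i=1..2 * b. \<bar>of_int (hasse_coeff i (b - 1))\<bar>) * of_nat ((n + 1) ^ 2 * ?B)"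
      using rational_part_bound[OF n(1) b \<epsilon>] by (simp only: of_nat_mult)
    ultimately show ?thesis unfolding l_def L_def distrib_right by linarith
  qed
  moreover have "of_nat D * multiplier n b * l \<in> \<int>"
    unfolding l_def by (rule multiplier_limit_Ints[OF n(1) b \<epsilon> I(2) D(2)])
  moreover have r1: "r \<ge> 1" using r by simp
  have "rat_abs2 l = ((1 / 8) ^ n * rat_abs2 (fact n)) ^ b * (1 / 2) ^ (b - 2) * rat_abs2 (of_nat (b choose 2)) *
      (2 ^ (r + 2)) ^ (b - 2) * 2 ^ r"
    by (rule tends2_rat_abs2[OF lim rat_abs2_volk_sum_integrand[OF r1 n_def b]])
  ultimately have one: "1 \<le> 2 * real D * of_rat L * x ^ 4 * (C * x ^ 7 * (P / 64 ^ (2 ^ r))) ^ b"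
    unfolding x_def C_def P_def by (intro nonvanishing_bound r1 n_def b D(1) L0)
  define W where "W = C * x ^ 7 * (P / 64 ^ (2 ^ r))"
  have W0: "W \<ge> 0" unfolding W_def using C x P0 by (intro mult_nonneg_nonneg) auto
  have WE: "W \<le> C * x ^ 7 * exp (- \<eta> * x)" unfolding W_def using C x P by (intro mult_left_mono) auto
  have "K * x ^ 4 * W \<le> K * x ^ 4 * (C * x ^ 7 * exp (- \<eta> * x))" using K x by (intro mult_left_mono WE) auto
  also have "\<dots> = K * C * x ^ 11 * exp (- \<eta> * x)" by (simp add: eval_nat_numeral)
  also have "\<dots> < 1" using r0[of r] r unfolding x_def by simp
  finally have small: "K * x ^ 4 * W < 1" .
  have "1 * 1 * W \<le> K * x ^ 4 * W" using K x W0 by (intro mult_right_mono mult_mono) auto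
  then have "W \<le> 1" using small by simp
  then have "W ^ b \<le> W" using W0 b power_decreasing[of 1 b W] by simp
  then have "2 * real D * of_rat L * x ^ 4 * W ^ b \<le> K * x ^ 4 * W"
    using K x W0 L0 by (intro mult_mono) (auto simp: zero_le_of_rat_iff)
  then show False using one small unfolding W_def by linarith
qed

theorem theorem1p2:
  fixes s :: nat and \<delta> :: int
  assumes "\<delta> \<in> {0, 1}"
  shows "\<exists>z \<in> {hurwitz_zeta2 j (1 / 4) | j :: int.
            j \<in> {int s + 3 .. 3 * int s + 5} \<and> [j = \<delta>] (mod 2)}. z \<notin> \<rat>"
proof (rule ccontr)
  assume "\<not> ?thesis"
  then have rat: "hurwitz_zeta2 j (1 / 4) \<in> \<rat>"
    if "j \<in> {int s + 3 .. 3 * int s + 5}" "[j = \<delta>] (mod 2)" for j using that by blast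
  \<comment> \<open>A pole of order i contributes the zeta value with j = i + s + 1. Thus i in
    [2, 2s+4] corresponds to j in [s+3, 3s+5], and i + \<epsilon> even to j congruent to \<delta>
    modulo 2.\<close>
  define \<epsilon> where "\<epsilon> = nat ((int s + 1 + \<delta>) mod 2)"
  have \<epsilon>: "int \<epsilon> = (int s + 1 + \<delta>) mod 2" by (simp add: \<epsilon>_def)
  then have \<epsilon>1: "\<epsilon> \<le> 1" by linarith
  have "\<exists>q. tends2 (\<lambda>N. volk_sum N (inv_pow (i + s))) q" if i: "i \<in> {2..2 * (s + 2)}" "even (i + \<epsilon>)" for i
  proof -
    have "[int (i + s) + 1 = \<delta>] (mod 2)"
      using i(2) \<epsilon> unfolding cong_def by presburger
    then have "hurwitz_zeta2 (int (i + s) + 1) (1 / 4) \<in> \<rat>" using i(1) by (intro rat) auto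
    then show ?thesis using i(1) rational_zeta_tends2[of "i + s"] by auto
  qed
  then obtain q where "\<And>i. i \<in> {2..2 * (s + 2)} \<Longrightarrow> even (i + \<epsilon>) \<Longrightarrow> tends2 (\<lambda>N. volk_sum N (inv_pow (i + s))) (q i)"
    by metis
  with no_rational_limits[of "s + 2" \<epsilon> q] \<epsilon>1 show False by simp
qed

end
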